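(* Let $A$ be a gentle algebra realised by a graded marked ribbon surface $\mathbf S^{\mathcal F}$, and let $\tilde c$ be an admissible curve in $\widetilde{\mathrm{AC}}_{\mathfrak m}(\mathbf S^{\mathcal F})$. Then, for any $n\in\mathbb Z$, there are integers $r_i$ and $s_i$ with $0\le r_i\le s_i\le m(c_{\mathrm{proj}}(D_i))+1$, $1\le i\le n(\tilde c)$, such that $$\mathfrak M^{-1}(\mathrm H^n(\mathfrak X(\tilde c)))=\overrightarrow{\bigsqcup_{n=-\varsigma_i^{\tilde c}}}\ \mathfrak T_{r_i}^{s_i}(c_{\mathrm{proj}}(D_i)),$$ where $\mathfrak T_{r_i}^{s_i}(c_{\mathrm{proj}}(D_i))$ are truncations of the projective permissible curves $c_{\mathrm{proj}}(D_i)$ and the right-hand side is the completion of their supplemental union.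
   Context: Modules are finite-dimensional right modules over an algebraically closed field $\Bbbk$; paths are composed left to right; $P(v)=e_vA$, so a path $\wp$ from $v$ to $w$ induces a map $P(w)\to P(v)$. Gentle algebra: $A=\Bbbk\mathcal Q/\mathcal I$ finite-dimensional, where each vertex is source and target of at most two arrows; for each arrow $\alpha$ there is at most one arrow $\beta$ with $\alpha\beta\in\mathcal I$ and at most one composable $\beta$ with $\alpha\beta\notin\mathcal I$, and dually on the left; $\mathcal I$ is admissible and generated by paths of length 2. Surface of $A$: a compact oriented surface $\mathcal S$ with non-empty boundary and finite sets $\mathcal M$ ($\bullet$-points) and $\mathcal Y$ ($\circ$-points) on $\partial\mathcal S$, alternating along boundary components. $\Delta_\bullet$ is a set of curves with endpoints in $\mathcal M$ ($\bullet$-arcs), pairwise disjoint in the interior, cutting $\mathcal S$ into elementary $\bullet$-polygons, each having exactly one edge in $\partial\mathcal S$; also allowed are $\infty$-elementary polygons, all of whose edges are $\bullet$-arcs and which enclose a boundary component without $\bullet$-points. $\Delta_\circ$ is the dual system of curves with endpoints in $\mathcal Y$ ($\circ$-arcs): each $\circ$-arc meets exactly one $\bullet$-arc (its dual), exactly once. $\Delta_\circ$ cuts $\mathcal S$ into elementary $\circ$-polygons, each containing exactly one $\bullet$-point. Extra marked points ($\mathcal E$) are the $\circ$-points lying in digons of $\Delta_\bullet$. The algebra: vertices of $\mathcal Q$ are the $\bullet$-arcs (write $\mathfrak v(a)$); if two edges $a^1,a^2$ of an elementary $\bullet$-polygon share an endpoint $p\in\mathcal M$ as consecutive edges and $a^2$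 is to the left of $a^1$ at $p$ (counterclockwise around $p$), there is an arrow $\mathfrak v(a^1)\to\mathfrak v(a^2)$; $\mathcal I$ is generated by the $\alpha\beta$ for which the arcs of $s(\alpha)$, $t(\alpha)=s(\beta)$, $t(\beta)$ are edges of the same polygon. Every gentle algebra arises this way. Curves are taken up to homotopy and in minimal position. Permissible curve: a curve $c$ that is a concatenation of segments $c_{(0,1)},\dots,c_{(m,m+1)}$, $m=m(c)$, crossing $\bullet$-arcs $a^c_1,\dots,a^c_m$, adjacent segments being different. Each middle segment lies in one elementary $\bullet$-polygon, joins two edges sharing a vertex $p\in\mathcal M$ and cuts off the corner at $p$. Each end segment lies in one elementary $\bullet$-polygon $\mathcal P$ and joins the crossed edge $a$ either to the vertex of $\mathcal P$ that is the other endpoint of a $\bullet$-arc edge of $\mathcal P$ adjacent to $a$, or, if $\mathcal P$ is a digon, to the extra marked point in it. Curves crossing the same arcs through the same middle segments, and $c$ and $c^{-1}$, are identified. A curve crossing no $\bullet$-arc is trivial. $\mathfrak M(c)$ is the string module of the string $\mathfrak v(a^c_1)-\cdots-\mathfrak v(a^c_m)$ whose letters are the arrows given by the cut-off corners ($\mathfrak M$ of a trivial curve is $0$). For a module $M\cong\bigoplus_j\mathfrak M(c_j)$ with $c_j$ non-trivial permissible curves, $\mathfrak M^{-1}(M)$ is the (multi)set $\{c_j\}$; trivial curves are disregarded in such sets. Projective permissible curve $c_{\mathrm{proj}}(a)$ of a $\bullet$-arc $a$: the permissible curve $p$ with $a=a^p_i$ for a unique $i$ such that $a^p_1,\dots,a^p_i$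 share an endpoint $x$ to the right of $p$ and no $\bullet$-arc at $x$ is to the left of $a^p_1$, and $a^p_i,\dots,a^p_m$ share an endpoint $y$ to the left of $p$ and no $\bullet$-arc at $y$ is to the left of $a^p_m$. Then $\mathfrak M(c_{\mathrm{proj}}(a))\cong P(\mathfrak v(a))$. Admissible curve: a curve $c$, with grading $\tilde c$, that is a concatenation of segments $c_{[i,i+1]}$ ($0\le i\le n(\tilde c)$), $c_{[i,i+1]}$ lying in an elementary $\circ$-polygon $\mathcal P_i$, successively crossing $\circ$-arcs $a_{\circ,1},\dots,a_{\circ,n(\tilde c)}$, adjacent segments being different; end segments join the $\bullet$-point of a $\circ$-polygon to a crossed $\circ$-arc. $\widetilde{\mathrm{AC}}_{\mathfrak m}(\mathbf S^{\mathcal F})$ is the set of admissible curves having both endpoints in $\mathcal M$, or having exactly one endpoint, which lies in $\mathcal M$ (the other end then spirals infinitely around a boundary component without $\bullet$-points). Let $D_i$ be the $\bullet$-arc dual to $a_{\circ,i}$ and $\varsigma_i^{\tilde c}\in\mathbb Z$ the intersection index of $\tilde c$ with $\tilde a_{\circ,i}$ at the $i$-th crossing. If the $\bullet$-point of $\mathcal P_i$ is to the left of $c_{[i,i+1]}$, then $\wp_i$ is the path from $\mathfrak v(D_i)$ to $\mathfrak v(D_{i+1})$ around that point and $\varsigma_{i+1}=\varsigma_i+1$; if it is to the right, $\wp_i$ is the path from $\mathfrak v(D_{i+1})$ to $\mathfrak v(D_i)$ and $\varsigma_{i+1}=\varsigma_i-1$. A grading amounts to a choice of one $\varsigma_i$.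 The complex $\mathfrak X(\tilde c)$ has $n$-th term $\bigoplus_{\varsigma_i=-n}P(\mathfrak v(D_i))$ and differential whose components are the maps induced by the paths $\wp_i$. Truncations: for a permissible curve $p$ and $0\le t\le t'\le m(p)+1$, $\mathfrak T_t^{t'}(p)$ is the part of $p$ consisting of the segments $p_{(i,i+1)}$, $t\le i\le t'-1$, i.e. the part cut out by $a^p_t$ and $a^p_{t'}$, where $a^p_0=p(0)$, $a^p_{m(p)+1}=p(1)$; for $t=t'$ it is a point. For $t>t'$ the truncation is trivial (empty). The completion $\hat s$ of a sequence of consecutive segments $s$ is the permissible curve crossing exactly the $\bullet$-arcs met by $s$ and having the corresponding segments of $s$ as middle segments (for a single point on an arc $a$: the curve crossing only $a$; for a point not on a $\bullet$-arc, the trivial curve). Supplemental union with respect to $\tilde c$: let $\tau_1$ be a truncation of $c_{\mathrm{proj}}(D_{i-1})$ and $\tau_2$ a truncation of $c_{\mathrm{proj}}(D_{i+1})$, where the $\bullet$-point $\mathfrak m_1$ of $\mathcal P_{i-1}$ is to the left of $c_{[i-1,i]}$ and the $\bullet$-point $\mathfrak m_2$ of $\mathcal P_i$ is to the right of $c_{[i,i+1]}$. On $c_{\mathrm{proj}}(D_{i-1})$, let $b_1$ be the $\bullet$-arc at $\mathfrak m_1$ crossed immediately before $D_i$ (coming from $D_{i-1}$) and $s_{\mathrm I}$ the segment between $b_1$ and $D_i$; on $c_{\mathrm{proj}}(D_{i+1})$, let $b_2$ be the $\bullet$-arc at $\mathfrak m_2$ crossed immediately before $D_i$ (coming from $D_{i+1}$)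 and $s_{\mathrm{II}}$ the segment between $b_2$ and $D_i$. If $\tau_1$ ends on $D_i$ and $\tau_2$ ends on $b_2$, the supplemental union is $\tau_1\cup s_{\mathrm{II}}\cup\tau_2$; if $\tau_1$ ends on $b_1$ and $\tau_2$ ends on $D_i$, it is $\tau_1\cup s_{\mathrm I}\cup\tau_2$. Similarly, if $s^\star$ is the one-point truncation of $c_{\mathrm{proj}}(D_i)$ at $D_i$, $s$ ends on $b_1$ and $s'$ ends on $b_2$, then the supplemental unions of $s,s^\star$, of $s^\star,s'$ and of $s,s^\star,s'$ are $s\cup s_{\mathrm I}\cup s^\star$, $s^\star\cup s_{\mathrm{II}}\cup s'$ and $s\cup s_{\mathrm I}\cup s^\star\cup s_{\mathrm{II}}\cup s'$. In all other cases the supplemental union is the collection $\{\tau_1,\tau_2\}$. For several truncations it is formed inductively, in the order of the indices $i$. The symbol $\overrightarrow{\bigsqcup}$ denotes the (collection of) completion(s) of the supplemental union. *)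

theory Defs
  imports
    "HOL-Algebra.QuotRing"
    "HOL-Computational_Algebra.Polynomial"
    "HOL-Library.Extended_Nat"
    "HOL-Library.Multiset"
begin

section \<open>Bound quivers and their algebras\<close>

record ('v, 'a) bound_quiver =
  verts :: "'v set"
  arrows :: "'a set"
  src :: "'a \<Rightarrow> 'v"
  tgt :: "'a \<Rightarrow> 'v"
  rels :: "('a \<times> 'a) set"

text \<open>A path is its starting vertex together with its list of arrows, composed left to right;
  \<open>(v, [])\<close> is the trivial path at \<open>v\<close>. An element \<open>(\<alpha>, \<beta>)\<close> of \<open>rels\<close> stands for the relation
  \<open>\<alpha>\<beta>\<close>.\<close>

type_synonym ('v, 'a) path = "'v \<times> 'a list"

fun is_path :: "('v, 'a) bound_quiver \<Rightarrow> 'v \<Rightarrow> 'a list \<Rightarrow> bool" where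
  "is_path Q v [] \<longleftrightarrow> v \<in> verts Q"
| "is_path Q v (a # as) \<longleftrightarrow> v \<in> verts Q \<and> a \<in> arrows Q \<and> src Q a = v \<and> is_path Q (tgt Q a) as"

definition path_end :: "('v, 'a) bound_quiver \<Rightarrow> 'v \<Rightarrow> 'a list \<Rightarrow> 'v" where
  "path_end Q v as = (if as = [] then v else tgt Q (last as))"

text \<open>The path algebra \<open>kQ\<close>: finitely supported functions on the paths of \<open>Q\<close>. The product is the
  convolution over all factorisations of a path.\<close>

definition path_algebra :: "('v, 'a) bound_quiver \<Rightarrow> (('v, 'a) path \<Rightarrow> 'k::field) ring" where
  "path_algebra Q =
    \<lparr>carrier = {x. finite {p. x p \<noteq> 0} \<and> (\<forall>v as. x (v, as) \<noteq> 0 \<longrightarrow> is_path Q v as)},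
     monoid.mult = (\<lambda>x y (v, as). \<Sum>i\<le>length as. x (v, take i as) * y (path_end Q v (take i as), drop i as)),
     one = (\<lambda>(v, as). if v \<in> verts Q \<and> as = [] then 1 else 0),
     zero = (\<lambda>_. 0),
     add = (\<lambda>x y p. x p + y p)\<rparr>"

definition single :: "('v, 'a) path \<Rightarrow> ('v, 'a) path \<Rightarrow> 'k::field" where
  "single p = (\<lambda>q. if q = p then 1 else 0)"

definition rel_ideal :: "('v, 'a) bound_quiver \<Rightarrow> (('v, 'a) path \<Rightarrow> 'k::field) set" where
  "rel_ideal Q = Idl\<^bsub>path_algebra Q\<^esub> {single (src Q \<alpha>, [\<alpha>, \<beta>]) | \<alpha> \<beta>. (\<alpha>, \<beta>) \<in> rels Q}"

definition bound_algebra :: "('v, 'a) bound_quiver \<Rightarrow> (('v, 'a) path \<Rightarrow> 'k::field) set ring" where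
  "bound_algebra Q = path_algebra Q Quot rel_ideal Q"

definition path_class :: "('v, 'a) bound_quiver \<Rightarrow> ('v, 'a) path \<Rightarrow> (('v, 'a) path \<Rightarrow> 'k::field) set" where
  "path_class Q p = rel_ideal Q +>\<^bsub>path_algebra Q\<^esub> single p"

text \<open>The quiver is finite because the algebra is finite-dimensional. The ideal is generated by
  paths of length 2, so admissibility amounts to the ideal containing all sufficiently long paths.\<close>

definition gentle :: "'k::field itself \<Rightarrow> ('v, 'a) bound_quiver \<Rightarrow> bool" where
  "gentle (_ :: 'k itself) Q \<longleftrightarrow>
    finite (verts Q) \<and> finite (arrows Q) \<and>
    (\<forall>a\<in>arrows Q. src Q a \<in> verts Q \<and> tgt Q a \<in> verts Q) \<and>
    rels Q \<subseteq> {(a, b). a \<in> arrows Q \<and> b \<in> arrows Q \<and> tgt Q a = src Q b} \<and>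
    (\<forall>v\<in>verts Q. card {a \<in> arrows Q. src Q a = v} \<le> 2 \<and> card {a \<in> arrows Q. tgt Q a = v} \<le> 2) \<and>
    (\<forall>a\<in>arrows Q. card {b. (a, b) \<in> rels Q} \<le> 1 \<and> card {b. (b, a) \<in> rels Q} \<le> 1 \<and>
       card {b \<in> arrows Q. tgt Q a = src Q b \<and> (a, b) \<notin> rels Q} \<le> 1 \<and>
       card {b \<in> arrows Q. tgt Q b = src Q a \<and> (b, a) \<notin> rels Q} \<le> 1) \<and>
    (\<exists>N. \<forall>v as. is_path Q v as \<longrightarrow> N \<le> length as \<longrightarrow>
       (single (v, as) :: ('v, 'a) path \<Rightarrow> 'k) \<in> rel_ideal Q)"


section \<open>Right modules\<close>

text \<open>HOL-Algebra only has modules over commutative rings. As in its record \<open>module\<close>, the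
  fields \<open>mult\<close> and \<open>one\<close> inherited from \<open>ring\<close> carry no meaning. The vector space structure of a
  module is part of the action of the algebra.\<close>

record ('a, 'm) right_module = "'m ring" +
  ract :: "'m \<Rightarrow> 'a \<Rightarrow> 'm"

definition rmod_iso ::
  "('a, 'b) ring_scheme \<Rightarrow> ('a, 'm, 'c) right_module_scheme \<Rightarrow> ('a, 'n, 'd) right_module_scheme \<Rightarrow> bool" where
  "rmod_iso R M N \<longleftrightarrow> (\<exists>f. bij_betw f (carrier M) (carrier N) \<and>
     (\<forall>x\<in>carrier M. \<forall>y\<in>carrier M. f (x \<oplus>\<^bsub>M\<^esub> y) = f x \<oplus>\<^bsub>N\<^esub> f y) \<and>
     (\<forall>x\<in>carrier M. \<forall>a\<in>carrier R. f (ract M x a) = ract N (f x) a))"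

definition rmod_dsum :: "'i set \<Rightarrow> ('i \<Rightarrow> ('a, 'm) right_module) \<Rightarrow> ('a, 'i \<Rightarrow> 'm) right_module" where
  "rmod_dsum I M =
    \<lparr>carrier = {f \<in> \<Pi>\<^sub>E i\<in>I. carrier (M i). finite {i \<in> I. f i \<noteq> \<zero>\<^bsub>M i\<^esub>}},
     monoid.mult = undefined, one = undefined,
     zero = (\<lambda>i\<in>I. \<zero>\<^bsub>M i\<^esub>),
     add = (\<lambda>f g. \<lambda>i\<in>I. f i \<oplus>\<^bsub>M i\<^esub> g i),
     ract = (\<lambda>f a. \<lambda>i\<in>I. ract (M i) (f i) a)\<rparr>"

definition rmod_quot :: "('a, 'm) right_module \<Rightarrow> 'm set \<Rightarrow> ('a, 'm set) right_module" where
  "rmod_quot M N =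
    \<lparr>carrier = a_rcosets\<^bsub>M\<^esub> N, monoid.mult = undefined, one = undefined, zero = N, add = set_add M,
     ract = (\<lambda>X a. \<Union>x\<in>X. N +>\<^bsub>M\<^esub> ract M x a)\<rparr>"

record ('a, 'm) cochain_complex =
  trm :: "int \<Rightarrow> ('a, 'm) right_module"
  diff :: "int \<Rightarrow> 'm \<Rightarrow> 'm"

definition cohomology :: "('a, 'm) cochain_complex \<Rightarrow> int \<Rightarrow> ('a, 'm set) right_module" where
  "cohomology C n =
    rmod_quot (trm C n\<lparr>carrier := a_kernel (trm C n) (trm C (n + 1)) (diff C n)\<rparr>)
      (diff C (n - 1) ` carrier (trm C (n - 1)))"

definition principal_module :: "'a ring \<Rightarrow> 'a \<Rightarrow> ('a, 'a) right_module" where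
  "principal_module A e =
    \<lparr>carrier = (\<lambda>a. e \<otimes>\<^bsub>A\<^esub> a) ` carrier A, monoid.mult = undefined, one = undefined,
     zero = \<zero>\<^bsub>A\<^esub>, add = add A, ract = monoid.mult A\<rparr>"


section \<open>Marked ribbon surfaces\<close>

text \<open>The surface with its two dissections is given, up to orientation preserving homeomorphism, by
  its ribbon graph: the finite set \<open>pts\<close> of \<open>\<bullet>\<close>-points and, for each \<open>\<bullet>\<close>-point, the list
  \<open>fan\<close> of the ends of \<open>\<bullet>\<close>-arcs (half-edges) at it in counterclockwise order. This order
  is linear and not just cyclic since \<open>\<bullet>\<close>-points lie on the boundary. The involution \<open>opp\<close>
  exchanges the two ends of a \<open>\<bullet>\<close>-arc.

  Two half-edges \<open>h\<close>, \<open>h'\<close> that are consecutive in a fan span a corner of an elementary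
  \<open>\<bullet>\<close>-polygon, and the corner following it along the boundary of that polygon, if there is one, is
  the one spanned by \<open>opp h'\<close> and its successor. A maximal chain of such corners is an elementary
  polygon with exactly one edge in the boundary; a cyclic chain is an \<open>\<infinity>\<close>-elementary polygon,
  which encloses a boundary component without \<open>\<bullet>\<close>-points. An arc side with no corner is a digon;
  it contains an extra marked point.

  Dually, the elementary \<open>\<circ>\<close>-polygons correspond to the \<open>\<bullet>\<close>-points they contain; the edges of
  the \<open>\<circ>\<close>-polygon of \<open>p\<close> are the \<open>\<circ>\<close>-arcs dual to the members of the fan of \<open>p\<close>, in this order
  (a loop at \<open>p\<close> contributing two edges). Crossing the edge belonging to \<open>h\<close> leads into the
  \<open>\<circ>\<close>-polygon of the point of \<open>opp h\<close>.\<close>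

record ('p, 'h) ribbon_surface =
  pts :: "'p set"
  fan :: "'p \<Rightarrow> 'h list"
  opp :: "'h \<Rightarrow> 'h"

definition half_edges :: "('p, 'h) ribbon_surface \<Rightarrow> 'h set" where
  "half_edges S = (\<Union>p\<in>pts S. set (fan S p))"

definition marked_ribbon_surface :: "('p, 'h) ribbon_surface \<Rightarrow> bool" where
  "marked_ribbon_surface S \<longleftrightarrow>
    finite (pts S) \<and> (\<forall>p\<in>pts S. distinct (fan S p)) \<and>
    (\<forall>p\<in>pts S. \<forall>q\<in>pts S. p \<noteq> q \<longrightarrow> set (fan S p) \<inter> set (fan S q) = {}) \<and>
    (\<forall>h\<in>half_edges S. opp S h \<in> half_edges S \<and> opp S h \<noteq> h \<and> opp S (opp S h) = h)"

definition arc :: "('p, 'h) ribbon_surface \<Rightarrow> 'h \<Rightarrow> 'h set" where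
  "arc S h = {h, opp S h}"

definition base :: "('p, 'h) ribbon_surface \<Rightarrow> 'h \<Rightarrow> 'p" where
  "base S h = (THE p. p \<in> pts S \<and> h \<in> set (fan S p))"

text \<open>\<open>h'\<close> is the next half-edge after \<open>h\<close>, respectively comes somewhere after \<open>h\<close>, in
  counterclockwise order around a common \<open>\<bullet>\<close>-point; \<open>succs\<close> lists the latter.\<close>

definition corner :: "('p, 'h) ribbon_surface \<Rightarrow> 'h \<Rightarrow> 'h \<Rightarrow> bool" where
  "corner S h h' \<longleftrightarrow> (\<exists>p\<in>pts S. \<exists>us vs. fan S p = us @ h # h' # vs)"

definition ccw_before :: "('p, 'h) ribbon_surface \<Rightarrow> 'h \<Rightarrow> 'h \<Rightarrow> bool" where
  "ccw_before S h h' \<longleftrightarrow> (\<exists>p\<in>pts S. \<exists>us vs ws. fan S p = us @ h # vs @ h' # ws)"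

definition succs :: "('p, 'h) ribbon_surface \<Rightarrow> 'h \<Rightarrow> 'h list" where
  "succs S h = tl (dropWhile (\<lambda>x. x \<noteq> h) (fan S (base S h)))"

text \<open>The arrows are the corners. Let \<open>\<alpha> = (x, y)\<close>; an arrow starting at the arc of \<open>y\<close> has the form
  \<open>(y, z)\<close> or \<open>(opp y, z)\<close>. In the first case the corners \<open>\<alpha>\<close>, \<open>\<beta>\<close> lie on different sides of the
  arc of \<open>y\<close>; in the second case they are successive corners of one polygon. That the resulting
  bound quiver is gentle is \<open>gentle_surface_quiver\<close> below.\<close>

definition surface_quiver :: "('p, 'h) ribbon_surface \<Rightarrow> ('h set, 'h \<times> 'h) bound_quiver" where
  "surface_quiver S =
    \<lparr>verts = arc S ` half_edges S,
     arrows = {(x, y). corner S x y},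
     src = (\<lambda>(x, y). arc S x),
     tgt = (\<lambda>(x, y). arc S y),
     rels = {((x, y), (opp S y, z)) | x y z. corner S x y \<and> corner S (opp S y) z}\<rparr>"

type_synonym ('h, 'k) surface_alg = "(('h set, 'h \<times> 'h) path \<Rightarrow> 'k) set ring"

definition surface_algebra :: "('p, 'h) ribbon_surface \<Rightarrow> ('h, 'k::field) surface_alg" where
  "surface_algebra S = bound_algebra (surface_quiver S)"

text \<open>The path around the \<open>\<bullet>\<close>-point of \<open>g\<close> from the arc of \<open>g\<close> to the arc of \<open>h\<close>, where
  \<open>ccw_before S g h\<close>.\<close>

definition around :: "('p, 'h) ribbon_surface \<Rightarrow> 'h \<Rightarrow> 'h \<Rightarrow> ('h \<times> 'h) list" where
  "around S g h = (let l = takeWhile (\<lambda>x. x \<noteq> h) (g # succs S g) @ [h] in zip l (tl l))"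


section \<open>Permissible curves\<close>

text \<open>A crossing of a \<open>\<bullet>\<close>-arc is recorded by one of its half-edges \<open>e\<close>: the curve passes from the
  right of \<open>e\<close> to the left of \<open>e\<close>, seen from the \<open>\<bullet>\<close>-point of \<open>e\<close>. Thus it moves counterclockwise
  around the point of \<open>e\<close> and clockwise around the point of \<open>opp e\<close>, and \<open>opp e\<close> is the reverse
  crossing. A middle segment from \<open>e\<close> to \<open>e'\<close> therefore cuts off either the corner \<open>(e, e')\<close>, whose
  point lies to its left, or the corner \<open>(opp e', opp e)\<close>, whose point lies to its right. That the
  next segment starts on the other side of the crossed arc excludes backtracking.

  A permissible curve is given by its crossings and, for each middle segment, the side on which the
  cut-off \<open>\<bullet>\<close>-point lies. End segments always exist, and curves that differ only in their end segments
  are identified, so they are not recorded. The trivial curves are represented by \<open>([], [])\<close>. The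
  identification of a curve with its inverse is not divided out.\<close>

datatype side = PtLeft | PtRight

type_synonym 'h pcurve = "'h list \<times> side list"

fun seg_arrow :: "('p, 'h) ribbon_surface \<Rightarrow> side \<Rightarrow> 'h \<Rightarrow> 'h \<Rightarrow> 'h \<times> 'h" where
  "seg_arrow S PtLeft e e' = (e, e')"
| "seg_arrow S PtRight e e' = (opp S e', opp S e)"

definition permissible :: "('p, 'h) ribbon_surface \<Rightarrow> 'h pcurve \<Rightarrow> bool" where
  "permissible S p \<longleftrightarrow> (case p of (xs, ts) \<Rightarrow>
    set xs \<subseteq> half_edges S \<and> length ts = length xs - 1 \<and>
    (\<forall>j. Suc j < length xs \<longrightarrow> case_prod (corner S) (seg_arrow S (ts ! j) (xs ! j) (xs ! Suc j))))"

definition ncross :: "'h pcurve \<Rightarrow> nat" where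
  "ncross p = length (fst p)"

text \<open>The string module has basis \<open>z\<^sub>0, \<dots>, z\<^sub>m\<^sub>-\<^sub>1\<close>; a letter PtLeft (resp. PtRight) between the
  vertices \<open>j\<close> and \<open>j + 1\<close> is an arrow \<open>\<alpha>\<close> with \<open>z\<^sub>j \<alpha> = z\<^sub>j\<^sub>+\<^sub>1\<close> (resp. \<open>z\<^sub>j\<^sub>+\<^sub>1 \<alpha> = z\<^sub>j\<close>).\<close>

definition string_arrow_act ::
  "('p, 'h) ribbon_surface \<Rightarrow> 'h pcurve \<Rightarrow> (nat \<Rightarrow> 'k::field) \<Rightarrow> 'h \<times> 'h \<Rightarrow> nat \<Rightarrow> 'k" where
  "string_arrow_act S p f a = (case p of (xs, ts) \<Rightarrow> (\<lambda>j.
     (if 0 < j \<and> j < length xs \<and> ts ! (j - 1) = PtLeft \<and> a = seg_arrow S PtLeft (xs ! (j - 1)) (xs ! j)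
      then f (j - 1) else 0) +
     (if Suc j < length xs \<and> ts ! j = PtRight \<and> a = seg_arrow S PtRight (xs ! j) (xs ! Suc j)
      then f (Suc j) else 0)))"

definition string_path_act ::
  "('p, 'h) ribbon_surface \<Rightarrow> 'h pcurve \<Rightarrow> (nat \<Rightarrow> 'k::field) \<Rightarrow> ('h set, 'h \<times> 'h) path \<Rightarrow> nat \<Rightarrow> 'k" where
  "string_path_act S p f = (\<lambda>(v, as).
     foldl (string_arrow_act S p) (\<lambda>j. if j < ncross p \<and> arc S (fst p ! j) = v then f j else 0) as)"

text \<open>An element of the algebra, being a coset of the relation ideal, acts through any representative.\<close>

definition string_module ::
  "('p, 'h) ribbon_surface \<Rightarrow> 'h pcurve \<Rightarrow> ((('h set, 'h \<times> 'h) path \<Rightarrow> 'k::field) set, nat \<Rightarrow> 'k) right_module"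
  where
  "string_module S p =
    \<lparr>carrier = {f. \<forall>j\<ge>ncross p. f j = 0}, monoid.mult = undefined, one = undefined,
     zero = (\<lambda>_. 0), add = (\<lambda>f g j. f j + g j),
     ract = (\<lambda>f X. let x = (SOME x. x \<in> X) in
       (\<lambda>j. \<Sum>q | x q \<noteq> 0. x q * string_path_act S p f q j))\<rparr>"

text \<open>The relation \<open>\<MM>\<^sup>-\<^sup>1(M) = cs\<close>. The curves in \<open>cs\<close> are unique only up to inversion, so the
  multiset is determined up to this identification.\<close>

definition is_curves_of ::
  "('p, 'h) ribbon_surface \<Rightarrow> ('h, 'k::field) surface_alg \<Rightarrow>
   ((('h set, 'h \<times> 'h) path \<Rightarrow> 'k) set, 'm) right_module \<Rightarrow> 'h pcurve multiset \<Rightarrow> bool" where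
  "is_curves_of S A M cs \<longleftrightarrow> (\<exists>ps. mset ps = cs \<and>
     (\<forall>p\<in>set ps. permissible S p \<and> ncross p \<noteq> 0) \<and>
     rmod_iso A M (rmod_dsum {..<length ps} (\<lambda>j. string_module S (ps ! j))))"

text \<open>The projective permissible curve of the arc of \<open>e\<close>, oriented such that it has the crossing \<open>e\<close>;
  see \<open>cproj_unique\<close> below. That crossing is number \<open>cproj_pos S e\<close>, counted from 1.\<close>

definition cproj :: "('p, 'h) ribbon_surface \<Rightarrow> 'h \<Rightarrow> 'h pcurve" where
  "cproj S e =
    (map (opp S) (rev (succs S (opp S e))) @ e # succs S e,
     replicate (length (succs S (opp S e))) PtRight @ replicate (length (succs S e)) PtLeft)"

definition cproj_pos :: "('p, 'h) ribbon_surface \<Rightarrow> 'h \<Rightarrow> nat" where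
  "cproj_pos S e = Suc (length (succs S (opp S e)))"

text \<open>The crossings numbered \<open>t, \<dots>, t'\<close> (as far as they exist, counting from 1) and the segments
  between them, i.e. the completion of the truncation from \<open>t\<close> to \<open>t'\<close>.\<close>

definition trunc :: "nat \<Rightarrow> nat \<Rightarrow> 'h pcurve \<Rightarrow> 'h pcurve" where
  "trunc t t' p = (if t \<le> t' then
     (drop (t - 1) (take t' (fst p)), drop (t - 1) (take (t' - 1) (snd p))) else ([], []))"


section \<open>Admissible curves and their complexes\<close>

text \<open>A graded curve is a walk through the \<open>\<circ>\<close>-polygons \<open>P\<^sub>0, P\<^sub>1, \<dots>\<close>. It is given by the number
  \<open>len\<close> of crossings with \<open>\<circ>\<close>-arcs, by the half-edges \<open>cross i\<close> (\<open>1 \<le> i \<le> len\<close>) at the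
  \<open>\<bullet>\<close>-point of \<open>P\<^sub>i\<^sub>-\<^sub>1\<close> such that the \<open>i\<close>-th crossing is with the dual of the arc of \<open>cross i\<close>,
  and by the intersection indices. So \<open>P\<^sub>i\<close> belongs to the point of \<open>opp (cross i)\<close>.\<close>

record 'h graded_curve =
  len :: enat
  cross :: "nat \<Rightarrow> 'h"
  idx :: "nat \<Rightarrow> int"

abbreviation uncross :: "('p, 'h) ribbon_surface \<Rightarrow> 'h graded_curve \<Rightarrow> nat \<Rightarrow> 'h" where
  "uncross S c i \<equiv> opp S (cross c i)"

text \<open>For \<open>1 \<le> i < len\<close>: the \<open>\<bullet>\<close>-point of \<open>P\<^sub>i\<close> lies to the left (right) of the segment in \<open>P\<^sub>i\<close>,
  which joins the dual of \<open>uncross i\<close> to the dual of \<open>cross (i + 1)\<close>.\<close>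

definition pt_left :: "('p, 'h) ribbon_surface \<Rightarrow> 'h graded_curve \<Rightarrow> nat \<Rightarrow> bool" where
  "pt_left S c i \<longleftrightarrow> 1 \<le> i \<and> enat (i + 1) \<le> len c \<and> ccw_before S (uncross S c i) (cross c (i + 1))"

definition pt_right :: "('p, 'h) ribbon_surface \<Rightarrow> 'h graded_curve \<Rightarrow> nat \<Rightarrow> bool" where
  "pt_right S c i \<longleftrightarrow> 1 \<le> i \<and> enat (i + 1) \<le> len c \<and> ccw_before S (cross c (i + 1)) (uncross S c i)"

text \<open>Admissible curves with both ends in \<open>\<bullet>\<close>-points, or starting in a \<open>\<bullet>\<close>-point and finally
  spiralling around a boundary component without \<open>\<bullet>\<close>-points, i.e. cutting off successive corners of
  an \<open>\<infinity>\<close>-elementary polygon, in one direction or the other.\<close>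

definition admissible :: "('p, 'h) ribbon_surface \<Rightarrow> 'h graded_curve \<Rightarrow> bool" where
  "admissible S c \<longleftrightarrow> 1 \<le> len c \<and>
    (\<forall>i. 1 \<le> i \<and> enat i \<le> len c \<longrightarrow> cross c i \<in> half_edges S) \<and>
    (\<forall>i. 1 \<le> i \<and> enat (i + 1) \<le> len c \<longrightarrow>
       base S (cross c (i + 1)) = base S (uncross S c i) \<and> cross c (i + 1) \<noteq> uncross S c i) \<and>
    (\<forall>i. pt_left S c i \<longrightarrow> idx c (i + 1) = idx c i + 1) \<and>
    (\<forall>i. pt_right S c i \<longrightarrow> idx c (i + 1) = idx c i - 1) \<and>
    (len c = \<infinity> \<longrightarrow> (\<exists>N\<ge>1. (\<forall>i\<ge>N. corner S (uncross S c i) (cross c (i + 1))) \<or>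
                          (\<forall>i\<ge>N. corner S (cross c (i + 1)) (uncross S c i))))"

definition indices_at :: "'h graded_curve \<Rightarrow> int \<Rightarrow> nat set" where
  "indices_at c n = {i. 1 \<le> i \<and> enat i \<le> len c \<and> n = - idx c i}"

text \<open>A path from \<open>v\<close> to \<open>w\<close> induces \<open>P(w) \<rightarrow> P(v)\<close> by left multiplication.\<close>

definition curve_complex ::
  "('p, 'h) ribbon_surface \<Rightarrow> ('h, 'k::field) surface_alg \<Rightarrow> 'h graded_curve \<Rightarrow>
   ((('h set, 'h \<times> 'h) path \<Rightarrow> 'k) set, nat \<Rightarrow> (('h set, 'h \<times> 'h) path \<Rightarrow> 'k) set) cochain_complex" where
  "curve_complex S A c = (let cls = path_class (surface_quiver S) in
    \<lparr>trm = (\<lambda>n. rmod_dsum (indices_at c n) (\<lambda>i. principal_module A (cls (arc S (cross c i), [])))),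
     diff = (\<lambda>n f. \<lambda>i\<in>indices_at c (n + 1).
       (if pt_left S c i
        then cls (arc S (cross c i), around S (uncross S c i) (cross c (i + 1))) \<otimes>\<^bsub>A\<^esub> f (i + 1)
        else \<zero>\<^bsub>A\<^esub>) \<oplus>\<^bsub>A\<^esub>
       (if pt_right S c (i - 1)
        then cls (arc S (cross c i), around S (cross c i) (uncross S c (i - 1))) \<otimes>\<^bsub>A\<^esub> f (i - 1)
        else \<zero>\<^bsub>A\<^esub>))\<rparr>)"


section \<open>Supplemental unions\<close>

text \<open>We orient \<open>c\<^sub>p\<^sub>r\<^sub>o\<^sub>j(D\<^sub>i)\<close> from the side of \<open>P\<^sub>i\<^sub>-\<^sub>1\<close> to the side of \<open>P\<^sub>i\<close>, so that it has the crossing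
  \<open>uncross i\<close>: its part before \<open>D\<^sub>i\<close> turns around the \<open>\<bullet>\<close>-point of \<open>P\<^sub>i\<^sub>-\<^sub>1\<close>, its part after \<open>D\<^sub>i\<close>
  around that of \<open>P\<^sub>i\<close>.\<close>

definition cprojD :: "('p, 'h) ribbon_surface \<Rightarrow> 'h graded_curve \<Rightarrow> nat \<Rightarrow> 'h pcurve" where
  "cprojD S c i = cproj S (uncross S c i)"

definition posD :: "('p, 'h) ribbon_surface \<Rightarrow> 'h graded_curve \<Rightarrow> nat \<Rightarrow> nat" where
  "posD S c i = cproj_pos S (uncross S c i)"

definition meeting :: "('p, 'h) ribbon_surface \<Rightarrow> 'h graded_curve \<Rightarrow> nat \<Rightarrow> bool" where
  "meeting S c i \<longleftrightarrow> pt_left S c (i - 1) \<and> pt_right S c i"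

text \<open>For \<open>meeting S c i\<close>: the positions of the crossing with \<open>D\<^sub>i\<close> on \<open>c\<^sub>p\<^sub>r\<^sub>o\<^sub>j(D\<^sub>i\<^sub>-\<^sub>1)\<close> and on
  \<open>c\<^sub>p\<^sub>r\<^sub>o\<^sub>j(D\<^sub>i\<^sub>+\<^sub>1)\<close>. The arcs \<open>b\<^sub>1\<close> and \<open>b\<^sub>2\<close> are at \<open>posI - 1\<close> and \<open>posII + 1\<close>; one has \<open>b\<^sub>1 = D\<^sub>i\<^sub>-\<^sub>1\<close>
  if \<open>\<wp>\<^sub>i\<^sub>-\<^sub>1\<close> is an arrow, and similarly for \<open>b\<^sub>2\<close>.\<close>

definition posI :: "('p, 'h) ribbon_surface \<Rightarrow> 'h graded_curve \<Rightarrow> nat \<Rightarrow> nat" where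
  "posI S c i = posD S c (i - 1) + length (around S (uncross S c (i - 1)) (cross c i))"

definition posII :: "('p, 'h) ribbon_surface \<Rightarrow> 'h graded_curve \<Rightarrow> nat \<Rightarrow> nat" where
  "posII S c i = posD S c (i + 1) - length (around S (cross c (i + 1)) (uncross S c i))"

text \<open>In the following, \<open>r\<close> and \<open>s\<close> give the ends of the truncations of the curves \<open>cprojD S c i\<close>.
  One has to remember them since two truncations with the same completion, such as those from 0
  and from 1, may end on an arc or not.\<close>

definition one_point :: "('p, 'h) ribbon_surface \<Rightarrow> 'h graded_curve \<Rightarrow> (nat \<Rightarrow> nat) \<Rightarrow> (nat \<Rightarrow> nat) \<Rightarrow> nat \<Rightarrow> bool"
  where
  "one_point S c r s i \<longleftrightarrow> meeting S c i \<and> r i = posD S c i \<and> s i = posD S c i"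

text \<open>The connecting segment, if any, inserted between the truncations of \<open>c\<^sub>p\<^sub>r\<^sub>o\<^sub>j(D\<^sub>i)\<close> and
  \<open>c\<^sub>p\<^sub>r\<^sub>o\<^sub>j(D\<^sub>i\<^sub>')\<close>. It is \<open>s\<^sub>I\<close>, running around the \<open>\<bullet>\<close>-point to the left, in the case PtLeft, and
  \<open>s\<^sub>I\<^sub>I\<close> in the case PtRight. The last two cases are those of the one-point truncation \<open>s\<^sup>\<star>\<close>.\<close>

definition connection ::
  "('p, 'h) ribbon_surface \<Rightarrow> 'h graded_curve \<Rightarrow> (nat \<Rightarrow> nat) \<Rightarrow> (nat \<Rightarrow> nat) \<Rightarrow> nat \<Rightarrow> nat \<Rightarrow> side option" where
  "connection S c r s i i' =
    (if i' = i + 2 \<and> meeting S c (i + 1) \<and> s i = posI S c (i + 1) \<and> r i' = posII S c (i + 1) + 1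
     then Some PtRight
     else if i' = i + 2 \<and> meeting S c (i + 1) \<and> s i = posI S c (i + 1) - 1 \<and> r i' = posII S c (i + 1)
     then Some PtLeft
     else if i' = i + 1 \<and> one_point S c r s i' \<and> s i = posI S c i' - 1
     then Some PtLeft
     else if i' = i + 1 \<and> one_point S c r s i \<and> r i' = posII S c i + 1
     then Some PtRight
     else None)"

text \<open>A one-point truncation \<open>s\<^sup>\<star>\<close> is traversed in the direction of the adjoining segments \<open>s\<^sub>I\<close>, \<open>s\<^sub>I\<^sub>I\<close>,
  which is opposite to that of \<open>cprojD S c i\<close>.\<close>

definition part ::
  "('p, 'h) ribbon_surface \<Rightarrow> 'h graded_curve \<Rightarrow> (nat \<Rightarrow> nat) \<Rightarrow> (nat \<Rightarrow> nat) \<Rightarrow> nat \<Rightarrow> 'h pcurve" where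
  "part S c r s i =
    (if one_point S c r s i then ([cross c i], []) else trunc (r i) (s i) (cprojD S c i))"

fun join :: "'h pcurve \<Rightarrow> side \<Rightarrow> 'h pcurve \<Rightarrow> 'h pcurve" where
  "join (xs, ts) d (ys, us) = (xs @ ys, ts @ d # us)"

text \<open>The completions of the members of the supplemental union, for a list of indices in ascending
  order. In a given degree there are only finitely many indices, see \<open>finite_indices_at\<close> below.\<close>

fun suppl_union ::
  "('p, 'h) ribbon_surface \<Rightarrow> 'h graded_curve \<Rightarrow> (nat \<Rightarrow> nat) \<Rightarrow> (nat \<Rightarrow> nat) \<Rightarrow> nat list \<Rightarrow> 'h pcurve list" where
  "suppl_union S c r s [] = []"
| "suppl_union S c r s [i] = [part S c r s i]"
| "suppl_union S c r s (i # i' # is) =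
    (let us = suppl_union S c r s (i' # is) in
     case connection S c r s i i' of
       None \<Rightarrow> part S c r s i # us
     | Some d \<Rightarrow> join (part S c r s i) d (hd us) # tl us)"

definition nontrivial_curves :: "'h pcurve list \<Rightarrow> 'h pcurve multiset" where
  "nontrivial_curves ps = mset (filter (\<lambda>p. ncross p \<noteq> 0) ps)"


section \<open>Consistency of the definitions\<close>

lemma is_path_append:
  "is_path Q v (as @ bs) \<longleftrightarrow> is_path Q v as \<and> is_path Q (path_end Q v as) bs"
proof (induction as arbitrary: v)
  case Nil
  then show ?case by (cases bs) (auto simp: path_end_def)
next
  case (Cons a as)
  then show ?case by (cases as) (auto simp: path_end_def)
qed

lemma path_end_append: "path_end Q (path_end Q v as) bs = path_end Q v (as @ bs)"
  by (simp add: path_end_def)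

lemma path_algebra_mult_closed:
  assumes "x \<in> carrier (path_algebra Q)" "y \<in> carrier (path_algebra Q)"
  shows "x \<otimes>\<^bsub>path_algebra Q\<^esub> y \<in> carrier (path_algebra Q)"
proof -
  let ?m = "x \<otimes>\<^bsub>path_algebra Q\<^esub> y"
  have *: "\<exists>i. x (v, take i as) \<noteq> 0 \<and> y (path_end Q v (take i as), drop i as) \<noteq> 0"
    if "?m (v, as) \<noteq> 0" for v as
    using that by (force simp: path_algebra_def dest: sum.not_neutral_contains_not_neutral)
  have "{p. ?m p \<noteq> 0} \<subseteq> (\<lambda>(p, q). (fst p, snd p @ snd q)) ` ({p. x p \<noteq> 0} \<times> {p. y p \<noteq> 0})"
    using * by force
  moreover have "finite ({p. x p \<noteq> 0} \<times> {p. y p \<noteq> 0})"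
    using assms by (simp add: path_algebra_def)
  ultimately have "finite {p. ?m p \<noteq> 0}"
    by (meson finite_imageI finite_subset)
  moreover have "is_path Q v as" if nz: "?m (v, as) \<noteq> 0" for v as
  proof -
    obtain i where "x (v, take i as) \<noteq> 0" "y (path_end Q v (take i as), drop i as) \<noteq> 0"
      using *[OF nz] by blast
    then have "is_path Q v (take i as)" "is_path Q (path_end Q v (take i as)) (drop i as)"
      using assms by (auto simp: path_algebra_def)
    then show ?thesis using is_path_append[of Q v "take i as" "drop i as"] by simp
  qed
  ultimately show ?thesis by (simp add: path_algebra_def)
qed

lemma path_algebra_assoc:
  "(x \<otimes>\<^bsub>path_algebra Q\<^esub> y) \<otimes>\<^bsub>path_algebra Q\<^esub> z = x \<otimes>\<^bsub>path_algebra Q\<^esub> (y \<otimes>\<^bsub>path_algebra Q\<^esub> z)"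
proof (rule ext, clarify)
  fix v as
  let ?e = "path_end Q v"
  let ?t = "\<lambda>i j. x (v, take j as) * y (?e (take j as), take (i - j) (drop j as)) * z (?e (take i as), drop i as)"
  have "((x \<otimes>\<^bsub>path_algebra Q\<^esub> y) \<otimes>\<^bsub>path_algebra Q\<^esub> z) (v, as) = (\<Sum>i\<le>length as. \<Sum>j\<le>i. ?t i j)"
    unfolding path_algebra_def
    by (auto simp: sum_distrib_right drop_take min_def intro!: sum.cong)
  also have "\<dots> = (\<Sum>(i, j)\<in>(SIGMA i:{..length as}. {..i}). ?t i j)"
    by (subst sum.Sigma) auto
  also have "\<dots> = (\<Sum>(j, k)\<in>(SIGMA j:{..length as}. {..length as - j}). ?t (j + k) j)"
    by (rule sum.reindex_bij_witness[of _ "\<lambda>(j, k). (j + k, j)" "\<lambda>(i, j). (j, i - j)"]) auto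
  also have "\<dots> = (\<Sum>j\<le>length as. \<Sum>k\<le>length as - j. ?t (j + k) j)"
    by (subst sum.Sigma) auto
  also have "\<dots> = (x \<otimes>\<^bsub>path_algebra Q\<^esub> (y \<otimes>\<^bsub>path_algebra Q\<^esub> z)) (v, as)"
    unfolding path_algebra_def
    by (auto simp: sum_distrib_left path_end_append take_add mult.assoc add.commute intro!: sum.cong)
  finally show "((x \<otimes>\<^bsub>path_algebra Q\<^esub> y) \<otimes>\<^bsub>path_algebra Q\<^esub> z) (v, as) =
    (x \<otimes>\<^bsub>path_algebra Q\<^esub> (y \<otimes>\<^bsub>path_algebra Q\<^esub> z)) (v, as)" .
qed

lemma ring_path_algebra:
  assumes "finite (verts Q)"
  shows "ring (path_algebra Q :: (('v, 'a) path \<Rightarrow> 'k::field) ring)"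
proof -
  let ?R = "path_algebra Q :: (('v, 'a) path \<Rightarrow> 'k) ring"
  have add: "x \<oplus>\<^bsub>?R\<^esub> y = (\<lambda>p. x p + y p)" "\<zero>\<^bsub>?R\<^esub> = (\<lambda>_. 0)" for x y
    by (simp_all add: path_algebra_def)
  have addc: "x \<oplus>\<^bsub>?R\<^esub> y \<in> carrier ?R" if "x \<in> carrier ?R" "y \<in> carrier ?R" for x y
  proof -
    have "{p. x p + y p \<noteq> 0} \<subseteq> {p. x p \<noteq> 0} \<union> {p. y p \<noteq> 0}" by auto
    moreover have "finite ({p. x p \<noteq> 0} \<union> {p. y p \<noteq> 0})"
      using that by (simp add: path_algebra_def)
    ultimately have "finite {p. x p + y p \<noteq> 0}" by (rule finite_subset)
    moreover have "x p \<noteq> 0 \<or> y p \<noteq> 0" if "x p + y p \<noteq> 0" for p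
      using that by auto
    ultimately show ?thesis using that unfolding add by (simp add: path_algebra_def) blast
  qed
  have onec: "\<one>\<^bsub>?R\<^esub> \<in> carrier ?R"
  proof -
    have "{p. \<one>\<^bsub>?R\<^esub> p \<noteq> 0} \<subseteq> (\<lambda>v. (v, [])) ` verts Q" by (auto simp: path_algebra_def split: if_splits)
    then have "finite {p. \<one>\<^bsub>?R\<^esub> p \<noteq> 0}" using assms finite_subset by blast
    then show ?thesis by (auto simp: path_algebra_def split: if_splits)
  qed
  have vv: "v \<in> verts Q" if "is_path Q v as" for v and as :: "'a list"
    using that by (cases as) auto
  have ev: "path_end Q v as \<in> verts Q" if "is_path Q v as" for v and as :: "'a list"
    using that is_path_append[of Q v as "[]"] by simp
  have lone: "\<one>\<^bsub>?R\<^esub> \<otimes>\<^bsub>?R\<^esub> x = x" if "x \<in> carrier ?R" for x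
  proof (rule ext, clarify)
    fix v as
    have "(\<one>\<^bsub>?R\<^esub> \<otimes>\<^bsub>?R\<^esub> x) (v, as) = (\<Sum>i\<le>length as. if i = 0 then (if v \<in> verts Q then x (v, as) else 0) else 0)"
      unfolding path_algebra_def by (cases "as = []") (auto simp: path_end_def if_distrib[of "\<lambda>z. z * _"] cong: if_cong)
    also have "\<dots> = x (v, as)"
      using that vv[of v as] by (auto simp: path_algebra_def)
    finally show "(\<one>\<^bsub>?R\<^esub> \<otimes>\<^bsub>?R\<^esub> x) (v, as) = x (v, as)" .
  qed
  have rone: "x \<otimes>\<^bsub>?R\<^esub> \<one>\<^bsub>?R\<^esub> = x" if "x \<in> carrier ?R" for x
  proof (rule ext, clarify)
    fix v as
    have "(x \<otimes>\<^bsub>?R\<^esub> \<one>\<^bsub>?R\<^esub>) (v, as) =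
      (\<Sum>i\<le>length as. if i = length as then (if path_end Q v as \<in> verts Q then x (v, as) else 0) else 0)"
      unfolding path_algebra_def monoid.simps prod.case by (rule sum.cong) auto
    also have "\<dots> = x (v, as)"
      using that ev[of v as] by (auto simp: path_algebra_def)
    finally show "(x \<otimes>\<^bsub>?R\<^esub> \<one>\<^bsub>?R\<^esub>) (v, as) = x (v, as)" .
  qed
  show ?thesis
  proof (rule ringI)
    show "abelian_group ?R"
    proof (rule abelian_groupI)
      fix x assume x: "x \<in> carrier ?R"
      have "(\<lambda>p. - x p) \<in> carrier ?R" using x by (auto simp: path_algebra_def)
      then show "\<exists>y\<in>carrier ?R. y \<oplus>\<^bsub>?R\<^esub> x = \<zero>\<^bsub>?R\<^esub>"
        by (intro bexI[of _ "\<lambda>p. - x p"]) (auto simp: add)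
    next
      fix x y assume "x \<in> carrier ?R" "y \<in> carrier ?R"
      then show "x \<oplus>\<^bsub>?R\<^esub> y \<in> carrier ?R" by (rule addc)
    qed (auto simp: path_algebra_def algebra_simps)
    show "Group.monoid ?R"
      by (rule monoidI) (auto simp: path_algebra_mult_closed onec lone rone path_algebra_assoc)
  qed (auto simp: path_algebra_def algebra_simps sum.distrib)
qed


lemma single_carrier: "is_path Q v as \<Longrightarrow> single (v, as) \<in> carrier (path_algebra Q)"
  by (auto simp: path_algebra_def single_def)

lemma single_mult:
  "single (v, as) \<otimes>\<^bsub>path_algebra Q\<^esub> single (path_end Q v as, bs) = (single (v, as @ bs) :: ('v, 'a) path \<Rightarrow> 'k::field)"
proof (rule ext, clarify)
  fix w cs
  let ?t = "\<lambda>i. (single (v, as) (w, take i cs) :: 'k) * single (path_end Q v as, bs) (path_end Q w (take i cs), drop i cs)"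
  have "?t i = (if i = length as then if (w, cs) = (v, as @ bs) then 1 else 0 else 0)"
    if "i \<le> length cs" for i
  proof -
    have "take i cs = as \<and> drop i cs = bs \<longleftrightarrow> i = length as \<and> cs = as @ bs"
      using that by (auto simp: append_eq_conv_conj)
    then have *: "w = v \<and> take i cs = as \<and> drop i cs = bs \<longleftrightarrow> w = v \<and> i = length as \<and> cs = as @ bs"
      by blast
    show ?thesis
    proof (cases "w = v \<and> i = length as \<and> cs = as @ bs")
      case True
      then show ?thesis by (simp add: single_def)
    next
      case False
      then have "\<not> (w = v \<and> take i cs = as \<and> drop i cs = bs)" using * by blast
      then consider "(w, take i cs) \<noteq> (v, as)" | "w = v" "take i cs = as" "drop i cs \<noteq> bs" by blast
      then have "?t i = 0"
      proof cases
        case 1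
        then have "(single (v, as) (w, take i cs) :: 'k) = 0" unfolding single_def by (rule if_not_P)
        then show ?thesis by simp
      next
        case 2
        then have "(path_end Q w (take i cs), drop i cs) \<noteq> (path_end Q v as, bs)" by simp
        then have "(single (path_end Q v as, bs) (path_end Q w (take i cs), drop i cs) :: 'k) = 0"
          unfolding single_def by (rule if_not_P)
        then show ?thesis by simp
      qed
      then show ?thesis using False by auto
    qed
  qed
  then have "(\<Sum>i\<le>length cs. ?t i) =
    (\<Sum>i\<le>length cs. if i = length as then if (w, cs) = (v, as @ bs) then 1 else 0 else 0)"
    by (intro sum.cong) auto
  also have "\<dots> = single (v, as @ bs) (w, cs)"
    by (auto simp: single_def)
  finally show "(single (v, as) \<otimes>\<^bsub>path_algebra Q\<^esub> single (path_end Q v as, bs)) (w, cs) =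
      (single (v, as @ bs) (w, cs) :: 'k)"
    by (simp add: path_algebra_def)
qed

lemma rel_ideal_ideal:
  assumes "finite (verts Q)" "\<And>a b. (a, b) \<in> rels Q \<Longrightarrow> is_path Q (src Q a) [a, b]"
  shows "ideal (rel_ideal Q :: (('v, 'a) path \<Rightarrow> 'k::field) set) (path_algebra Q)"
  unfolding rel_ideal_def
  using assms by (intro ring.genideal_ideal ring_path_algebra) (auto intro!: single_carrier)

lemma long_path_in_rel_ideal:
  assumes "finite (verts Q)" "\<And>a b. (a, b) \<in> rels Q \<Longrightarrow> is_path Q (src Q a) [a, b]"
    and "(a, b) \<in> rels Q" "is_path Q v (us @ a # b # ws)"
  shows "(single (v, us @ a # b # ws) :: ('v, 'a) path \<Rightarrow> 'k::field) \<in> rel_ideal Q"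
proof -
  let ?R = "path_algebra Q :: (('v, 'a) path \<Rightarrow> 'k) ring"
  interpret I: ideal "rel_ideal Q" ?R by (rule rel_ideal_ideal) (use assms in auto)
  have p: "is_path Q v us" "path_end Q v us = src Q a" "is_path Q (path_end Q (src Q a) [a, b]) ws"
    using assms(4) by (auto simp: is_path_append path_end_def)
  have "single (src Q a, [a, b]) \<in> rel_ideal Q"
    using assms(3) I.genideal_self unfolding rel_ideal_def genideal_def by blast
  then have "single (src Q a, [a, b]) \<otimes>\<^bsub>?R\<^esub> single (path_end Q (src Q a) [a, b], ws) \<in> rel_ideal Q"
    by (rule I.I_r_closed) (rule single_carrier[OF p(3)])
  then have "single (v, us) \<otimes>\<^bsub>?R\<^esub> single (path_end Q v us, a # b # ws) \<in> rel_ideal Q"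
    unfolding single_mult p(2) by (intro I.I_l_closed single_carrier[OF p(1)]) simp
  then show ?thesis by (simp add: single_mult)
qed

context
  fixes S :: "('p, 'h) ribbon_surface"
  assumes S: "marked_ribbon_surface S"
begin

lemma base_eq: "p \<in> pts S \<Longrightarrow> h \<in> set (fan S p) \<Longrightarrow> base S h = p"
  using S unfolding base_def marked_ribbon_surface_def by (intro the_equality) blast+

lemma succs_eq:
  assumes "p \<in> pts S" "fan S p = us @ h # vs"
  shows "succs S h = vs"
proof -
  have "base S h = p" using assms by (intro base_eq) auto
  moreover have "h \<notin> set us" using S assms unfolding marked_ribbon_surface_def by (metis distinct_append disjoint_insert(2) list.simps(15) not_distinct_conv_prefix)
  ultimately show ?thesis using assms by (simp add: succs_def dropWhile_append)
qed

lemma half_edge_fan: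
  assumes "h \<in> half_edges S"
  obtains p us where "p \<in> pts S" "fan S p = us @ h # succs S h"
proof -
  obtain p where p: "p \<in> pts S" "h \<in> set (fan S p)" using assms unfolding half_edges_def by blast
  then obtain us vs where "fan S p = us @ h # vs" by (meson split_list)
  with p(1) show ?thesis using succs_eq[of p us h vs] by (intro that[of p us]) auto
qed

lemma corner_half_edges: "corner S h h' \<Longrightarrow> h \<in> half_edges S \<and> h' \<in> half_edges S"
  unfolding corner_def half_edges_def by force

lemma corner_succs: "corner S h h' \<longleftrightarrow> h \<in> half_edges S \<and> (\<exists>vs. succs S h = h' # vs)"
proof
  assume "corner S h h'"
  then show "h \<in> half_edges S \<and> (\<exists>vs. succs S h = h' # vs)"
    using corner_half_edges succs_eq unfolding corner_def by blast
next
  assume "h \<in> half_edges S \<and> (\<exists>vs. succs S h = h' # vs)"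
  then obtain vs p us where "succs S h = h' # vs" "p \<in> pts S" "fan S p = us @ h # succs S h"
    using half_edge_fan by blast
  then show "corner S h h'" unfolding corner_def by auto
qed

lemma succs_Cons:
  assumes "h \<in> half_edges S" "succs S h = h' # vs"
  shows "succs S h' = vs"
proof -
  obtain p us where "p \<in> pts S" "fan S p = us @ h # succs S h" using half_edge_fan[OF assms(1)] .
  then show ?thesis using succs_eq[of p "us @ [h]" h' vs] assms(2) by simp
qed

lemma corner_unique_right: "corner S h a \<Longrightarrow> corner S h b \<Longrightarrow> a = b"
  by (auto simp: corner_succs)

lemma corner_unique_left:
  assumes "corner S a h" "corner S b h" shows "a = b"
proof -
  obtain p us vs q us' vs' where p: "p \<in> pts S" "fan S p = us @ a # h # vs"
    and q: "q \<in> pts S" "fan S q = us' @ b # h # vs'"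
    using assms unfolding corner_def by blast
  have "p = q" using p q base_eq[of p h] base_eq[of q h] by auto
  then have e: "(us @ [a]) @ h # vs = (us' @ [b]) @ h # vs'"
    using p(2) q(2) by (metis append.assoc append_Cons append_Nil)
  have d: "distinct (fan S p)" using S p(1) unfolding marked_ribbon_surface_def by blast
  have "h \<notin> set (us @ [a])" "h \<notin> set vs" using d unfolding p(2) by auto
  then have "us @ [a] = us' @ [b]" using iffD1[OF append_Cons_eq_iff e] by blast
  then show ?thesis by simp
qed

lemma opp_opp: "h \<in> half_edges S \<Longrightarrow> opp S (opp S h) = h"
  and opp_neq: "h \<in> half_edges S \<Longrightarrow> opp S h \<noteq> h"
  and opp_half_edges: "h \<in> half_edges S \<Longrightarrow> opp S h \<in> half_edges S"
  using S unfolding marked_ribbon_surface_def by blast+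

lemma finite_half_edges: "finite (half_edges S)"
  using S unfolding half_edges_def marked_ribbon_surface_def by auto

lemma arc_eq: "h \<in> half_edges S \<Longrightarrow> arc S h = arc S h' \<Longrightarrow> h' = h \<or> h' = opp S h"
  unfolding arc_def by blast

lemma arc_opp: "h \<in> half_edges S \<Longrightarrow> arc S (opp S h) = arc S h"
  unfolding arc_def using opp_opp by auto

lemma gentle_surface_quiver: "gentle TYPE('k::field) (surface_quiver S)"
proof -
  let ?Q = "surface_quiver S"
  have sub: "{(x, y). corner S x y} \<subseteq> half_edges S \<times> half_edges S"
    using corner_half_edges by auto
  have fin: "finite (verts ?Q)" "finite (arrows ?Q)"
    using finite_half_edges finite_subset[OF sub] by (auto simp: surface_quiver_def)
  have c1: "card {x. P x} \<le> 1" if "\<And>x y. P x \<Longrightarrow> P y \<Longrightarrow> x = y" for P :: "'h \<times> 'h \<Rightarrow> bool"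
  proof (cases "\<exists>x. P x")
    case True
    then obtain x where "P x" by blast
    then have "{x. P x} = {x}" using that by blast
    then show ?thesis by simp
  next
    case False
    then have "{x. P x} = {}" by blast
    then show ?thesis by (simp only: card.empty)
  qed
  have c2: "card {x \<in> arrows ?Q. \<exists>y\<in>arc S h. f x = y} \<le> 2"
    if "\<And>x y. x \<in> arrows ?Q \<Longrightarrow> y \<in> arrows ?Q \<Longrightarrow> f x = f y \<Longrightarrow> x = y" for f h
  proof -
    have "card {x \<in> arrows ?Q. \<exists>y\<in>arc S h. f x = y} \<le> card (arc S h)"
      by (rule card_inj_on_le[of f]) (auto simp: inj_on_def that arc_def)
    also have "\<dots> \<le> 2" by (simp add: arc_def card_insert_if)
    finally show ?thesis .
  qed
  have inj: "fst x = fst y \<Longrightarrow> x = y" "snd x = snd y \<Longrightarrow> x = y" if "x \<in> arrows ?Q" "y \<in> arrows ?Q" for x y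
    using that corner_unique_left corner_unique_right by (auto simp: surface_quiver_def)
  have s: "{a \<in> arrows ?Q. src ?Q a = arc S h} = {x \<in> arrows ?Q. \<exists>y\<in>arc S h. fst x = y}"
    "{a \<in> arrows ?Q. tgt ?Q a = arc S h} = {x \<in> arrows ?Q. \<exists>y\<in>arc S h. snd x = y}" if "h \<in> half_edges S" for h
    using that corner_half_edges opp_opp by (auto simp: surface_quiver_def arc_def)
  have relpath: "is_path ?Q (src ?Q a) [a, b]" if "(a, b) \<in> rels ?Q" for a b
    using that corner_half_edges arc_opp by (auto simp: surface_quiver_def)
  have long: "length as < length (succs S (fst a))"
    if "is_path ?Q v (a # as)" "\<nexists>us x y ws. a # as = us @ x # y # ws \<and> (x, y) \<in> rels ?Q" for v a as
    using that
  proof (induction as arbitrary: v a)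
    case Nil
    then show ?case by (auto simp: surface_quiver_def corner_succs)
  next
    case (Cons b as)
    obtain x y x' z where ab: "a = (x, y)" "b = (x', z)" by (metis surj_pair)
    have c: "corner S x y" "corner S x' z" "arc S y = arc S x'"
      using Cons.prems(1) by (auto simp: surface_quiver_def ab)
    have "a # b # as = [] @ a # b # as" by simp
    then have "(a, b) \<notin> rels ?Q" using Cons.prems(2) by blast
    then have "x' \<noteq> opp S y" using c by (auto simp: surface_quiver_def ab)
    then have x': "x' = y" using arc_eq[of y x'] c corner_half_edges by blast
    have "length as < length (succs S (fst b))"
    proof (rule Cons.IH)
      show "is_path ?Q (tgt ?Q a) (b # as)" using Cons.prems(1) by simp
      show "\<nexists>us x y ws. b # as = us @ x # y # ws \<and> (x, y) \<in> rels ?Q"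
      proof
        assume "\<exists>us x y ws. b # as = us @ x # y # ws \<and> (x, y) \<in> rels ?Q"
        then obtain us x y ws where "b # as = us @ x # y # ws" "(x, y) \<in> rels ?Q" by blast
        then have "a # b # as = (a # us) @ x # y # ws \<and> (x, y) \<in> rels ?Q" by simp
        then show False using Cons.prems(2) by blast
      qed
    qed
    moreover have "succs S x = y # succs S y" using c(1) corner_succs succs_Cons by metis
    ultimately show ?case by (simp add: ab x')
  qed
  have bound: "length (succs S h) < Suc (card (half_edges S))" if hH: "h \<in> half_edges S" for h
  proof -
    obtain p us where p: "p \<in> pts S" "fan S p = us @ h # succs S h" using half_edge_fan[OF hH] .
    then have "distinct (succs S h)" using S unfolding marked_ribbon_surface_def by (metis distinct.simps(2) distinct_append)
    then have "length (succs S h) = card (set (succs S h))" by (simp add: distinct_card)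
    also have "\<dots> \<le> card (half_edges S)"
      using p finite_half_edges by (intro card_mono) (force simp: half_edges_def)+
    finally show ?thesis by simp
  qed
  have adm: "(single (v, as) :: _ \<Rightarrow> 'k) \<in> rel_ideal ?Q"
    if pr: "is_path ?Q v as" "Suc (card (half_edges S)) \<le> length as" for v as
  proof -
    obtain a as' where as: "as = a # as'" using pr(2) by (cases as) auto
    have p: "is_path ?Q v (a # as')" using pr(1) as by simp
    then have "corner S (fst a) (snd a)" by (auto simp: surface_quiver_def)
    then have "fst a \<in> half_edges S" using corner_half_edges by blast
    then have "\<not> length as' < length (succs S (fst a))"
      using bound[of "fst a"] pr(2) by (simp add: as)
    then obtain us x y ws where *: "a # as' = us @ x # y # ws" "(x, y) \<in> rels ?Q"
      using long[OF p] by blast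
    show ?thesis
      unfolding as *(1) by (rule long_path_in_rel_ideal[OF fin(1) relpath *(2)]) (use p *(1) in auto)
  qed
  show ?thesis
    unfolding gentle_def
  proof (intro conjI ballI)
    show "rels ?Q \<subseteq> {(a, b). a \<in> arrows ?Q \<and> b \<in> arrows ?Q \<and> tgt ?Q a = src ?Q b}"
      using corner_half_edges arc_opp by (auto simp: surface_quiver_def)
    fix v assume "v \<in> verts ?Q"
    then obtain h where "h \<in> half_edges S" "v = arc S h" by (auto simp: surface_quiver_def)
    then show "card {a \<in> arrows ?Q. src ?Q a = v} \<le> 2" "card {a \<in> arrows ?Q. tgt ?Q a = v} \<le> 2"
      using s c2[of fst h] c2[of snd h] inj by auto
  next
    show "\<exists>N. \<forall>v as. is_path ?Q v as \<longrightarrow> N \<le> length as \<longrightarrow> (single (v, as) :: _ \<Rightarrow> 'k) \<in> rel_ideal ?Q"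
      using adm by blast
  next
    fix a assume a: "a \<in> arrows ?Q"
    then obtain x y where xy: "a = (x, y)" "corner S x y" by (auto simp: surface_quiver_def)
    have h: "x \<in> half_edges S" "y \<in> half_edges S" using xy corner_half_edges by blast+
    show "src ?Q a \<in> verts ?Q" "tgt ?Q a \<in> verts ?Q" using h by (auto simp: surface_quiver_def xy)
    show "card {b. (a, b) \<in> rels ?Q} \<le> 1"
      by (rule c1) (auto simp: surface_quiver_def xy dest: corner_unique_right)
    show "card {b. (b, a) \<in> rels ?Q} \<le> 1"
    proof (rule c1)
      fix b b' assume "(b, a) \<in> rels ?Q" "(b', a) \<in> rels ?Q"
      then obtain u v u' v' where b: "b = (u, v)" "b' = (u', v')" "x = opp S v" "x = opp S v'"
        "corner S u v" "corner S u' v'" by (auto simp: surface_quiver_def xy)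
      then have "v = v'" using opp_opp corner_half_edges by metis
      then show "b = b'" using b corner_unique_left by auto
    qed
    show "card {b \<in> arrows ?Q. tgt ?Q a = src ?Q b \<and> (a, b) \<notin> rels ?Q} \<le> 1"
    proof (rule c1)
      have *: "\<exists>z. b = (y, z) \<and> corner S y z" if "b \<in> arrows ?Q \<and> tgt ?Q a = src ?Q b \<and> (a, b) \<notin> rels ?Q" for b
        using that xy h arc_eq[of y "fst b"] by (auto simp: surface_quiver_def)
      fix b b' assume "b \<in> arrows ?Q \<and> tgt ?Q a = src ?Q b \<and> (a, b) \<notin> rels ?Q"
        "b' \<in> arrows ?Q \<and> tgt ?Q a = src ?Q b' \<and> (a, b') \<notin> rels ?Q"
      then show "b = b'" using * corner_unique_right by metis
    qed
    show "card {b \<in> arrows ?Q. tgt ?Q b = src ?Q a \<and> (b, a) \<notin> rels ?Q} \<le> 1"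
    proof (rule c1)
      have *: "\<exists>z. b = (z, x) \<and> corner S z x" if "b \<in> arrows ?Q \<and> tgt ?Q b = src ?Q a \<and> (b, a) \<notin> rels ?Q" for b
        using that xy h arc_eq[of x "snd b"] opp_opp by (auto simp: surface_quiver_def)
      fix b b' assume "b \<in> arrows ?Q \<and> tgt ?Q b = src ?Q a \<and> (b, a) \<notin> rels ?Q"
        "b' \<in> arrows ?Q \<and> tgt ?Q b' = src ?Q a \<and> (b', a) \<notin> rels ?Q"
      then show "b = b'" using * corner_unique_left by metis
    qed
  qed (use fin in auto)
qed

lemma succs_half_edges: "h \<in> half_edges S \<Longrightarrow> set (succs S h) \<subseteq> half_edges S"
proof -
  assume "h \<in> half_edges S"
  then obtain p us where p: "p \<in> pts S" "fan S p = us @ h # succs S h" by (rule half_edge_fan)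
  then have "set (succs S h) \<subseteq> set (fan S p)" by auto
  with p(1) show ?thesis unfolding half_edges_def by blast
qed

lemma succs_chain:
  assumes "h \<in> half_edges S"
  shows "(\<forall>j<length ys. corner S ((h # ys) ! j) (ys ! j)) \<and> (\<nexists>h'. corner S (last (h # ys)) h') \<longleftrightarrow>
    ys = succs S h"
  using assms
proof (induction ys arbitrary: h)
  case Nil
  then show ?case by (cases "succs S h") (auto simp: corner_succs)
next
  case (Cons y ys)
  have "(\<forall>j<length (y # ys). corner S ((h # y # ys) ! j) ((y # ys) ! j)) \<longleftrightarrow>
    corner S h y \<and> (\<forall>j<length ys. corner S ((y # ys) ! j) (ys ! j))"
    by (simp add: All_less_Suc2)
  moreover have "corner S h y \<Longrightarrow> y \<in> half_edges S" using corner_half_edges by blast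
  moreover have "corner S h y \<Longrightarrow> succs S h = y # succs S y"
  proof -
    assume "corner S h y"
    then obtain vs where "succs S h = y # vs" unfolding corner_succs by blast
    with succs_Cons[OF Cons.prems this] show ?thesis by simp
  qed
  moreover have "y # ys = succs S h \<Longrightarrow> corner S h y"
    unfolding corner_succs using Cons.prems by (intro conjI exI[of _ ys]) simp_all
  moreover have "last (h # y # ys) = last (y # ys)" by simp
  ultimately show ?case using Cons.IH[of y] by (metis list.inject)
qed


text \<open>\<open>cproj S e\<close> is the only permissible curve with crossing \<open>e\<close> such that the \<open>\<bullet>\<close>-arcs up to this
  crossing share an endpoint to its right, the \<open>\<bullet>\<close>-arcs from this crossing on share an endpoint to
  its left, and no \<open>\<bullet>\<close>-arc at these endpoints is to the left of the first, respectively last,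
  crossed \<open>\<bullet>\<close>-arc.\<close>

lemma cproj_unique:
  assumes e: "e \<in> half_edges S"
  shows "permissible S (xs, ts) \<and> k < length xs \<and> xs ! k = e \<and>
      (\<forall>j<k. ts ! j = PtRight) \<and> (\<nexists>h. corner S (opp S (hd xs)) h) \<and>
      (\<forall>j. k \<le> j \<and> Suc j < length xs \<longrightarrow> ts ! j = PtLeft) \<and> (\<nexists>h. corner S (last xs) h) \<longleftrightarrow>
    (xs, ts) = cproj S e \<and> Suc k = cproj_pos S e"
proof (cases "k < length xs \<and> xs ! k = e \<and> set xs \<subseteq> half_edges S")
  case True
  define A where "A = map (opp S) (rev (take k xs))"
  define B where "B = drop (Suc k) xs"
  have k: "k < length xs" "length A = k" "length B = length xs - Suc k" using True by (auto simp: A_def B_def)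
  have xsH: "x \<in> half_edges S" if "x \<in> set xs" for x using True that by blast
  have "map (opp S) (rev A) = map (opp S \<circ> opp S) (take k xs)" by (simp add: A_def rev_map)
  also have "\<dots> = take k xs" using xsH by (intro map_idI) (auto simp: opp_opp dest: in_set_takeD)
  finally have xs: "xs = map (opp S) (rev A) @ e # B"
    using True id_take_nth_drop[of k xs] by (simp add: B_def)
  have nA: "(opp S e # A) ! i = opp S (xs ! (k - i))" if "i \<le> k" for i
    using that True k by (cases i) (auto simp: A_def rev_nth)
  have nB: "(e # B) ! i = xs ! (k + i)" if "k + i < length xs" for i
    using that True by (cases i) (auto simp: B_def)
  have lA: "last (opp S e # A) = opp S (hd xs)"
  proof -
    have "last (opp S e # A) = (opp S e # A) ! k" using k(2) by (subst last_conv_nth) auto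
    also have "\<dots> = opp S (xs ! 0)" using nA[of k] by simp
    also have "xs ! 0 = hd xs" using k(1) by (subst hd_conv_nth) auto
    finally show ?thesis .
  qed
  have lB: "last (e # B) = last xs" unfolding xs by simp
  have cA: "(\<forall>j<length A. corner S ((opp S e # A) ! j) (A ! j)) \<longleftrightarrow>
    (\<forall>j<k. corner S (opp S (xs ! Suc j)) (opp S (xs ! j)))" (is "?l \<longleftrightarrow> ?r")
  proof -
    have "?l \<longleftrightarrow> (\<forall>j<k. corner S (opp S (xs ! (k - j))) (opp S (xs ! (k - Suc j))))"
    proof -
      have "(opp S e # A) ! j = opp S (xs ! (k - j)) \<and> A ! j = opp S (xs ! (k - Suc j))" if "j < k" for j
        using nA[of j] nA[of "Suc j"] that by simp
      then show ?thesis unfolding k(2) by simp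
    qed
    also have "\<dots> \<longleftrightarrow> ?r"
    proof safe
      fix j assume *: "\<forall>j<k. corner S (opp S (xs ! (k - j))) (opp S (xs ! (k - Suc j)))" "j < k"
      show "corner S (opp S (xs ! Suc j)) (opp S (xs ! j))"
        using *(1)[rule_format, of "k - Suc j"] *(2) by (simp add: Suc_diff_Suc)
    next
      fix j assume *: "\<forall>j<k. corner S (opp S (xs ! Suc j)) (opp S (xs ! j))" "j < k"
      show "corner S (opp S (xs ! (k - j))) (opp S (xs ! (k - Suc j)))"
        using *(1)[rule_format, of "k - Suc j"] *(2) by (simp add: Suc_diff_Suc)
    qed
    finally show ?thesis .
  qed
  have cB: "(\<forall>j<length B. corner S ((e # B) ! j) (B ! j)) \<longleftrightarrow>
    (\<forall>j. k \<le> j \<and> Suc j < length xs \<longrightarrow> corner S (xs ! j) (xs ! Suc j))" (is "?l \<longleftrightarrow> ?r")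
  proof
    assume l: ?l
    show ?r
    proof (intro allI impI)
      fix j assume j: "k \<le> j \<and> Suc j < length xs"
      then show "corner S (xs ! j) (xs ! Suc j)"
        using l[rule_format, of "j - k"] nB[of "j - k"] nB[of "Suc (j - k)"] k by auto
    qed
  next
    assume r: ?r
    show ?l
    proof (intro allI impI)
      fix j assume j: "j < length B"
      then show "corner S ((e # B) ! j) (B ! j)"
        using r[rule_format, of "k + j"] nB[of "j"] nB[of "Suc j"] k by auto
    qed
  qed
  have oe: "opp S e \<in> half_edges S" using e opp_half_edges by blast
  have ts: "(length ts = length xs - 1 \<and> (\<forall>j<k. ts ! j = PtRight) \<and>
      (\<forall>j. k \<le> j \<and> Suc j < length xs \<longrightarrow> ts ! j = PtLeft)) \<longleftrightarrow>
    ts = replicate k PtRight @ replicate (length B) PtLeft" (is "?l \<longleftrightarrow> ?r")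
  proof
    assume ?l
    then show ?r using k by (intro nth_equalityI) (auto simp: nth_append)
  qed (use k in \<open>auto simp: nth_append\<close>)
  have perm: "permissible S (xs, ts) \<and> (\<forall>j<k. ts ! j = PtRight) \<and>
      (\<forall>j. k \<le> j \<and> Suc j < length xs \<longrightarrow> ts ! j = PtLeft) \<longleftrightarrow>
    ts = replicate k PtRight @ replicate (length B) PtLeft \<and>
    (\<forall>j<k. corner S (opp S (xs ! Suc j)) (opp S (xs ! j))) \<and>
    (\<forall>j. k \<le> j \<and> Suc j < length xs \<longrightarrow> corner S (xs ! j) (xs ! Suc j))" (is "?p \<longleftrightarrow> _ \<and> ?c1 \<and> ?c2")
  proof -
    have "?p \<longleftrightarrow> ts = replicate k PtRight @ replicate (length B) PtLeft \<and> permissible S (xs, ts)"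
      using ts True by (auto simp: permissible_def)
    also have "\<dots> \<longleftrightarrow> ts = replicate k PtRight @ replicate (length B) PtLeft \<and> ?c1 \<and> ?c2"
    proof (rule conj_cong[OF refl])
      assume t: "ts = replicate k PtRight @ replicate (length B) PtLeft"
      have "permissible S (xs, ts) \<longleftrightarrow> (\<forall>j. Suc j < length xs \<longrightarrow>
        (if j < k then corner S (opp S (xs ! Suc j)) (opp S (xs ! j)) else corner S (xs ! j) (xs ! Suc j)))"
        using True k by (auto simp: permissible_def t nth_append)
      also have "\<dots> \<longleftrightarrow> ?c1 \<and> ?c2"
      proof -
        have "Suc j < length xs" if "j < k" for j using that k(1) by linarith
        then show ?thesis by (meson linorder_not_less)
      qed
      finally show "permissible S (xs, ts) \<longleftrightarrow> ?c1 \<and> ?c2" .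
    qed
    finally show ?thesis .
  qed
  have "permissible S (xs, ts) \<and> k < length xs \<and> xs ! k = e \<and>
      (\<forall>j<k. ts ! j = PtRight) \<and> (\<nexists>h. corner S (opp S (hd xs)) h) \<and>
      (\<forall>j. k \<le> j \<and> Suc j < length xs \<longrightarrow> ts ! j = PtLeft) \<and> (\<nexists>h. corner S (last xs) h) \<longleftrightarrow>
    ts = replicate k PtRight @ replicate (length B) PtLeft \<and> A = succs S (opp S e) \<and> B = succs S e"
    using True perm cA cB succs_chain[OF oe, of A] succs_chain[OF e, of B] unfolding lA lB by blast
  also have "\<dots> \<longleftrightarrow> (xs, ts) = cproj S e \<and> Suc k = cproj_pos S e"
  proof
    assume "ts = replicate k PtRight @ replicate (length B) PtLeft \<and> A = succs S (opp S e) \<and> B = succs S e"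
    then show "(xs, ts) = cproj S e \<and> Suc k = cproj_pos S e"
      using k(2) xs by (simp add: cproj_def cproj_pos_def)
  next
    assume r: "(xs, ts) = cproj S e \<and> Suc k = cproj_pos S e"
    then have l: "length (succs S (opp S e)) = k" by (simp add: cproj_pos_def)
    have x: "xs = map (opp S) (rev (succs S (opp S e))) @ e # succs S e" using r by (simp add: cproj_def)
    have "B = succs S e" unfolding B_def x using l by simp
    moreover have "A = map (opp S \<circ> opp S) (succs S (opp S e))"
      unfolding A_def x using l by (simp add: rev_map)
    then have "A = succs S (opp S e)"
      using opp_opp succs_half_edges[OF oe] by (auto intro!: map_idI)
    ultimately show "ts = replicate k PtRight @ replicate (length B) PtLeft \<and> A = succs S (opp S e) \<and> B = succs S e"
      using r l by (simp add: cproj_def)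
  qed
  finally show ?thesis .
next
  case False
  have "k < length xs \<and> xs ! k = e \<and> set xs \<subseteq> half_edges S"
    if "(xs, ts) = cproj S e \<and> Suc k = cproj_pos S e"
  proof -
    have k: "k = length (succs S (opp S e))"
      and x: "xs = map (opp S) (rev (succs S (opp S e))) @ e # succs S e"
      using that by (auto simp: cproj_def cproj_pos_def)
    have "set xs \<subseteq> half_edges S"
      unfolding x using e opp_half_edges succs_half_edges[OF opp_half_edges[OF e]] succs_half_edges[OF e] by auto
    then show ?thesis by (simp add: x k nth_append)
  qed
  then show ?thesis using False by (auto simp: permissible_def)
qed

end

lemma corner_ccw_before: "corner S g h \<Longrightarrow> ccw_before S g h"
  unfolding corner_def ccw_before_def by (metis append_Nil)

lemma finite_indices_at:
  assumes "admissible S c"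
  shows "finite (indices_at c n)"
proof (cases "len c")
  case (enat m)
  then have "indices_at c n \<subseteq> {..m}" by (auto simp: indices_at_def)
  then show ?thesis using finite_subset by blast
next
  case infinity
  have lr: "pt_left S c i \<Longrightarrow> idx c (i + 1) = idx c i + 1" "pt_right S c i \<Longrightarrow> idx c (i + 1) = idx c i - 1" for i
    using assms unfolding admissible_def by blast+
  obtain N where N: "N \<ge> 1" "(\<forall>i\<ge>N. corner S (uncross S c i) (cross c (i + 1))) \<or>
      (\<forall>i\<ge>N. corner S (cross c (i + 1)) (uncross S c i))"
    using assms infinity unfolding admissible_def by blast
  have "(\<forall>i\<ge>N. idx c (i + 1) = idx c i + 1) \<or> (\<forall>i\<ge>N. idx c (i + 1) = idx c i - 1)"
  proof -
    have "pt_left S c i" if "N \<le> i" "corner S (uncross S c i) (cross c (i + 1))" for i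
      using that N(1) infinity corner_ccw_before by (auto simp: pt_left_def)
    moreover have "pt_right S c i" if "N \<le> i" "corner S (cross c (i + 1)) (uncross S c i)" for i
      using that N(1) infinity corner_ccw_before by (auto simp: pt_right_def)
    ultimately show ?thesis using N(2) lr by blast
  qed
  then obtain d :: int where d: "d = 1 \<or> d = - 1" "\<forall>i\<ge>N. idx c (Suc i) = idx c i + d"
    by (metis Suc_eq_plus1 diff_conv_add_uminus)
  have "idx c (N + j) = idx c N + int j * d" for j
    by (induction j) (use d(2) in \<open>auto simp: algebra_simps\<close>)
  then have "inj_on (idx c) {N..}"
    using d(1) by (intro inj_onI) (metis add_left_cancel atLeast_iff le_Suc_ex mult_cancel_right of_nat_eq_iff one_neq_zero zero_neq_neg_one)
  moreover have "idx c ` (indices_at c n \<inter> {N..}) \<subseteq> {- n}" by (auto simp: indices_at_def)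
  ultimately have "finite (indices_at c n \<inter> {N..})"
    by (meson finite.emptyI finite.insertI finite_subset inf_le2 inj_on_finite inj_on_subset)
  moreover have "indices_at c n \<subseteq> {..<N} \<union> (indices_at c n \<inter> {N..})" by auto
  ultimately show ?thesis by (meson finite_UnI finite_lessThan finite_subset)
qed

end

theory Submission
  imports Defs
begin

text \<open>The indecomposable projective \<open>P(v(D\<^sub>i))\<close> has the non-zero paths starting at \<open>v(D\<^sub>i)\<close> as
  a basis, and these are the crossings of \<open>c\<^sub>p\<^sub>r\<^sub>o\<^sub>j(D\<^sub>i)\<close>: the trivial path in the middle and one arm on
  each side. Every component of the differential maps the middle and one arm of a projective
  injectively onto an end piece of an arm of its neighbour, killing the other arm. Hence the cycles of degree \<open>n\<close>
  are spanned by basis elements, and the boundaries by end pieces of arms together with, for each projective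
  \<open>P(v(D\<^sub>i\<^sub>+\<^sub>1))\<close> mapping to both of its neighbours, the sum of one basis element of \<open>P(v(D\<^sub>i))\<close> and one
  of \<open>P(v(D\<^sub>i\<^sub>+\<^sub>2))\<close>. So in cohomology an interval of each \<open>c\<^sub>p\<^sub>r\<^sub>o\<^sub>j(D\<^sub>i)\<close> survives, and two intervals
  are glued at a common socle element exactly where the supplemental union joins them; we always let
  this element belong to the truncation of \<open>c\<^sub>p\<^sub>r\<^sub>o\<^sub>j(D\<^sub>i)\<close>. One-point truncations \<open>s\<^sup>\<star>\<close> are never needed.\<close>

section \<open>Reduced paths and the quotient by the relations\<close>

text \<open>All curves \<open>cprojD S c i\<close> are oriented along the walk, so an arm shared by
  neighbouring projectives is run through in opposite directions; this is the source of the
  reflections x -> a - x and x -> - b - x. The two summands of the differential at a given term sit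
  on different sides of the origin, so nothing cancels and the kernel is read off coordinate by
  coordinate. Cohomology is not computed by choosing representatives: the linear map
  \<open>psi\<close> from cycles to functions on the surviving basis elements is onto, and exactly
  the boundaries go to 0. At a glued element it combines, with opposite signs, the two coordinates
  at which every boundary takes equal values. The algebra consists of cosets, and string modules act
  through a chosen representative, so everything is expressed by coefficients at paths without
  relations, where all representatives agree. The ends of the intervals depend on the neighbouring
  indices but not on the degree, so a single choice of r and s serves all n.\<close>

definition reduced :: "('v, 'a) bound_quiver \<Rightarrow> ('v, 'a) path \<Rightarrow> bool" where
  "reduced Q = (\<lambda>(v, as). is_path Q v as \<and> successively (\<lambda>x y. (x, y) \<notin> rels Q) as)"

text \<open>Connects \<open>successively\<close> with the explicit position of a relation inside a
  path that \<open>long_path_in_rel_ideal\<close> expects.\<close>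

lemma successively_split: "(\<forall>us x y ws. as = us @ x # y # ws \<longrightarrow> R x y) \<longleftrightarrow> successively R as"
proof
  assume "\<forall>us x y ws. as = us @ x # y # ws \<longrightarrow> R x y"
  then show "successively R as"
  proof (induction as rule: induct_list012)
    case (3 x y zs)
    have "R x y" using 3(3) by (metis append_Nil)
    moreover have "successively R (y # zs)"
      by (rule 3(2)) (metis 3(3) append_Cons)
    ultimately show ?case by simp
  qed auto
qed (auto simp: successively_append_iff)

lemma reduced_append:
  "reduced Q (v, as @ bs) \<Longrightarrow> reduced Q (v, as) \<and> reduced Q (path_end Q v as, bs)"
  by (auto simp: reduced_def is_path_append successively_append_iff)

lemma is_path_vert: "is_path Q v as \<Longrightarrow> v \<in> verts Q"
  by (cases as) auto

locale finite_bound_quiver =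
  fixes Q :: "('v, 'a) bound_quiver"
  assumes finite_verts: "finite (verts Q)"
    and rels_path: "\<And>a b. (a, b) \<in> rels Q \<Longrightarrow> is_path Q (src Q a) [a, b]"
begin

lemma ring_Q: "ring (path_algebra Q :: (('v, 'a) path \<Rightarrow> 'k::field) ring)"
  by (rule ring_path_algebra[OF finite_verts])

lemma ideal_Q: "ideal (rel_ideal Q :: (('v, 'a) path \<Rightarrow> 'k::field) set) (path_algebra Q)"
  by (rule rel_ideal_ideal[OF finite_verts rels_path])

lemma ring_A: "ring (bound_algebra Q :: (('v, 'a) path \<Rightarrow> 'k::field) set ring)"
  unfolding bound_algebra_def by (rule ideal.quotient_is_ring[OF ideal_Q])

lemma path_algebra_simps:
  "x \<oplus>\<^bsub>path_algebra Q\<^esub> y = (\<lambda>p. x p + y p)" "\<zero>\<^bsub>path_algebra Q\<^esub> = (\<lambda>_. 0)"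
  by (simp_all add: path_algebra_def)

lemma path_algebra_mult:
  "(x \<otimes>\<^bsub>path_algebra Q\<^esub> y) (v, as) =
    (\<Sum>i\<le>length as. x (v, take i as) * y (path_end Q v (take i as), drop i as))"
  by (simp add: path_algebra_def)

lemma carrier_support:
  "x \<in> carrier (path_algebra Q) \<longleftrightarrow> finite {p. x p \<noteq> 0} \<and> (\<forall>v as. x (v, as) \<noteq> 0 \<longrightarrow> is_path Q v as)"
  by (simp add: path_algebra_def)

text \<open>The path algebra is only a ring here; multiplication by c times a trivial path replaces
  the scalar action, so that ideals are closed under scaling a path.\<close>

lemma scaled_single_mult:
  assumes "is_path Q v as"
  shows "(\<lambda>q. if q = (v, []) then c else 0) \<otimes>\<^bsub>path_algebra Q\<^esub> single (v, as) =
    (\<lambda>q. if q = (v, as) then c else (0::'k::field))"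
proof (rule ext, clarify)
  fix w bs
  have "((\<lambda>q. if q = (v, []) then c else 0) \<otimes>\<^bsub>path_algebra Q\<^esub> single (v, as)) (w, bs) =
    (\<Sum>i\<le>length bs. if i = 0 then (if (w, bs) = (v, as) then c else 0) else 0)"
    unfolding path_algebra_mult
    by (rule sum.cong) (auto simp: single_def path_end_def take_eq_Nil)
  also have "\<dots> = (if (w, bs) = (v, as) then c else 0)" by simp
  finally show "((\<lambda>q. if q = (v, []) then c else 0) \<otimes>\<^bsub>path_algebra Q\<^esub> single (v, as)) (w, bs) =
    (if (w, bs) = (v, as) then c else 0)" .
qed

lemma scaled_nonreduced_in_rel_ideal:
  assumes "is_path Q v as" "\<not> reduced Q (v, as)"
  shows "(\<lambda>q. if q = (v, as) then c else (0::'k::field)) \<in> rel_ideal Q"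
proof -
  let ?R = "path_algebra Q :: (('v, 'a) path \<Rightarrow> 'k) ring"
  interpret I: ideal "rel_ideal Q" ?R by (rule ideal_Q)
  have "\<not> successively (\<lambda>x y. (x, y) \<notin> rels Q) as" using assms by (simp add: reduced_def)
  then obtain us x y ws where *: "as = us @ x # y # ws" "(x, y) \<in> rels Q"
    unfolding successively_split[symmetric] by blast
  have "(single (v, as) :: _ \<Rightarrow> 'k) \<in> rel_ideal Q"
    unfolding *(1) by (rule long_path_in_rel_ideal[OF finite_verts rels_path *(2)]) (use assms * in auto)
  moreover have "(\<lambda>q. if q = (v, []) then c else 0) \<in> carrier ?R"
    using is_path_vert[OF assms(1)] by (auto simp: carrier_support)
  ultimately have "(\<lambda>q. if q = (v, []) then c else 0) \<otimes>\<^bsub>?R\<^esub> single (v, as) \<in> rel_ideal Q"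
    by (rule I.I_l_closed)
  then show ?thesis unfolding scaled_single_mult[OF assms(1)] .
qed

text \<open>Subpaths of paths without relations have no relations either, so the elements vanishing
  on reduced paths form an ideal containing the generators. Conversely, such an element is a finite
  sum of scaled non-reduced paths.\<close>

lemma rel_ideal_iff:
  "x \<in> rel_ideal Q \<longleftrightarrow> x \<in> carrier (path_algebra Q) \<and> (\<forall>p. reduced Q p \<longrightarrow> x p = (0::'k::field))"
proof -
  let ?R = "path_algebra Q :: (('v, 'a) path \<Rightarrow> 'k) ring"
  let ?J = "{x \<in> carrier ?R. \<forall>p. reduced Q p \<longrightarrow> x p = 0}"
  interpret R: ring ?R by (rule ring_Q)
  interpret I: ideal "rel_ideal Q" ?R by (rule ideal_Q)
  have neg: "\<ominus>\<^bsub>?R\<^esub> x = (\<lambda>p. - x p)" if "x \<in> carrier ?R" for x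
  proof -
    have "(\<lambda>p. - x p) \<in> carrier ?R" using that by (auto simp: carrier_support)
    then show ?thesis using that by (intro R.minus_equality) (auto simp: path_algebra_simps)
  qed
  have "ideal ?J ?R"
  proof (rule idealI)
    show "ring ?R" by (rule ring_Q)
    show "subgroup ?J (add_monoid ?R)"
    proof
      show "x \<otimes>\<^bsub>add_monoid ?R\<^esub> y \<in> ?J" if "x \<in> ?J" "y \<in> ?J" for x y
        using that R.add.m_closed[of x y] by (auto simp: path_algebra_simps)
      show "inv\<^bsub>add_monoid ?R\<^esub> x \<in> ?J" if "x \<in> ?J" for x
        using that neg[of x] R.add.inv_closed[of x] by (auto simp: a_inv_def)
      show "\<one>\<^bsub>add_monoid ?R\<^esub> \<in> ?J" using R.zero_closed by (auto simp: path_algebra_simps)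
    qed auto
  next
    fix x y assume *: "x \<in> ?J" "y \<in> carrier ?R"
    have "(y \<otimes>\<^bsub>?R\<^esub> x) p = 0 \<and> (x \<otimes>\<^bsub>?R\<^esub> y) p = 0" if p: "reduced Q p" for p
    proof -
      obtain v as where va: "p = (v, as)" by (cases p)
      have "reduced Q (v, take i as)" "reduced Q (path_end Q v (take i as), drop i as)" for i
        using p reduced_append[of Q v "take i as" "drop i as"] by (simp_all add: va)
      then show ?thesis using * unfolding va path_algebra_mult by (simp)
    qed
    then show "y \<otimes>\<^bsub>?R\<^esub> x \<in> ?J" "x \<otimes>\<^bsub>?R\<^esub> y \<in> ?J"
      using * by auto
  qed
  moreover have "{single (src Q \<alpha>, [\<alpha>, \<beta>]) | \<alpha> \<beta>. (\<alpha>, \<beta>) \<in> rels Q} \<subseteq> ?J"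
  proof clarify
    fix \<alpha> \<beta> assume r: "(\<alpha>, \<beta>) \<in> rels Q"
    have "single (src Q \<alpha>, [\<alpha>, \<beta>]) p = (0::'k)" if "reduced Q p" for p
      using that r by (cases p) (auto simp: single_def reduced_def)
    then show "single (src Q \<alpha>, [\<alpha>, \<beta>]) \<in> carrier ?R \<and> (\<forall>p. reduced Q p \<longrightarrow> single (src Q \<alpha>, [\<alpha>, \<beta>]) p = (0::'k))"
      using single_carrier[OF rels_path[OF r]] by blast
  qed
  ultimately have "rel_ideal Q \<subseteq> ?J"
    unfolding rel_ideal_def by (rule R.genideal_minimal)
  moreover have "x \<in> rel_ideal Q" if "x \<in> ?J" for x
  proof -
    \<comment> \<open>The induction runs over a finite superset F of the support; cutting out the
      value at p leaves an element supported in the smaller set.\<close>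
    have "finite F \<Longrightarrow> x \<in> ?J \<Longrightarrow> {p. x p \<noteq> 0} \<subseteq> F \<Longrightarrow> x \<in> rel_ideal Q" for F x
    proof (induction F arbitrary: x rule: finite_induct)
      case empty
      then have "x = (\<lambda>_. 0)" by auto
      then show ?case using I.zero_closed by (simp add: path_algebra_simps)
    next
      case (insert p F)
      let ?y = "\<lambda>q. if q = p then 0 else x q" and ?z = "\<lambda>q. if q = p then x p else 0"
      have "{q. ?y q \<noteq> 0} \<subseteq> {q. x q \<noteq> 0}" by auto
      moreover have "finite {q. x q \<noteq> 0}" using insert.prems(1) by (simp add: carrier_support)
      ultimately have "finite {q. ?y q \<noteq> 0}" by (rule finite_subset)
      then have "?y \<in> ?J" using insert.prems(1) by (auto simp: carrier_support)
      then have "?y \<in> rel_ideal Q" by (rule insert.IH) (use insert.prems in auto)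
      moreover have "?z \<in> rel_ideal Q"
      proof (cases "x p = 0")
        case True
        then have "?z = (\<lambda>_. 0)" by auto
        then show ?thesis using I.zero_closed by (simp add: path_algebra_simps)
      next
        case False
        obtain v as where va: "p = (v, as)" by (cases p)
        have "is_path Q v as" "\<not> reduced Q (v, as)"
          using False insert.prems(1) by (auto simp: va carrier_support)
        then show ?thesis unfolding va by (rule scaled_nonreduced_in_rel_ideal)
      qed
      ultimately have "?y \<oplus>\<^bsub>?R\<^esub> ?z \<in> rel_ideal Q" by (rule I.a_closed)
      moreover have "?y \<oplus>\<^bsub>?R\<^esub> ?z = x" by (auto simp: path_algebra_simps)
      ultimately show ?case by simp
    qed
    then show ?thesis using that by (auto simp: carrier_support)
  qed
  ultimately show ?thesis by blast
qed

text \<open>On reduced paths all representatives of a class agree.\<close>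

definition coef :: "(('v, 'a) path \<Rightarrow> 'k::field) set \<Rightarrow> ('v, 'a) path \<Rightarrow> 'k" where
  "coef X p = (if reduced Q p then (SOME x. x \<in> X) p else 0)"

lemma carrier_A: "carrier (bound_algebra Q) = {rel_ideal Q +>\<^bsub>path_algebra Q\<^esub> x | x. x \<in> carrier (path_algebra Q)}"
  by (auto simp: bound_algebra_def FactRing_def A_RCOSETS_def')

lemma rep:
  assumes "X \<in> carrier (bound_algebra Q)" "x \<in> X"
  shows "x \<in> carrier (path_algebra Q)" "X = rel_ideal Q +>\<^bsub>path_algebra Q\<^esub> x"
    "reduced Q p \<Longrightarrow> coef X p = (x p :: 'k::field)"
proof -
  let ?R = "path_algebra Q :: (('v, 'a) path \<Rightarrow> 'k) ring"
  interpret I: ideal "rel_ideal Q" ?R by (rule ideal_Q)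
  obtain y where y: "y \<in> carrier ?R" "X = rel_ideal Q +>\<^bsub>?R\<^esub> y"
    using assms(1) unfolding carrier_A by blast
  have mem: "\<exists>j\<in>rel_ideal Q. z = (\<lambda>p. j p + y p)" if "z \<in> X" for z
    using that by (auto simp: y(2) a_r_coset_def' path_algebra_simps)
  show "x \<in> carrier ?R"
  proof -
    from mem[OF assms(2)] obtain j where "j \<in> rel_ideal Q" "x = (\<lambda>p. j p + y p)" by (elim bexE)
    then show ?thesis using I.a_closed I.a_Hcarr[of j] y(1) I.add.m_closed[of j y] by (simp add: path_algebra_simps)
  qed
  show "X = rel_ideal Q +>\<^bsub>?R\<^esub> x"
    unfolding y(2) by (rule I.a_repr_independence) (use assms(2) y I.a_subgroup in auto)
  have eq: "z p = y p" if "z \<in> X" "reduced Q p" for z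
  proof -
    from mem[OF that(1)] obtain j where "j \<in> rel_ideal Q" "z = (\<lambda>p. j p + y p)" by (elim bexE)
    moreover from this have "j p = 0" using that(2) unfolding rel_ideal_iff by blast
    ultimately show ?thesis by simp
  qed
  show "coef X p = x p" if "reduced Q p"
    using eq[of x] eq[of "SOME x. x \<in> X"] that assms(2) someI[of "\<lambda>x. x \<in> X" x] by (simp add: coef_def)
qed

lemma rep_exists:
  assumes "X \<in> carrier (bound_algebra Q :: (('v, 'a) path \<Rightarrow> 'k::field) set ring)"
  shows "(SOME x. x \<in> X) \<in> X"
proof -
  let ?R = "path_algebra Q :: (('v, 'a) path \<Rightarrow> 'k) ring"
  interpret I: ideal "rel_ideal Q" ?R by (rule ideal_Q)
  obtain y where y: "y \<in> carrier ?R" "X = rel_ideal Q +>\<^bsub>?R\<^esub> y"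
    using assms unfolding carrier_A by blast
  show ?thesis unfolding y(2) by (rule someI[of "\<lambda>x. x \<in> _", OF I.a_rcos_self[OF y(1)]])
qed

lemma coset_coef:
  assumes "x \<in> carrier (path_algebra Q)"
  shows "rel_ideal Q +>\<^bsub>path_algebra Q\<^esub> x \<in> carrier (bound_algebra Q)"
    and "coef (rel_ideal Q +>\<^bsub>path_algebra Q\<^esub> x) p = (if reduced Q p then x p else (0::'k::field))"
proof -
  let ?R = "path_algebra Q :: (('v, 'a) path \<Rightarrow> 'k) ring"
  interpret I: ideal "rel_ideal Q" ?R by (rule ideal_Q)
  show 1: "rel_ideal Q +>\<^bsub>?R\<^esub> x \<in> carrier (bound_algebra Q)" unfolding carrier_A using assms by blast
  show "coef (rel_ideal Q +>\<^bsub>?R\<^esub> x) p = (if reduced Q p then x p else 0)"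
  proof (cases "reduced Q p")
    case True
    then show ?thesis using rep(3)[OF 1 I.a_rcos_self[OF assms] True] by (simp only: if_True)
  qed (simp only: coef_def if_False)
qed

lemma coef_nonzero: "X \<in> carrier (bound_algebra Q) \<Longrightarrow> coef X p \<noteq> 0 \<Longrightarrow> reduced Q p"
  by (auto simp: coef_def split: if_splits)

lemma coef_path_class:
  assumes "is_path Q v as"
  shows "path_class Q (v, as) \<in> carrier (bound_algebra Q)"
    and "coef (path_class Q (v, as)) p = (if reduced Q p \<and> p = (v, as) then 1 else (0::'k::field))"
proof -
  show "path_class Q (v, as) \<in> carrier (bound_algebra Q)"
    unfolding path_class_def by (rule coset_coef(1)[OF single_carrier[OF assms]])
  show "coef (path_class Q (v, as)) p = (if reduced Q p \<and> p = (v, as) then 1 else (0::'k::field))"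
    unfolding path_class_def coset_coef(2)[OF single_carrier[OF assms]]
    by (cases "reduced Q p") (simp_all only: single_def if_True if_False simp_thms)
qed

lemma coef_add:
  fixes X Y :: "(('v, 'a) path \<Rightarrow> 'k::field) set"
  assumes "X \<in> carrier (bound_algebra Q)" "Y \<in> carrier (bound_algebra Q)"
  shows "coef (X \<oplus>\<^bsub>bound_algebra Q\<^esub> Y) p = coef X p + coef Y p"
proof -
  let ?R = "path_algebra Q :: (('v, 'a) path \<Rightarrow> 'k) ring"
  interpret I: ideal "rel_ideal Q" ?R by (rule ideal_Q)
  define x y where "x = (SOME x. x \<in> X)" "y = (SOME y. y \<in> Y)"
  then have xy: "x \<in> X" "y \<in> Y" using assms rep_exists by auto
  note r = rep[OF assms(1) xy(1)] rep[OF assms(2) xy(2)]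
  have "X \<oplus>\<^bsub>bound_algebra Q\<^esub> Y = X <+>\<^bsub>?R\<^esub> Y" by (simp add: bound_algebra_def FactRing_def)
  also have "\<dots> = rel_ideal Q +>\<^bsub>?R\<^esub> (x \<oplus>\<^bsub>?R\<^esub> y)"
    by (simp only: r(2) r(5) I.a_rcos_sum[OF r(1,4)])
  finally have "coef (X \<oplus>\<^bsub>bound_algebra Q\<^esub> Y) p = (if reduced Q p then x p + y p else 0)"
    using coset_coef(2)[of "x \<oplus>\<^bsub>?R\<^esub> y"] I.add.m_closed[OF r(1,4)] by (simp add: path_algebra_simps)
  also have "\<dots> = coef X p + coef Y p"
  proof (cases "reduced Q p")
    case True
    then show ?thesis using r(3,6)[OF True] by simp
  qed (simp add: coef_def)
  finally show ?thesis .
qed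

text \<open>The right factor enters through an arbitrary representative y because string modules sum
  over the whole support of a chosen representative; \<open>coords_ract\<close> compares the two
  sums.\<close>

lemma coef_mult:
  fixes X Y :: "(('v, 'a) path \<Rightarrow> 'k::field) set"
  assumes "X \<in> carrier (bound_algebra Q)" "Y \<in> carrier (bound_algebra Q)" "y \<in> Y" "reduced Q (v, as)"
  shows "coef (X \<otimes>\<^bsub>bound_algebra Q\<^esub> Y) (v, as) =
    (\<Sum>i\<le>length as. coef X (v, take i as) * y (path_end Q v (take i as), drop i as))"
proof -
  let ?R = "path_algebra Q :: (('v, 'a) path \<Rightarrow> 'k) ring"
  interpret I: ideal "rel_ideal Q" ?R by (rule ideal_Q)
  define x where "x = (SOME x. x \<in> X)"
  then have xy: "x \<in> X" using assms rep_exists by auto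
  note r = rep[OF assms(1) xy(1)] rep[OF assms(2) assms(3)]
  have "X \<otimes>\<^bsub>bound_algebra Q\<^esub> Y = rel_ideal Q +>\<^bsub>?R\<^esub> (x \<otimes>\<^bsub>?R\<^esub> y)"
    using r I.rcoset_mult_add[of x y] by (simp add: bound_algebra_def FactRing_def)
  then have "coef (X \<otimes>\<^bsub>bound_algebra Q\<^esub> Y) (v, as) = (x \<otimes>\<^bsub>?R\<^esub> y) (v, as)"
    using r assms(4) by (simp add: coset_coef path_algebra_mult_closed)
  also have "\<dots> = (\<Sum>i\<le>length as. coef X (v, take i as) * y (path_end Q v (take i as), drop i as))"
    unfolding path_algebra_mult
  proof (rule sum.cong)
    fix i
    have "reduced Q (v, take i as)" using assms(4) reduced_append[of Q v "take i as" "drop i as"] by simp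
    then show "x (v, take i as) * y (path_end Q v (take i as), drop i as) =
      coef X (v, take i as) * y (path_end Q v (take i as), drop i as)" using r by simp
  qed simp
  finally show ?thesis .
qed

lemma coef_eqI:
  fixes X Y :: "(('v, 'a) path \<Rightarrow> 'k::field) set"
  assumes "X \<in> carrier (bound_algebra Q)" "Y \<in> carrier (bound_algebra Q)"
    and "\<And>p. reduced Q p \<Longrightarrow> coef X p = coef Y p"
  shows "X = Y"
proof -
  let ?R = "path_algebra Q :: (('v, 'a) path \<Rightarrow> 'k) ring"
  interpret I: ideal "rel_ideal Q" ?R by (rule ideal_Q)
  define x y where "x = (SOME x. x \<in> X)" "y = (SOME y. y \<in> Y)"
  then have xy: "x \<in> X" "y \<in> Y" using assms rep_exists by auto
  note r = rep[OF assms(1) xy(1)] rep[OF assms(2) xy(2)]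
  have "{p. x p - y p \<noteq> 0} \<subseteq> {p. x p \<noteq> 0} \<union> {p. y p \<noteq> 0}" by auto
  then have "finite {p. x p - y p \<noteq> 0}" using r(1,4) finite_subset by (fastforce simp: carrier_support)
  then have "(\<lambda>p. x p - y p) \<in> carrier ?R"
    using r(1,4) unfolding carrier_support by (metis diff_self)
  then have "(\<lambda>p. x p - y p) \<in> rel_ideal Q"
    using r(3,6) assms(3) unfolding rel_ideal_iff by simp
  moreover have "x = (\<lambda>p. x p - y p) \<oplus>\<^bsub>?R\<^esub> y" by (simp add: path_algebra_simps)
  ultimately have "x \<in> rel_ideal Q +>\<^bsub>?R\<^esub> y" by (auto simp: a_r_coset_def')
  then have "x \<in> Y" using r(5) by simp
  then show ?thesis using r(2) rep(2)[OF assms(2)] by simp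
qed

lemma coef_zero: "coef \<zero>\<^bsub>bound_algebra Q\<^esub> p = (0::'k::field)"
proof -
  have "\<zero>\<^bsub>bound_algebra Q\<^esub> \<in> carrier (bound_algebra Q :: (('v, 'a) path \<Rightarrow> 'k) set ring)"
    using ring_A ring.ring_simprules(2) by blast
  moreover have "(\<lambda>_. 0) \<in> \<zero>\<^bsub>bound_algebra Q :: (('v, 'a) path \<Rightarrow> 'k) set ring\<^esub>"
    by (simp add: bound_algebra_def FactRing_def rel_ideal_iff carrier_support)
  ultimately show ?thesis using rep(3) by (cases "reduced Q p") (fastforce simp: coef_def)+
qed

lemma coef_surj:
  assumes "finite {p. g p \<noteq> (0::'k::field)}" "\<And>p. g p \<noteq> 0 \<Longrightarrow> reduced Q p"
  shows "\<exists>X\<in>carrier (bound_algebra Q). \<forall>p. coef X p = g p"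
proof -
  have "g \<in> carrier (path_algebra Q)" using assms by (auto simp: carrier_support reduced_def)
  from coset_coef[OF this] show ?thesis using assms(2) by (metis (full_types))
qed

section \<open>Principal modules and left multiplication by a path\<close>

text \<open>In a product with a trivial path on the left only the empty prefix contributes, so this
  multiplication projects onto the paths starting at v.\<close>

lemma principal_carrier:
  assumes "v \<in> verts Q"
  shows "carrier (principal_module (bound_algebra Q) (path_class Q (v, []))) =
    {X \<in> carrier (bound_algebra Q). \<forall>w as. coef X (w, as) \<noteq> (0::'k::field) \<longrightarrow> w = v}"
proof -
  let ?A = "bound_algebra Q :: (('v, 'a) path \<Rightarrow> 'k) set ring"
  let ?e = "path_class Q (v, []) :: (('v, 'a) path \<Rightarrow> 'k) set"
  interpret A: ring ?A by (rule ring_A)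
  have e: "?e \<in> carrier ?A" using coef_path_class[of v "[]"] assms by simp
  have mult: "coef (?e \<otimes>\<^bsub>?A\<^esub> X) (w, as) = (if w = v then coef X (w, as) else 0)"
    if "X \<in> carrier ?A" "reduced Q (w, as)" for X w as
  proof -
    have "coef (?e \<otimes>\<^bsub>?A\<^esub> X) (w, as) =
      (\<Sum>i\<le>length as. if i = 0 then if w = v then (SOME x. x \<in> X) (w, as) else 0 else 0)"
      unfolding coef_mult[OF e that(1) rep_exists[OF that(1)] that(2)]
    proof (rule sum.cong)
      fix i assume i: "i \<in> {..length as}"
      have "reduced Q (w, take i as)" using that(2) reduced_append[of Q w "take i as" "drop i as"] by simp
      then show "coef ?e (w, take i as) * (SOME x. x \<in> X) (path_end Q w (take i as), drop i as) =
          (if i = 0 then if w = v then (SOME x. x \<in> X) (w, as) else 0 else 0)"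
        using i assms by (cases "i = 0") (auto simp: path_end_def coef_path_class(2))
    qed simp
    also have "\<dots> = (if w = v then coef X (w, as) else 0)"
      using that(2) by (cases "w = v") (simp_all add: coef_def)
    finally show ?thesis .
  qed
  show ?thesis
  proof (intro equalityI subsetI)
    fix X assume "X \<in> carrier (principal_module ?A ?e)"
    then obtain Y where "Y \<in> carrier ?A" "X = ?e \<otimes>\<^bsub>?A\<^esub> Y" by (auto simp: principal_module_def)
    then have Y: "Y \<in> carrier ?A" "X = ?e \<otimes>\<^bsub>?A\<^esub> Y" "X \<in> carrier ?A" using e by auto
    have "w = v" if "coef X (w, as) \<noteq> 0" for w as
      using that mult[OF Y(1) coef_nonzero[OF Y(3) that]] unfolding Y(2) by presburger
    then show "X \<in> {X \<in> carrier ?A. \<forall>w as. coef X (w, as) \<noteq> 0 \<longrightarrow> w = v}"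
      using Y(3) by blast
  next
    fix X assume X: "X \<in> {X \<in> carrier ?A. \<forall>w as. coef X (w, as) \<noteq> 0 \<longrightarrow> w = v}"
    have "X = ?e \<otimes>\<^bsub>?A\<^esub> X"
    proof (rule coef_eqI)
      fix p assume p: "reduced Q p"
      obtain w as where wa: "p = (w, as)" by (cases p)
      have "w \<noteq> v \<longrightarrow> coef X p = 0" using X wa by blast
      then show "coef X p = coef (?e \<otimes>\<^bsub>?A\<^esub> X) p" using X mult[of X w as] p wa by simp
    qed (use X e in auto)
    then show "X \<in> carrier (principal_module ?A ?e)" using X by (auto simp: principal_module_def)
  qed
qed

text \<open>Only the factorisation with prefix bs survives: left multiplication by a path is
  prefixing, and a result that is not reduced vanishes.\<close>

lemma coef_path_mult:
  fixes X :: "(('v, 'a) path \<Rightarrow> 'k::field) set"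
  assumes "is_path Q v bs" "X \<in> carrier (bound_algebra Q)" "reduced Q (w, as)"
    and "\<And>u cs. coef X (u, cs) \<noteq> 0 \<Longrightarrow> u = path_end Q v bs"
  shows "coef (path_class Q (v, bs) \<otimes>\<^bsub>bound_algebra Q\<^esub> X) (w, as) =
    (if w = v \<and> take (length bs) as = bs then coef X (path_end Q v bs, drop (length bs) as) else 0)"
proof -
  have "coef (path_class Q (v, bs) \<otimes>\<^bsub>bound_algebra Q\<^esub> X) (w, as) =
    (\<Sum>i\<le>length as. if i = length bs then if w = v \<and> take (length bs) as = bs
       then coef X (path_end Q v bs, drop (length bs) as) else 0 else 0)"
    unfolding coef_mult[OF coef_path_class(1)[OF assms(1)] assms(2) rep_exists[OF assms(2)] assms(3)]
  proof (rule sum.cong)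
    fix i assume i: "i \<in> {..length as}"
    have red: "reduced Q (w, take i as)" "reduced Q (path_end Q w (take i as), drop i as)"
      using assms(3) reduced_append[of Q w "take i as" "drop i as"] by auto
    show "coef (path_class Q (v, bs)) (w, take i as) * (SOME x. x \<in> X) (path_end Q w (take i as), drop i as) =
      (if i = length bs then if w = v \<and> take (length bs) as = bs
       then coef X (path_end Q v bs, drop (length bs) as) else 0 else 0)"
    proof -
      have "(SOME x. x \<in> X) (path_end Q w (take i as), drop i as) = coef X (path_end Q w (take i as), drop i as)"
        using red by (simp add: coef_def)
      then show ?thesis using i red by (auto simp: coef_path_class[OF assms(1)])
    qed
  qed simp
  also have "\<dots> = (if w = v \<and> take (length bs) as = bs then coef X (path_end Q v bs, drop (length bs) as) else 0)"
    by auto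
  finally show ?thesis .
qed

end

section \<open>Reduced paths in the quiver of a surface\<close>

definition nth_after :: "('p, 'h) ribbon_surface \<Rightarrow> 'h \<Rightarrow> nat \<Rightarrow> 'h" where
  "nth_after S h n = (h # succs S h) ! n"

definition chain :: "('p, 'h) ribbon_surface \<Rightarrow> 'h \<Rightarrow> nat \<Rightarrow> ('h \<times> 'h) list" where
  "chain S h n = map (\<lambda>j. (nth_after S h j, nth_after S h (Suc j))) [0..<n]"

abbreviation fan_deg :: "('p, 'h) ribbon_surface \<Rightarrow> 'h \<Rightarrow> nat" where
  "fan_deg S h \<equiv> length (succs S h)"

text \<open>Coordinates on the projective permissible curve of \<open>e\<close>, with origin at the crossing \<open>e\<close>.\<close>

definition coord_path :: "('p, 'h) ribbon_surface \<Rightarrow> 'h \<Rightarrow> int \<Rightarrow> ('h \<times> 'h) list" where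
  "coord_path S e x = (if 0 \<le> x then chain S e (nat x) else chain S (opp S e) (nat (- x)))"

text \<open>On the negative side the half-edges are reversed as in \<open>cproj\<close>, whose
  crossings before e are opposite to the successors of \<open>opp S e\<close>.\<close>

definition coord_cross :: "('p, 'h) ribbon_surface \<Rightarrow> 'h \<Rightarrow> int \<Rightarrow> 'h" where
  "coord_cross S e x = (if 0 \<le> x then nth_after S e (nat x) else opp S (nth_after S (opp S e) (nat (- x))))"

definition coord_range :: "('p, 'h) ribbon_surface \<Rightarrow> 'h \<Rightarrow> int set" where
  "coord_range S e = {- int (fan_deg S (opp S e)) .. int (fan_deg S e)}"

lemma nth_after_0 [simp]: "nth_after S h 0 = h"
  and nth_after_Suc: "nth_after S h (Suc n) = succs S h ! n"
  by (simp_all add: nth_after_def)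

lemma length_chain [simp]: "length (chain S h n) = n"
  by (simp add: chain_def)

lemma chain_0 [simp]: "chain S h 0 = []"
  by (simp add: chain_def)

lemma chain_eq_Nil [simp]: "chain S h n = [] \<longleftrightarrow> n = 0"
  by (simp add: chain_def)

lemma take_chain: "take k (chain S h n) = chain S h (min k n)"
  by (rule nth_equalityI) (auto simp: chain_def)

lemma chain_Suc: "chain S h (Suc n) = chain S h n @ [(nth_after S h n, nth_after S h (Suc n))]"
  by (simp add: chain_def)

lemma hd_chain: "0 < n \<Longrightarrow> fst (hd (chain S h n)) = h"
  by (simp add: chain_def hd_map)

lemma length_coord_path [simp]: "length (coord_path S e x) = nat \<bar>x\<bar>"
  by (simp add: coord_path_def)

lemma surface_quiver_simps:
  "src (surface_quiver S) a = arc S (fst a)" "tgt (surface_quiver S) a = arc S (snd a)"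
  "a \<in> arrows (surface_quiver S) \<longleftrightarrow> corner S (fst a) (snd a)"
  "verts (surface_quiver S) = arc S ` half_edges S"
  "((x, y), (x', z)) \<in> rels (surface_quiver S) \<longleftrightarrow> x' = opp S y \<and> corner S x y \<and> corner S x' z"
  by (auto simp: surface_quiver_def split: prod.splits)

context
  fixes S :: "('p, 'h) ribbon_surface"
  assumes S: "marked_ribbon_surface S"
begin

lemma finite_bound_quiver_surface: "finite_bound_quiver (surface_quiver S)"
proof
  show "finite (verts (surface_quiver S))" using finite_half_edges[OF S] by (simp add: surface_quiver_simps)
  fix a b assume "(a, b) \<in> rels (surface_quiver S)"
  then show "is_path (surface_quiver S) (src (surface_quiver S) a) [a, b]"
    using corner_half_edges[OF S] arc_opp[OF S] by (cases a; cases b) (auto simp: surface_quiver_simps)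
qed

lemma succs_split:
  assumes "h \<in> half_edges S" "succs S h = us @ h' # vs"
  shows "succs S h' = vs" "h' \<in> half_edges S"
proof -
  obtain p ws where "p \<in> pts S" "fan S p = ws @ h # succs S h" using half_edge_fan[OF S assms(1)] .
  then show "succs S h' = vs" "h' \<in> half_edges S"
    using succs_eq[OF S, of p "ws @ h # us" h' vs] assms(2)
    by (auto simp: half_edges_def intro!: bexI[of _ p])
qed

lemma nth_after_succs:
  assumes "h \<in> half_edges S" "a \<le> fan_deg S h"
  shows "nth_after S h a \<in> half_edges S" "succs S (nth_after S h a) = drop a (succs S h)"
proof -
  have "nth_after S h a \<in> half_edges S \<and> succs S (nth_after S h a) = drop a (succs S h)"
  proof (cases a)
    case (Suc b)
    then have "succs S h = take b (succs S h) @ succs S h ! b # drop a (succs S h)"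
      using assms(2) by (simp add: id_take_nth_drop)
    from succs_split[OF assms(1) this] show ?thesis by (simp add: Suc nth_after_Suc)
  qed (use assms in auto)
  then show "nth_after S h a \<in> half_edges S" "succs S (nth_after S h a) = drop a (succs S h)" by auto
qed

lemma nth_after_nth_after:
  assumes "h \<in> half_edges S" "a \<le> fan_deg S h"
  shows "nth_after S (nth_after S h a) n = nth_after S h (a + n)"
  using nth_after_succs[OF assms] assms(2) by (cases n) (auto simp: nth_after_Suc nth_after_def[of _ _ "_ + _"])

lemma fan_deg_nth_after:
  assumes "h \<in> half_edges S" "a \<le> fan_deg S h"
  shows "fan_deg S (nth_after S h a) = fan_deg S h - a"
  using nth_after_succs[OF assms] by simp

lemma drop_chain:
  assumes "h \<in> half_edges S" "a \<le> fan_deg S h"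
  shows "drop a (chain S h n) = chain S (nth_after S h a) (n - a)"
  by (rule nth_equalityI) (auto simp: chain_def nth_after_nth_after[OF assms])

lemma corner_iff_nth_after:
  "corner S x y \<longleftrightarrow> x \<in> half_edges S \<and> 0 < fan_deg S x \<and> y = nth_after S x 1"
  unfolding corner_succs[OF S] by (cases "succs S x") (auto simp: nth_after_def)

lemma corner_nth_after:
  assumes "h \<in> half_edges S" "j < fan_deg S h"
  shows "corner S (nth_after S h j) (nth_after S h (Suc j))"
  using assms nth_after_succs[OF assms(1), of j] nth_after_nth_after[OF assms(1), of j 1]
  by (simp add: corner_iff_nth_after)

text \<open>The half-edges of a fan are distinct, so the \<open>takeWhile\<close> in
  \<open>around\<close> stops exactly at h. This turns \<open>around\<close> into a
  \<open>chain\<close>, for which prefixes and suffixes are easy.\<close>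

lemma ccw_before_around:
  assumes "ccw_before S g h"
  shows "g \<in> half_edges S" "0 < length (around S g h)" "length (around S g h) \<le> fan_deg S g"
    "nth_after S g (length (around S g h)) = h" "around S g h = chain S g (length (around S g h))"
proof -
  obtain p us vs ws where p: "p \<in> pts S" "fan S p = us @ g # vs @ h # ws"
    using assms unfolding ccw_before_def by blast
  then show g: "g \<in> half_edges S" by (auto simp: half_edges_def intro!: bexI[of _ p])
  have s: "succs S g = vs @ h # ws" by (rule succs_eq[OF S p])
  have "distinct (fan S p)" using S p(1) unfolding marked_ribbon_surface_def by blast
  then have "g \<noteq> h" "h \<notin> set vs" unfolding p(2) by auto
  then have "takeWhile (\<lambda>x. x \<noteq> h) (g # succs S g) = g # vs"
    unfolding s by (simp add: takeWhile_append)
  then have ar: "around S g h = zip (g # vs @ [h]) (vs @ [h])" by (simp add: around_def)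
  then show l: "0 < length (around S g h)" "length (around S g h) \<le> fan_deg S g" by (simp_all add: s)
  show "nth_after S g (length (around S g h)) = h" by (simp add: ar s nth_after_def)
  show "around S g h = chain S g (length (around S g h))"
  proof (rule nth_equalityI)
    fix j assume "j < length (around S g h)"
    then have j: "j \<le> length vs" by (simp add: ar)
    have "nth_after S g k = (g # vs @ [h]) ! k" if "k \<le> Suc (length vs)" for k
    proof -
      have "nth_after S g k = ((g # vs @ [h]) @ ws) ! k" by (simp add: nth_after_def s)
      also have "\<dots> = (g # vs @ [h]) ! k" using that by (subst nth_append) auto
      finally show ?thesis .
    qed
    then show "around S g h ! j = chain S g (length (around S g h)) ! j"
      using j by (simp add: ar chain_def del: upt_Suc)
  qed simp
qed

lemma path_end_chain:
  assumes "h \<in> half_edges S"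
  shows "path_end (surface_quiver S) (arc S h) (chain S h n) = arc S (nth_after S h n)"
  by (cases n) (auto simp: path_end_def chain_Suc surface_quiver_simps)

text \<open>Consecutive corners of one fan meet in the same half-edge, whereas a relation passes to
  the opposite one.\<close>

lemma reduced_chain:
  assumes "h \<in> half_edges S" "n \<le> fan_deg S h"
  shows "reduced (surface_quiver S) (arc S h, chain S h n)"
  using assms(2)
proof (induction n)
  case 0
  then show ?case using assms(1) by (simp add: reduced_def surface_quiver_simps)
next
  case (Suc n)
  have c: "corner S (nth_after S h n) (nth_after S h (Suc n))"
    using Suc.prems by (intro corner_nth_after[OF assms(1)]) simp
  then have H: "nth_after S h n \<in> half_edges S" "nth_after S h (Suc n) \<in> half_edges S"
    using corner_half_edges[OF S] by blast+
  have "((x, nth_after S h n), (nth_after S h n, z)) \<notin> rels (surface_quiver S)" for x z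
    using opp_neq[OF S H(1)] by (auto simp: surface_quiver_simps)
  then show ?case
    using Suc c H path_end_chain[OF assms(1), of n]
    by (cases n) (auto simp: chain_Suc reduced_def is_path_append successively_append_iff surface_quiver_simps)
qed

text \<open>After a corner (x, y) the next arrow starts at y or at \<open>opp S y\<close>, and the
  second choice is a relation. So a path without relations never leaves the fan in which it
  starts.\<close>

lemma reduced_cases:
  assumes "reduced (surface_quiver S) (v, as)" "as \<noteq> []"
  shows "\<exists>h\<in>half_edges S. v = arc S h \<and> length as \<le> fan_deg S h \<and> as = chain S h (length as)"
  using assms
proof (induction as arbitrary: v)
  case (Cons a as)
  obtain x y where a: "a = (x, y)" by (cases a)
  have c: "corner S x y" "v = arc S x" using Cons.prems(1) by (auto simp: reduced_def a surface_quiver_simps)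
  have H: "x \<in> half_edges S" "y \<in> half_edges S" using corner_half_edges[OF S c(1)] by auto
  have y: "0 < fan_deg S x" "y = nth_after S x 1" using c(1) by (auto simp: corner_iff_nth_after)
  have nn: "nth_after S y k = nth_after S x (Suc k)" for k
    using nth_after_nth_after[OF H(1), of 1 k] y by simp
  have ch: "(x, y) # chain S y n = chain S x (Suc n)" if "Suc n \<le> fan_deg S x" for n
  proof (rule nth_equalityI)
    fix j assume "j < length ((x, y) # chain S y n)"
    then show "((x, y) # chain S y n) ! j = chain S x (Suc n) ! j"
      using y nn by (cases j) (auto simp: chain_def simp del: upt_Suc)
  qed simp
  show ?case
  proof (cases "as = []")
    case True
    moreover have "1 \<le> fan_deg S x" using y(1) by linarith
    ultimately show ?thesis using H(1) c(2) ch[of 0] by (intro bexI[of _ x]) (simp_all add: a)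
  next
    case False
    have "reduced (surface_quiver S) (arc S y, as)" using Cons.prems(1) False
      by (cases as) (auto simp: reduced_def a surface_quiver_simps)
    from Cons.IH[OF this False] obtain h where h: "h \<in> half_edges S" "arc S y = arc S h"
      "length as \<le> fan_deg S h" "as = chain S h (length as)" by blast
    obtain b as' where as: "as = b # as'" using False by (cases as) auto
    have "fst (hd as) = h" using h(4) hd_chain[of "length as" S h] False by (metis length_greater_0_conv)
    then have b: "fst b = h" by (simp add: as)
    have "h \<noteq> opp S y"
    proof
      assume ho: "h = opp S y"
      obtain z where "b = (opp S y, z)" using b ho by (cases b) auto
      moreover from this have "corner S (opp S y) z" using Cons.prems(1) by (auto simp: reduced_def as surface_quiver_simps)
      ultimately have "(a, b) \<in> rels (surface_quiver S)" using c(1) by (auto simp: a surface_quiver_simps)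
      then show False using Cons.prems(1) by (auto simp: reduced_def as)
    qed
    then have "h = y" using arc_eq[OF S, of y h] H(2) h(2) by simp
    then have l: "length (a # as) \<le> fan_deg S x"
    proof -
      have d: "1 \<le> fan_deg S x" using y(1) by linarith
      then show ?thesis using h(3) fan_deg_nth_after[OF H(1) d] unfolding \<open>h = y\<close> y(2) by simp
    qed
    moreover have "a # as = chain S x (length (a # as))"
      using ch[of "length as"] h(4) \<open>h = y\<close> l by (simp add: a)
    ultimately show ?thesis using H(1) c(2) by blast
  qed
qed simp

section \<open>Coordinates for the non-zero paths starting at an arc\<close>

text \<open>Reversing the orientation reflects the coordinates, so that computations on the arm
  after a half-edge serve for both arms.\<close>

lemma coord_opp:
  assumes "e \<in> half_edges S" "x \<in> coord_range S e"
  shows "coord_path S (opp S e) (- x) = coord_path S e x"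
    "- x \<in> coord_range S (opp S e)"
proof -
  show "coord_path S (opp S e) (- x) = coord_path S e x"
    using opp_opp[OF S assms(1)] by (auto simp: coord_path_def)
  show "- x \<in> coord_range S (opp S e)"
    using assms opp_opp[OF S assms(1)] by (auto simp: coord_range_def)
qed

lemma reduced_coord_path:
  assumes "e \<in> half_edges S" "x \<in> coord_range S e"
  shows "reduced (surface_quiver S) (arc S e, coord_path S e x)"
    "path_end (surface_quiver S) (arc S e) (coord_path S e x) = arc S (coord_cross S e x)"
    "coord_cross S e x \<in> half_edges S"
proof -
  have o: "opp S e \<in> half_edges S" by (rule opp_half_edges[OF S assms(1)])
  show "reduced (surface_quiver S) (arc S e, coord_path S e x)"
    using reduced_chain[OF assms(1), of "nat x"] reduced_chain[OF o, of "nat (- x)"] assms(2)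
    by (auto simp: coord_path_def coord_range_def arc_opp[OF S assms(1)])
  have n: "nth_after S (opp S e) (nat (- x)) \<in> half_edges S" if "\<not> 0 \<le> x"
    using that assms(2) by (intro nth_after_succs o) (auto simp: coord_range_def)
  show "path_end (surface_quiver S) (arc S e) (coord_path S e x) = arc S (coord_cross S e x)"
    using path_end_chain[OF assms(1), of "nat x"] path_end_chain[OF o, of "nat (- x)"] n
    by (auto simp: coord_path_def coord_cross_def arc_opp[OF S] arc_opp[OF S assms(1)] path_end_def split: if_splits)
  show "coord_cross S e x \<in> half_edges S"
    using n opp_half_edges[OF S] nth_after_succs(1)[OF assms(1), of "nat x"] assms(2)
    by (auto simp: coord_cross_def coord_range_def)
qed

text \<open>The length gives the absolute value, and the first half-edge, e or
  \<open>opp S e\<close>, gives the sign.\<close>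

lemma coord_path_inj:
  assumes "e \<in> half_edges S" "coord_path S e x = coord_path S e y"
  shows "x = y"
proof -
  have "nat \<bar>x\<bar> = nat \<bar>y\<bar>" using assms(2) length_coord_path by metis
  moreover have False if "x \<ge> 0" "y < 0" "coord_path S e x = coord_path S e y" for x y
  proof -
    have "nat \<bar>x\<bar> = nat \<bar>y\<bar>" using that(3) length_coord_path by metis
    then have "x > 0" using that by auto
    then have "e = opp S e"
      using that hd_chain[of "nat x" S e] hd_chain[of "nat (- y)" S "opp S e"] by (auto simp: coord_path_def)
    then show False using opp_neq[OF S assms(1)] by simp
  qed
  ultimately show ?thesis using assms(2) by (metis abs_if linorder_not_le nat_eq_iff2 abs_ge_zero neg_equal_iff_equal nat_0_le abs_minus_cancel)
qed

text \<open>Together with \<open>reduced_coord_path\<close> and \<open>coord_path_inj\<close> this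
  makes the coordinates an enumeration of the basis of the projective at the arc of e.\<close>

lemma reduced_coord_cases:
  assumes "e \<in> half_edges S" "reduced (surface_quiver S) (arc S e, as)"
  obtains x where "x \<in> coord_range S e" "as = coord_path S e x"
proof (cases "as = []")
  case True
  then show ?thesis by (intro that[of 0]) (auto simp: coord_range_def coord_path_def)
next
  case False
  from reduced_cases[OF assms(2) False] obtain h where
    h: "h \<in> half_edges S" "arc S e = arc S h" "length as \<le> fan_deg S h" "as = chain S h (length as)" by blast
  from arc_eq[OF S assms(1) h(2)] show ?thesis
  proof
    assume "h = e"
    then show ?thesis using h by (intro that[of "int (length as)"]) (auto simp: coord_range_def coord_path_def)
  next
    assume "h = opp S e"
    then show ?thesis using h False by (intro that[of "- int (length as)"]) (auto simp: coord_range_def coord_path_def)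
  qed
qed

lemma coord_path_step_pos:
  assumes "0 < x"
  shows "coord_path S e x = coord_path S e (x - 1) @ [(coord_cross S e (x - 1), coord_cross S e x)]"
proof -
  have "nat x = Suc (nat (x - 1))" using assms by simp
  then show ?thesis using assms unfolding coord_path_def coord_cross_def by (simp add: chain_Suc)
qed

lemma coord_path_step_neg:
  assumes "e \<in> half_edges S" "x \<in> coord_range S e" "x < 0"
  shows "coord_path S e x = coord_path S e (x + 1) @ [(opp S (coord_cross S e (x + 1)), opp S (coord_cross S e x))]"
proof -
  have o: "opp S e \<in> half_edges S" by (rule opp_half_edges[OF S assms(1)])
  have n: "nat (- x) = Suc (nat (- x - 1))" using assms by simp
  have oo: "opp S (opp S (nth_after S (opp S e) k)) = nth_after S (opp S e) k" if "k \<le> nat (- x)" for k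
    using that assms(2) by (intro opp_opp[OF S] nth_after_succs o) (auto simp: coord_range_def)
  have "opp S (coord_cross S e (x + 1)) = nth_after S (opp S e) (nat (- x - 1))"
    using assms(3) oo[of "nat (- x - 1)"] by (auto simp: coord_cross_def)
  moreover have "opp S (coord_cross S e x) = nth_after S (opp S e) (nat (- x))"
    using assms(3) oo[of "nat (- x)"] by (auto simp: coord_cross_def)
  moreover have "coord_path S e (x + 1) = chain S (opp S e) (nat (- x - 1))"
    using assms(3) by (auto simp: coord_path_def)
  moreover have "coord_path S e x = chain S (opp S e) (nat (- x))"
    using assms(3) by (auto simp: coord_path_def)
  ultimately show ?thesis unfolding n by (simp add: chain_Suc)
qed

lemma take_coord_path:
  assumes "k \<le> nat \<bar>x\<bar>"
  shows "take k (coord_path S e x) = coord_path S e (sgn x * int k)"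
  using assms by (auto simp: coord_path_def take_chain sgn_if)

lemma coord_corner:
  assumes "e \<in> half_edges S" "x \<in> coord_range S e"
  shows "0 < x \<Longrightarrow> corner S (coord_cross S e (x - 1)) (coord_cross S e x)"
    "x < 0 \<Longrightarrow> corner S (opp S (coord_cross S e (x + 1))) (opp S (coord_cross S e x))"
proof -
  have r: "reduced (surface_quiver S) (arc S e, coord_path S e x)" using assms by (rule reduced_coord_path)
  show "0 < x \<Longrightarrow> corner S (coord_cross S e (x - 1)) (coord_cross S e x)"
    using r coord_path_step_pos[of x e] by (auto simp: reduced_def is_path_append surface_quiver_simps)
  show "x < 0 \<Longrightarrow> corner S (opp S (coord_cross S e (x + 1))) (opp S (coord_cross S e x))"
    using r coord_path_step_neg[OF assms] by (auto simp: reduced_def is_path_append surface_quiver_simps)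
qed

text \<open>The path at x runs through the chain iff it lies on the same arm and reaches at least a.
  What remains has the coordinate x - a >= 0 at the end of the chain, so the basis elements of X on
  the other arm are annihilated.\<close>

lemma coef_chain_mult:
  fixes X :: "(('h set, 'h \<times> 'h) path \<Rightarrow> 'k::field) set"
  assumes "e \<in> half_edges S" "0 < a" "a \<le> fan_deg S e" "x \<in> coord_range S e"
    and X: "X \<in> carrier (bound_algebra (surface_quiver S))" "\<And>u cs. finite_bound_quiver.coef (surface_quiver S) X (u, cs) \<noteq> 0 \<Longrightarrow> u = arc S (nth_after S e a)"
  shows "finite_bound_quiver.coef (surface_quiver S) (path_class (surface_quiver S) (arc S e, chain S e a) \<otimes>\<^bsub>bound_algebra (surface_quiver S)\<^esub> X) (arc S e, coord_path S e x) =
    (if int a \<le> x then finite_bound_quiver.coef (surface_quiver S) X (arc S (nth_after S e a), coord_path S (nth_after S e a) (x - int a)) else 0)"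
proof -
  interpret finite_bound_quiver "surface_quiver S" by (rule finite_bound_quiver_surface)
  have pe: "path_end (surface_quiver S) (arc S e) (chain S e a) = arc S (nth_after S e a)" by (rule path_end_chain[OF assms(1)])
  have p: "is_path (surface_quiver S) (arc S e) (chain S e a)" using reduced_chain[OF assms(1,3)] by (simp add: reduced_def)
  have 1: "take (length (chain S e a)) (coord_path S e x) = chain S e a \<longleftrightarrow> int a \<le> x"
  proof
    assume t: "take (length (chain S e a)) (coord_path S e x) = chain S e a"
    then have "length (take (length (chain S e a)) (coord_path S e x)) = a" by simp
    then have "int a \<le> \<bar>x\<bar>" by simp
    \<comment> \<open>On the other arm the first half-edge would be \<open>opp S e\<close>.\<close>
    moreover have "\<not> x < 0"
    proof
      assume "x < 0"
      then have "take a (coord_path S e x) = chain S (opp S e) (min a (nat (- x)))"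
        by (simp add: coord_path_def take_chain)
      then have "chain S (opp S e) (min a (nat (- x))) = chain S e a" using t by simp
      then have "e = opp S e"
        using hd_chain[of "min a (nat (- x))" S "opp S e"] hd_chain[of a S e] assms(2) \<open>x < 0\<close> by simp
      then show False using opp_neq[OF S assms(1)] by simp
    qed
    ultimately show "int a \<le> x" by simp
  next
    assume "int a \<le> x"
    then show "take (length (chain S e a)) (coord_path S e x) = chain S e a"
      by (simp add: coord_path_def take_chain min_def) linarith
  qed
  have 2: "drop (length (chain S e a)) (coord_path S e x) = coord_path S (nth_after S e a) (x - int a)" if "int a \<le> x"
    using that by (simp add: coord_path_def drop_chain[OF assms(1,3)] nat_diff_distrib)
  have X': "\<And>u cs. coef X (u, cs) \<noteq> 0 \<Longrightarrow> u = path_end (surface_quiver S) (arc S e) (chain S e a)"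
    unfolding pe by (rule X(2))
  have "coef (path_class (surface_quiver S) (arc S e, chain S e a) \<otimes>\<^bsub>bound_algebra (surface_quiver S)\<^esub> X) (arc S e, coord_path S e x) =
    (if arc S e = arc S e \<and> take (length (chain S e a)) (coord_path S e x) = chain S e a
     then coef X (path_end (surface_quiver S) (arc S e) (chain S e a), drop (length (chain S e a)) (coord_path S e x)) else 0)"
    by (rule coef_path_mult[OF p X(1) reduced_coord_path(1)[OF assms(1,4)] X'])
  then show ?thesis using 1 2 pe by simp
qed

end

section \<open>The complex in coordinates\<close>

text \<open>The \<open>i\<close>-th projective has basis elements with coordinates from \<open>- l i\<close> to \<open>r i\<close>, where 0 is the trivial
  path. If \<open>L i\<close>, the differential maps \<open>(i + 1, x)\<close> to \<open>(i, a i - x)\<close> for \<open>x \<le> 0\<close>; if \<open>R i\<close>, it maps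
  \<open>(i, x)\<close> to \<open>(i + 1, - b i - x)\<close> for \<open>x \<ge> 0\<close>. The set \<open>I n\<close> consists of the indices in degree \<open>n\<close>.\<close>

locale zigzag =
  fixes L R :: "nat \<Rightarrow> bool" and l r a b :: "nat \<Rightarrow> int" and I :: "int \<Rightarrow> nat set"
  assumes L_len: "L i \<Longrightarrow> 0 < a i \<and> r i = a i + l (i + 1)"
    and R_len: "R i \<Longrightarrow> 0 < b i \<and> l (i + 1) = b i + r i"
    and LR: "L i \<Longrightarrow> \<not> R i"
    and L_I: "L i \<Longrightarrow> i \<in> I (n + 1) \<longleftrightarrow> i + 1 \<in> I n"
    and R_I: "R i \<Longrightarrow> i + 1 \<in> I (n + 1) \<longleftrightarrow> i \<in> I n"
    and nonneg: "0 \<le> l i" "0 \<le> r i"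
    and not_0: "\<not> L 0" "\<not> R 0"
begin

section \<open>The differential and its kernel\<close>

definition terms :: "int \<Rightarrow> (nat \<Rightarrow> int \<Rightarrow> 'k::field) set" where
  "terms n = {u. \<forall>i x. u i x \<noteq> 0 \<longrightarrow> i \<in> I n \<and> - l i \<le> x \<and> x \<le> r i}"

text \<open>Written at the target. The reflections are their own inverses, and the conditions on x
  say that the source coordinate is <= 0, respectively >= 0.\<close>

definition boundary :: "int \<Rightarrow> (nat \<Rightarrow> int \<Rightarrow> 'k::field) \<Rightarrow> nat \<Rightarrow> int \<Rightarrow> 'k" where
  "boundary n u i x = (if i \<in> I (n + 1) \<and> - l i \<le> x \<and> x \<le> r i then
     (if L i \<and> a i \<le> x then u (i + 1) (a i - x) else 0) +
     (if R (i - 1) \<and> x \<le> - b (i - 1) then u (i - 1) (- b (i - 1) - x) else 0) else 0)"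

definition cycles :: "int \<Rightarrow> (nat \<Rightarrow> int \<Rightarrow> 'k::field) set" where
  "cycles n = {u \<in> terms n. \<forall>i x. boundary n u i x = 0}"

text \<open>The basis elements surviving in cohomology are those with coordinates from \<open>lo\<close> to \<open>hi\<close>. There are none if
  \<open>hi i < lo i\<close>; the case \<open>L (i - 1)\<close>, \<open>R i\<close>, where \<open>0\<close> is not a cycle, is covered by \<open>lo i = 1\<close>, \<open>hi i = - 1\<close>.\<close>

definition lo :: "nat \<Rightarrow> int" where
  "lo i = (if L (i - 1) then 1 else if R (i - 1) then 1 - b (i - 1) else - l i)"

definition hi :: "nat \<Rightarrow> int" where
  "hi i = (if R i then - 1 else if L i then (if R (i + 1) then a i else a i - 1) else r i)"

definition cells :: "int \<Rightarrow> (nat \<times> int) set" where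
  "cells n = {(i, x). i \<in> I n \<and> lo i \<le> x \<and> x \<le> hi i}"

text \<open>If \<open>D\<^sub>i\<^sub>+\<^sub>1\<close> maps to both neighbours, its top is sent to the sum of the basis elements
  \<open>(i, a i)\<close> and \<open>(i + 2, - b (i + 1))\<close>, which become opposite in cohomology. The sign makes them equal.\<close>

definition eps :: "nat \<Rightarrow> 'k::field" where
  "eps i = (- 1) ^ (i div 2)"

text \<open>The coordinate functionals of cohomology. The partner (i + 2, - b (i + 1)) of a glued
  cell lies just below \<open>lo (i + 2)\<close>, so it is not a cell itself.\<close>

definition psi :: "(nat \<Rightarrow> int \<Rightarrow> 'k::field) \<Rightarrow> nat \<times> int \<Rightarrow> 'k" where
  "psi u = (\<lambda>(i, x). eps i * u i x +
     (if L i \<and> R (i + 1) \<and> x = a i then eps (i + 2) * u (i + 2) (- b (i + 1)) else 0))"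

lemma eps_sq: "eps i * eps i = (1 :: 'k::field)"
  by (simp add: eps_def power_add[symmetric] mult_2[symmetric])

lemma eps_nz: "eps i \<noteq> (0 :: 'k::field)"
  by (simp add: eps_def)

text \<open>In the natural numbers 0 - 1 = 0; \<open>not_0\<close> rules out i = 0, so i - 1 is a
  true predecessor.\<close>

lemma R_pred: "R (i - 1) \<Longrightarrow> 0 < b (i - 1) \<and> l i = b (i - 1) + r (i - 1) \<and> i \<ge> 1 \<and> \<not> L (i - 1)"
  using R_len[of "i - 1"] not_0 LR[of "i - 1"] by (cases i) auto

lemma L_pred: "L (i - 1) \<Longrightarrow> 0 < a (i - 1) \<and> r (i - 1) = a (i - 1) + l i \<and> i \<ge> 1 \<and> \<not> R (i - 1)"
  using L_len[of "i - 1"] not_0 LR[of "i - 1"] by (cases i) auto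

lemma lo_bounds: "- l i \<le> lo i" "lo i \<le> 1" "0 < lo i \<Longrightarrow> L (i - 1) \<and> lo i = 1"
  using nonneg[of i] nonneg[of "i - 1"] R_pred[of i] by (auto simp: lo_def split: if_splits)

lemma hi_bounds: "hi i \<le> r i" "- 1 \<le> hi i" "hi i < 0 \<Longrightarrow> R i \<and> hi i = - 1"
  using nonneg[of i] nonneg[of "i + 1"] L_len[of i] by (auto simp: hi_def split: if_splits)

text \<open>The summand from i + 1 occurs only for x >= a i > 0 and the one from i - 1 only for x <=
  - b (i - 1) < 0. So each coordinate of the boundary is zero or a single coordinate of u, and each
  coordinate of u that is not killed reappears there.\<close>

lemma cycles_iff:
  "u \<in> cycles n \<longleftrightarrow> u \<in> terms n \<and> (\<forall>i x. R i \<and> 0 \<le> x \<longrightarrow> u i x = 0) \<and>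
     (\<forall>i x. L (i - 1) \<and> x \<le> 0 \<longrightarrow> u i x = 0)" (is "_ \<longleftrightarrow> _ \<and> ?R \<and> ?L")
proof
  assume u: "u \<in> cycles n"
  then have t: "u \<in> terms n" and d0: "\<And>i x. boundary n u i x = 0" by (auto simp: cycles_def)
  have ?R
  proof (intro allI impI, rule ccontr)
    fix i x assume *: "R i \<and> 0 \<le> x" "u i x \<noteq> 0"
    then have i: "i \<in> I n" "x \<le> r i" using t by (auto simp: terms_def)
    have "boundary n u (i + 1) (- b i - x) = u i x"
      using * i R_len[of i] R_I[of i n] L_len[of "i + 1"] nonneg[of "i + 1"] by (auto simp: boundary_def)
    then show False using d0 * by simp
  qed
  moreover have ?L
  proof (intro allI impI, rule ccontr)
    fix i x assume *: "L (i - 1) \<and> x \<le> 0" "u i x \<noteq> 0"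
    then have i: "i \<in> I n" "- l i \<le> x" using t by (auto simp: terms_def)
    have "boundary n u (i - 1) (a (i - 1) - x) = u i x"
      using * i L_pred[of i] L_I[of "i - 1" n] R_pred[of "i - 1"] nonneg[of "i - 1"] by (auto simp: boundary_def)
    then show False using d0 * by simp
  qed
  ultimately show "u \<in> terms n \<and> ?R \<and> ?L" using t by blast
next
  assume *: "u \<in> terms n \<and> ?R \<and> ?L"
  have "boundary n u i x = 0" for i x
    using * R_pred[of i] L_pred[of "i + 1"] by (auto simp: boundary_def)
  then show "u \<in> cycles n" using * by (simp add: cycles_def)
qed

lemma terms_iff: "u \<in> terms n \<longleftrightarrow> (\<forall>i x. \<not> (i \<in> I n \<and> - l i \<le> x \<and> x \<le> r i) \<longrightarrow> u i x = 0)"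
  by (auto simp: terms_def)

lemma cycles_closed:
  assumes "u \<in> cycles n"
  shows "w \<in> cycles n \<Longrightarrow> (\<lambda>i x. u i x + w i x) \<in> cycles n"
    and "w \<in> cycles n \<Longrightarrow> (\<lambda>i x. u i x - w i x) \<in> cycles n"
  using assms unfolding cycles_iff terms_iff by simp_all

lemma psi_add: "psi (\<lambda>i x. u i x + w i x) p = psi u p + psi w p"
  by (auto simp: psi_def algebra_simps split: prod.splits)

lemma psi_diff: "psi (\<lambda>i x. u i x - w i x) p = psi u p - psi w p"
  by (auto simp: psi_def algebra_simps split: prod.splits)

lemma psi_scale: "psi (\<lambda>i x. k * u i x) p = k * psi u p"
  by (auto simp: psi_def algebra_simps split: prod.splits)

lemma psi_sum: "psi (\<lambda>i x. \<Sum>q\<in>Q. u q i x) p = (\<Sum>q\<in>Q. psi (u q) p)"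
  by (auto simp: psi_def sum.distrib sum_distrib_left split: prod.splits)

section \<open>Boundaries are the cycles on which all coordinate functionals vanish\<close>

lemma boundary_terms: "boundary n u \<in> terms (n + 1)"
  by (auto simp: boundary_def terms_def)

text \<open>A boundary reaches a cell only if the cell is glued. There both coordinates are the
  coefficient of w at the top of the middle projective, and \<open>eps\<close> changes sign from i
  to i + 2.\<close>

lemma psi_boundary:
  assumes "(i, x) \<in> cells n"
  shows "psi (boundary (n - 1) w) (i, x) = 0"
proof -
  have i: "i \<in> I n" "lo i \<le> x" "x \<le> hi i" using assms by (auto simp: cells_def)
  have rng: "- l i \<le> x" "x \<le> r i" using i lo_bounds[of i] hi_bounds[of i] by linarith+
  have n2: "\<not> (R (i - 1) \<and> x \<le> - b (i - 1))" using i R_pred[of i] by (auto simp: lo_def)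
  show ?thesis
  proof (cases "L i \<and> a i \<le> x")
    case False
    then show ?thesis using n2 by (auto simp: psi_def boundary_def)
  next
    case True
    then have *: "x = a i" "R (i + 1)" using i LR[of i] by (auto simp: hi_def split: if_splits)
    have "i + 2 \<in> I n" using L_I[of i "n - 1"] R_I[of "i + 1" "n - 1"] True * i by simp
    moreover have "\<not> (L (i + 2) \<and> a (i + 2) \<le> - b (i + 1))" "- l (i + 2) \<le> - b (i + 1)" "- b (i + 1) \<le> r (i + 2)"
      using L_len[of "i + 2"] R_len[of "i + 1"] * nonneg[of "i + 1"] nonneg[of "i + 2"] by auto
    ultimately have "boundary (n - 1) w (i + 2) (- b (i + 1)) = w (i + 1) 0"
      using * by (auto simp: boundary_def)
    moreover have "boundary (n - 1) w i x = w (i + 1) 0" using i rng n2 True * by (auto simp: boundary_def)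
    ultimately show ?thesis using True * by (simp add: psi_def eps_def)
  qed
qed

text \<open>At i a boundary has coordinates x > 0 only if \<open>L i\<close>, which excludes
  \<open>R i\<close>, and coordinates x < 0 only if \<open>R (i - 1)\<close>, which excludes
  \<open>L (i - 1)\<close>. So the next differential kills it.\<close>

lemma boundary_cycle: "boundary (n - 1) w \<in> cycles n"
proof -
  have "R i \<and> 0 \<le> x \<longrightarrow> boundary (n - 1) w i x = 0" for i x
    using LR[of i] R_pred[of i] by (auto simp: boundary_def)
  moreover have "L (i - 1) \<and> x \<le> 0 \<longrightarrow> boundary (n - 1) w i x = 0" for i x
    using L_len[of i] L_pred[of i] by (auto simp: boundary_def)
  ultimately show ?thesis unfolding cycles_iff using boundary_terms[of "n - 1" w] by simp
qed

lemma exact: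
  fixes z :: "nat \<Rightarrow> int \<Rightarrow> 'k::field"
  assumes z: "z \<in> cycles n" and psi0: "\<And>p. p \<in> cells n \<Longrightarrow> psi z p = 0"
  shows "\<exists>w\<in>terms (n - 1). z = boundary (n - 1) w"
proof -
  \<comment> \<open>The preimage inverts the differential basis element by basis element. A top
    mapping to both neighbours offers two values for y = 0; the first branch takes the one in the
    right neighbour k + 1.\<close>
  define w where "w k y = (if k \<in> I (n - 1) \<and> - l k \<le> y \<and> y \<le> r k then
    if R k \<and> 0 \<le> y then z (k + 1) (- b k - y)
    else if L (k - 1) \<and> y \<le> 0 then z (k - 1) (a (k - 1) - y) else 0 else 0)" for k y
  have zt: "z \<in> terms n" and zR: "\<And>i x. R i \<Longrightarrow> 0 \<le> x \<Longrightarrow> z i x = 0"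
    and zL: "\<And>i x. L (i - 1) \<Longrightarrow> x \<le> 0 \<Longrightarrow> z i x = 0"
    using z unfolding cycles_iff by blast+
  have "z i x = boundary (n - 1) w i x" for i x
  proof (cases "i \<in> I n \<and> - l i \<le> x \<and> x \<le> r i")
    case False
    then have "z i x = 0" using zt by (auto simp: terms_def)
    then show ?thesis using False by (auto simp: boundary_def)
  next
    case True
    consider (l) "L i" "a i \<le> x" | (r) "R (i - 1)" "x \<le> - b (i - 1)" |
      (n) "\<not> (L i \<and> a i \<le> x)" "\<not> (R (i - 1) \<and> x \<le> - b (i - 1))" by blast
    then show ?thesis
    proof cases
      case l
      have i1: "i + 1 \<in> I (n - 1)" using L_I[of i "n - 1"] l True by simp
      have "boundary (n - 1) w i x = w (i + 1) (a i - x)"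
        using l True L_len[of i] R_pred[of i] by (auto simp: boundary_def)
      also have "\<dots> = z i x"
      proof (cases "R (i + 1) \<and> x = a i")
        \<comment> \<open>The value of w was read off at i + 2; the vanishing of
          \<open>psi z\<close> at the glued cell makes it agree with z at i.\<close>
        case True2: True
        have "(i, x) \<in> cells n"
          using True True2 l LR[of i] lo_bounds(2)[of i] L_len[of i] by (auto simp: cells_def hi_def)
        then have "psi z (i, x) = 0" by (rule psi0)
        then have "eps i * (z i x - z (i + 2) (- b (i + 1))) = 0"
          using True2 l by (simp add: psi_def eps_def algebra_simps)
        then have "z i x = z (i + 2) (- b (i + 1))" by (simp add: eps_nz)
        then show ?thesis using True2 i1 nonneg[of "i + 1"] by (simp add: w_def)
      next
        case False
        then show ?thesis using l True i1 L_len[of i] nonneg[of "i + 1"] by (auto simp: w_def)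
      qed
      finally show ?thesis by simp
    next
      case r
      then have i: "i = Suc (i - 1)" using R_pred[of i] by simp
      have i1: "i - 1 \<in> I (n - 1)" using R_I[of "i - 1" "n - 1"] r True i by simp
      have "boundary (n - 1) w i x = w (i - 1) (- b (i - 1) - x)"
        using r True L_len[of i] R_pred[of i] by (auto simp: boundary_def)
      also have "\<dots> = z (i - 1 + 1) x"
        using r True i1 R_pred[of i] nonneg[of "i - 1"] by (auto simp: w_def)
      finally show ?thesis using i by simp
    next
      \<comment> \<open>Off the image z has to vanish: on cells because \<open>psi z\<close> does,
        elsewhere because z is a cycle.\<close>
      case n
      have "z i x = 0"
      proof (cases "(i, x) \<in> cells n")
        case c: True
        then have "psi z (i, x) = 0" by (rule psi0)
        then show ?thesis using n by (auto simp: psi_def eps_nz split: if_splits)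
      next
        case False
        then have "x < lo i \<or> hi i < x" using True by (auto simp: cells_def)
        then show ?thesis
        proof
          assume "x < lo i"
          then show ?thesis using zL[of i x] n True by (auto simp: lo_def split: if_splits)
        next
          assume "hi i < x"
          then show ?thesis using zR[of i x] n True by (auto simp: hi_def split: if_splits)
        qed
      qed
      then show ?thesis using n by (auto simp: boundary_def)
    qed
  qed
  then have "z = boundary (n - 1) w" by blast
  moreover have "w \<in> terms (n - 1)" by (auto simp: terms_def w_def)
  ultimately show ?thesis by blast
qed

text \<open>For a function supported on the cells the second summand of \<open>psi\<close> looks at
  a position that is no cell, and \<open>eps\<close> is its own inverse.\<close>

lemma psi_surj:
  fixes F :: "nat \<times> int \<Rightarrow> 'k::field"
  shows "\<exists>u\<in>cycles n. \<forall>p\<in>cells n. psi u p = F p"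
proof (intro bexI ballI)
  let ?u = "\<lambda>i x. if (i, x) \<in> cells n then eps i * F (i, x) else 0"
  have "i \<in> I n \<and> - l i \<le> x \<and> x \<le> r i" if "(i, x) \<in> cells n" for i x
    using that lo_bounds[of i] hi_bounds[of i] unfolding cells_def by simp
  then have "?u \<in> terms n" by (simp add: terms_def)
  moreover have "(i, x) \<notin> cells n" if "R i" "0 \<le> x" for i x
    using that by (simp add: cells_def hi_def)
  moreover have "(i, x) \<notin> cells n" if "L (i - 1)" "x \<le> 0" for i x
    using that unfolding cells_def lo_def by simp
  ultimately show "?u \<in> cycles n" unfolding cycles_iff by simp
  fix p assume p: "p \<in> cells n"
  obtain i x where ix: "p = (i, x)" by (cases p)
  have "(i + 2, - b (i + 1)) \<notin> cells n" if "R (i + 1)"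
    using that LR[of "i + 1"] by (auto simp: cells_def lo_def)
  then show "psi ?u p = F p" using p by (auto simp: ix psi_def mult.assoc[symmetric] eps_sq)
qed

text \<open>With \<open>psi_surj\<close>, cohomology becomes the space of functions on the
  cells.\<close>

lemma psi_eq_iff:
  assumes "u \<in> cycles n" "y \<in> cycles n"
  shows "(\<forall>p\<in>cells n. psi y p = psi u p) \<longleftrightarrow> (\<exists>w\<in>terms (n - 1). y = (\<lambda>i x. boundary (n - 1) w i x + u i x))"
proof
  assume "\<forall>p\<in>cells n. psi y p = psi u p"
  then have "\<exists>w\<in>terms (n - 1). (\<lambda>i x. y i x - u i x) = boundary (n - 1) w"
    by (intro exact cycles_closed assms) (auto simp: psi_diff)
  then obtain w where w: "w \<in> terms (n - 1)" "(\<lambda>i x. y i x - u i x) = boundary (n - 1) w" by blast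
  have "y = (\<lambda>i x. boundary (n - 1) w i x + u i x)" by (simp add: w(2)[symmetric])
  then show "\<exists>w\<in>terms (n - 1). y = (\<lambda>i x. boundary (n - 1) w i x + u i x)" using w(1) by blast
next
  assume "\<exists>w\<in>terms (n - 1). y = (\<lambda>i x. boundary (n - 1) w i x + u i x)"
  then show "\<forall>p\<in>cells n. psi y p = psi u p"
    using psi_boundary by (auto simp: psi_add)
qed

end

section \<open>The right action of the algebra in coordinates\<close>

locale labelled_zigzag = zigzag +
  fixes op :: "'h \<Rightarrow> 'h" and cr :: "nat \<Rightarrow> int \<Rightarrow> 'h"
  assumes cr_glue: "L i \<Longrightarrow> R (i + 1) \<Longrightarrow> cr i (a i) = cr (i + 2) (- b (i + 1))"
begin

text \<open>Right multiplication by an arrow prolongs a path, so a basis element moves one step away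
  from the origin.\<close>

definition arrow_act :: "'h \<times> 'h \<Rightarrow> (nat \<Rightarrow> int \<Rightarrow> 'k::field) \<Rightarrow> nat \<Rightarrow> int \<Rightarrow> 'k" where
  "arrow_act \<alpha> u i x = (if - l i \<le> x \<and> x \<le> r i then
     if 0 < x \<and> \<alpha> = (cr i (x - 1), cr i x) then u i (x - 1)
     else if x < 0 \<and> \<alpha> = (op (cr i (x + 1)), op (cr i x)) then u i (x + 1) else 0 else 0)"

definition vertex_act :: "('h \<Rightarrow> 'v) \<Rightarrow> 'v \<Rightarrow> (nat \<Rightarrow> int \<Rightarrow> 'k::field) \<Rightarrow> nat \<Rightarrow> int \<Rightarrow> 'k" where
  "vertex_act f v u i x = (if f (cr i x) = v then u i x else 0)"

lemma vertex_act_cycles: "u \<in> cycles n \<Longrightarrow> vertex_act f v u \<in> cycles n"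
  unfolding cycles_iff by (auto simp: terms_def vertex_act_def split: if_splits)

lemma arrow_act_cycles: "u \<in> cycles n \<Longrightarrow> arrow_act \<alpha> u \<in> cycles n"
  unfolding cycles_iff terms_def arrow_act_def by (auto split: if_splits)

text \<open>By \<open>cr_glue\<close> both summands at a glued cell lie over the same crossing, so a
  vertex keeps or kills them together.\<close>

lemma psi_vertex_act: "psi (vertex_act f v u) (i, x) = (if f (cr i x) = v then psi u (i, x) else 0)"
  using cr_glue[of i] by (auto simp: psi_def vertex_act_def)

text \<open>The three summands are the arrows into the cell: along the arm after the origin, along
  the arm before it, and through the glue from the next truncation. The starting position of such an
  arrow can be missing among the cells only if it is an origin at which the cycle vanishes.\<close>

lemma psi_arrow_act:
  assumes u: "u \<in> cycles n" and c: "(i, x) \<in> cells n"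
  shows "psi (arrow_act \<alpha> u) (i, x) =
    (if 0 < x \<and> lo i < x \<and> \<alpha> = (cr i (x - 1), cr i x) then psi u (i, x - 1) else 0) +
    (if x < 0 \<and> x < hi i \<and> \<alpha> = (op (cr i (x + 1)), op (cr i x)) then psi u (i, x + 1) else 0) +
    (if L i \<and> R (i + 1) \<and> x = hi i \<and> lo (i + 2) \<le> hi (i + 2) \<and>
       \<alpha> = (op (cr (i + 2) (lo (i + 2))), op (cr i x)) then psi u (i + 2, lo (i + 2)) else (0::'k::field))"
proof -
  have i: "i \<in> I n" "lo i \<le> x" "x \<le> hi i" using c by (auto simp: cells_def)
  have rng: "- l i \<le> x" "x \<le> r i" using i lo_bounds[of i] hi_bounds[of i] by linarith+
  have uR: "\<And>i x. R i \<Longrightarrow> 0 \<le> x \<Longrightarrow> u i x = 0"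
    and uL: "\<And>i x. L (i - 1) \<Longrightarrow> x \<le> 0 \<Longrightarrow> u i x = 0"
    using u unfolding cycles_iff by blast+
  have glue: "L i \<and> R (i + 1) \<and> x = a i \<longleftrightarrow> L i \<and> R (i + 1) \<and> x = hi i"
    using LR[of i] by (auto simp: hi_def)
  have hia: "L i \<Longrightarrow> hi i \<le> a i" using LR[of i] by (auto simp: hi_def)
  have 1: "eps i * (if 0 < x \<and> \<alpha> = (cr i (x - 1), cr i x) then u i (x - 1) else 0) =
    (if 0 < x \<and> lo i < x \<and> \<alpha> = (cr i (x - 1), cr i x) then psi u (i, x - 1) else 0)"
  proof (cases "0 < x \<and> \<alpha> = (cr i (x - 1), cr i x)")
    case True
    show ?thesis
    proof (cases "lo i < x")
      case True2: True
      then show ?thesis using True hia i by (auto simp: psi_def)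
    next
      case False
      then have "x = 1" "L (i - 1)" using i True lo_bounds(3)[of i] by auto
      then show ?thesis using uL[of i 0] False by simp
    qed
  qed auto
  have 2: "eps i * (if x < 0 \<and> \<alpha> = (op (cr i (x + 1)), op (cr i x)) then u i (x + 1) else 0) =
    (if x < 0 \<and> x < hi i \<and> \<alpha> = (op (cr i (x + 1)), op (cr i x)) then psi u (i, x + 1) else 0)"
  proof (cases "x < 0 \<and> \<alpha> = (op (cr i (x + 1)), op (cr i x))")
    case True
    show ?thesis
    proof (cases "x < hi i")
      case True2: True
      then show ?thesis using True L_len[of i] by (auto simp: psi_def)
    next
      case False
      then have "x = - 1" "R i" using i True hi_bounds(3)[of i] by auto
      then show ?thesis using uR[of i 0] False by simp
    qed
  qed auto
  have 3: "(if L i \<and> R (i + 1) \<and> x = a i then eps (i + 2) * arrow_act \<alpha> u (i + 2) (- b (i + 1)) else 0) =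
    (if L i \<and> R (i + 1) \<and> x = hi i \<and> lo (i + 2) \<le> hi (i + 2) \<and>
       \<alpha> = (op (cr (i + 2) (lo (i + 2))), op (cr i x)) then psi u (i + 2, lo (i + 2)) else 0)"
  proof (cases "L i \<and> R (i + 1) \<and> x = hi i")
    case True
    then have x: "x = a i" using glue by blast
    have b: "0 < b (i + 1)" "l (i + 2) = b (i + 1) + r (i + 1)" using R_len[of "i + 1"] True by auto
    have lo: "lo (i + 2) = 1 - b (i + 1)" using True LR[of "i + 1"] by (auto simp: lo_def)
    have aa: "arrow_act \<alpha> u (i + 2) (- b (i + 1)) =
      (if \<alpha> = (op (cr (i + 2) (lo (i + 2))), op (cr i x)) then u (i + 2) (lo (i + 2)) else 0)"
      using b nonneg[of "i + 1"] nonneg[of "i + 2"] True x cr_glue[of i] unfolding lo arrow_act_def by simp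
    have p: "psi u (i + 2, lo (i + 2)) = eps (i + 2) * u (i + 2) (lo (i + 2))"
      using L_len[of "i + 2"] b unfolding lo psi_def by auto
    \<comment> \<open>If the interval at i + 2 is empty, then b (i + 1) = 1 and the position in
      question is the origin.\<close>
    have "u (i + 2) (lo (i + 2)) = 0" if "\<not> lo (i + 2) \<le> hi (i + 2)"
    proof -
      have "R (i + 2)" "lo (i + 2) = 0" using that hi_bounds[of "i + 2"] b lo by auto
      then show ?thesis using uR[of "i + 2" 0] by simp
    qed
    then show ?thesis using True x aa p by auto
  qed (use glue in auto)
  have 0: "arrow_act \<alpha> u i x = (if 0 < x \<and> \<alpha> = (cr i (x - 1), cr i x) then u i (x - 1) else 0) +
    (if x < 0 \<and> \<alpha> = (op (cr i (x + 1)), op (cr i x)) then u i (x + 1) else 0)"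
    using rng by (simp add: arrow_act_def)
  have "psi (arrow_act \<alpha> u) (i, x) = eps i * arrow_act \<alpha> u i x +
    (if L i \<and> R (i + 1) \<and> x = a i then eps (i + 2) * arrow_act \<alpha> u (i + 2) (- b (i + 1)) else 0)"
    by (simp add: psi_def)
  then show ?thesis unfolding 0 3 distrib_left 1 2 .
qed

end

section \<open>The supplemental union in coordinates\<close>

locale surface_curve =
  fixes S :: "('p, 'h) ribbon_surface" and c :: "'h graded_curve"
  assumes S: "marked_ribbon_surface S" and adm: "admissible S c"
begin

abbreviation "L \<equiv> pt_left S c"
abbreviation "R \<equiv> pt_right S c"
abbreviation "e i \<equiv> uncross S c i"
definition "len_left i = length (around S (e i) (cross c (i + 1)))"
definition "len_right i = length (around S (cross c (i + 1)) (e i))"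

lemma L_facts:
  assumes "L i"
  shows "e i \<in> half_edges S" "0 < len_left i" "len_left i \<le> fan_deg S (e i)" "nth_after S (e i) (len_left i) = cross c (i + 1)"
    "around S (e i) (cross c (i + 1)) = chain S (e i) (len_left i)"
    "fan_deg S (cross c (i + 1)) = fan_deg S (e i) - len_left i" "cross c (i + 1) \<in> half_edges S"
proof -
  have b: "ccw_before S (e i) (cross c (i + 1))" using assms by (simp add: pt_left_def)
  note f = ccw_before_around[OF S b, folded len_left_def]
  show "e i \<in> half_edges S" "0 < len_left i" "len_left i \<le> fan_deg S (e i)" "nth_after S (e i) (len_left i) = cross c (i + 1)"
    "around S (e i) (cross c (i + 1)) = chain S (e i) (len_left i)" by (rule f)+
  show "fan_deg S (cross c (i + 1)) = fan_deg S (e i) - len_left i"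
    using fan_deg_nth_after[OF S f(1,3)] f(4) by simp
  show "cross c (i + 1) \<in> half_edges S"
    using nth_after_succs(1)[OF S f(1,3)] f(4) by simp
qed

lemma R_facts:
  assumes "R i"
  shows "cross c (i + 1) \<in> half_edges S" "0 < len_right i" "len_right i \<le> fan_deg S (cross c (i + 1))" "nth_after S (cross c (i + 1)) (len_right i) = e i"
    "around S (cross c (i + 1)) (e i) = chain S (cross c (i + 1)) (len_right i)"
    "fan_deg S (e i) = fan_deg S (cross c (i + 1)) - len_right i" "e i \<in> half_edges S"
proof -
  have b: "ccw_before S (cross c (i + 1)) (e i)" using assms by (simp add: pt_right_def)
  note f = ccw_before_around[OF S b, folded len_right_def]
  show "cross c (i + 1) \<in> half_edges S" "0 < len_right i" "len_right i \<le> fan_deg S (cross c (i + 1))" "nth_after S (cross c (i + 1)) (len_right i) = e i"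
    "around S (cross c (i + 1)) (e i) = chain S (cross c (i + 1)) (len_right i)" by (rule f)+
  show "fan_deg S (e i) = fan_deg S (cross c (i + 1)) - len_right i"
    using fan_deg_nth_after[OF S f(1,3)] f(4) by simp
  show "e i \<in> half_edges S"
    using nth_after_succs(1)[OF S f(1,3)] f(4) by simp
qed

lemma index_half_edge:
  assumes "i \<in> indices_at c n"
  shows "cross c i \<in> half_edges S" "e i \<in> half_edges S" "opp S (e i) = cross c i"
    "arc S (e i) = arc S (cross c i)"
proof -
  show h: "cross c i \<in> half_edges S" using assms adm by (auto simp: admissible_def indices_at_def)
  show "e i \<in> half_edges S" "opp S (e i) = cross c i" "arc S (e i) = arc S (cross c i)"
    using h opp_half_edges[OF S] opp_opp[OF S] arc_opp[OF S] by auto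
qed

lemma enat_Suc_le: "enat (i + 1) \<le> len c \<Longrightarrow> enat i \<le> len c"
  by (meson dual_order.trans enat_ord_simps(1) le_add1)

text \<open>Coordinates below 0 turn around the point of \<open>cross c i\<close> and those above 0
  around the point of \<open>e i\<close>, whence the two lengths. \<open>L\<close> and
  \<open>R\<close> exclude each other because strictly fewer half-edges follow a later member of a
  fan.\<close>

sublocale labelled_zigzag L R "\<lambda>i. int (fan_deg S (cross c i))" "\<lambda>i. int (fan_deg S (e i))"
  "\<lambda>i. int (len_left i)" "\<lambda>i. int (len_right i)" "indices_at c" "opp S" "\<lambda>i. coord_cross S (e i)"
proof
  fix i n
  have lr: "L i \<Longrightarrow> idx c (i + 1) = idx c i + 1" "R i \<Longrightarrow> idx c (i + 1) = idx c i - 1"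
    using adm unfolding admissible_def by blast+
  show "L i \<Longrightarrow> 0 < int (len_left i) \<and> int (fan_deg S (e i)) = int (len_left i) + int (fan_deg S (cross c (i + 1)))"
    using L_facts[of i] by simp
  show "R i \<Longrightarrow> 0 < int (len_right i) \<and> int (fan_deg S (cross c (i + 1))) = int (len_right i) + int (fan_deg S (e i))"
    using R_facts[of i] by simp
  show "L i \<Longrightarrow> \<not> R i"
    using L_facts[of i] R_facts[of i] by linarith
  show "L i \<Longrightarrow> (i \<in> indices_at c (n + 1)) = (i + 1 \<in> indices_at c n)"
    using lr(1) enat_Suc_le[of i] by (auto simp: indices_at_def pt_left_def)
  show "R i \<Longrightarrow> (i + 1 \<in> indices_at c (n + 1)) = (i \<in> indices_at c n)"
    using lr(2) enat_Suc_le[of i] by (auto simp: indices_at_def pt_right_def)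
  show "\<not> L 0" "\<not> R 0" by (simp_all add: pt_left_def pt_right_def)
next
  fix i assume LR: "L i" "R (i + 1)"
  have "opp S (e (i + 2)) = cross c (i + 2)" using R_facts(1)[OF LR(2)] opp_opp[OF S] by simp
  then have "coord_cross S (e (i + 2)) (- int (len_right (i + 1))) = opp S (nth_after S (cross c (i + 1 + 1)) (len_right (i + 1)))"
    using R_facts(2)[OF LR(2)] by (simp add: coord_cross_def)
  also have "\<dots> = cross c (i + 1)" unfolding R_facts(4)[OF LR(2)] using L_facts(7)[OF LR(1)] opp_opp[OF S] by simp
  also have "\<dots> = coord_cross S (e i) (int (len_left i))" using L_facts(4)[OF LR(1)] by (simp add: coord_cross_def)
  finally show "coord_cross S (e i) (int (len_left i)) = coord_cross S (e (i + 2)) (- int (len_right (i + 1)))" by simp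
qed simp_all

lemma range_iff: "i \<in> indices_at c n \<Longrightarrow> x \<in> coord_range S (e i) \<longleftrightarrow> - int (fan_deg S (cross c i)) \<le> x \<and> x \<le> int (fan_deg S (e i))"
  using index_half_edge[of i n] by (auto simp: coord_range_def)

lemma cells_range: "(i, x) \<in> cells n \<Longrightarrow> x \<in> coord_range S (e i)"
  using lo_bounds(1)[of i] hi_bounds(1)[of i] range_iff[of i n x] by (auto simp: cells_def)

abbreviation crossing :: "nat \<times> int \<Rightarrow> 'h" where
  "crossing p \<equiv> coord_cross S (e (fst p)) (snd p)"

section \<open>Ends of the truncations and connecting segments\<close>

text \<open>If the interval at i + 2 is empty, nothing is left there to connect to.\<close>

definition linked :: "nat \<Rightarrow> bool" where
  "linked i \<longleftrightarrow> L i \<and> R (i + 1) \<and> lo (i + 2) \<le> hi (i + 2)"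

text \<open>A connecting segment is always s_II and hence has the letter PtRight, because the glued
  element closes the truncation at i.\<close>

definition letter :: "nat \<times> int \<Rightarrow> side option" where
  "letter = (\<lambda>(i, x). if x < hi i then Some (if x < 0 then PtRight else PtLeft)
     else if linked i then Some PtRight else None)"

definition next_cell :: "nat \<times> int \<Rightarrow> nat \<times> int" where
  "next_cell = (\<lambda>(i, x). if x < hi i then (i, x + 1) else (i + 2, lo (i + 2)))"

text \<open>Since r <= s is demanded, an empty interval cannot be encoded by r > s. The truncation
  from 0 to 0 crosses nothing, and its start 0 differs from the position \<open>posII + 1\<close> at
  which s_II would attach.\<close>

definition trunc_start :: "nat \<Rightarrow> nat" where
  "trunc_start i = (if lo i \<le> hi i then nat (int (posD S c i) + lo i) else 0)"

definition trunc_end :: "nat \<Rightarrow> nat" where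
  "trunc_end i = (if lo i \<le> hi i then nat (int (posD S c i) + hi i) else 0)"

lemma posD_eq: "i \<in> indices_at c n \<Longrightarrow> posD S c i = Suc (fan_deg S (cross c i))"
  using index_half_edge(3)[of i n] by (simp add: posD_def cproj_pos_def)

lemma trunc_bounds:
  assumes "i \<in> indices_at c n"
  shows "trunc_start i \<le> trunc_end i" "trunc_end i \<le> ncross (cprojD S c i) + 1"
proof -
  have "ncross (cprojD S c i) = Suc (fan_deg S (cross c i) + fan_deg S (e i))"
    using index_half_edge(3)[OF assms] by (simp add: ncross_def cprojD_def cproj_def)
  then show "trunc_start i \<le> trunc_end i" "trunc_end i \<le> ncross (cprojD S c i) + 1"
    using lo_bounds[of i] hi_bounds[of i] posD_eq[OF assms] by (auto simp: trunc_start_def trunc_end_def)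
qed

text \<open>At a meeting the top of the projective maps to both neighbours and the interval is
  empty, so the start is 0 while \<open>posD\<close> is positive.\<close>

lemma not_one_point: "\<not> one_point S c trunc_start trunc_end i"
proof
  assume o: "one_point S c trunc_start trunc_end i"
  then have "L (i - 1)" "R i" by (auto simp: one_point_def meeting_def)
  then have "lo i = 1" "hi i = - 1" by (auto simp: lo_def hi_def)
  then show False using o by (auto simp: one_point_def trunc_start_def posD_def cproj_pos_def)
qed

text \<open>The differential leads from i + 1 to both neighbours, so i + 1 has another degree and i
  + 2 is the next index of degree n.\<close>

lemma linked_index: "i \<in> indices_at c n \<Longrightarrow> L i \<Longrightarrow> R (i + 1) \<Longrightarrow> i + 2 \<in> indices_at c n \<and> i + 1 \<notin> indices_at c n"
  using L_I[of i "n - 1"] R_I[of "i + 1" "n - 1"] by (auto simp: indices_at_def)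

lemma linked_bounds:
  assumes "linked i"
  shows "lo i \<le> hi i" "hi i = int (len_left i)" "lo (i + 2) = 1 - int (len_right (i + 1))"
proof -
  have LR': "L i" "R (i + 1)" using assms by (auto simp: linked_def)
  then show h: "hi i = int (len_left i)" using LR[of i] by (auto simp: hi_def)
  show "lo i \<le> hi i" using lo_bounds(2)[of i] L_len[OF LR'(1)] h by simp
  show "lo (i + 2) = 1 - int (len_right (i + 1))" using LR[of "i + 1"] LR'(2) by (auto simp: lo_def)
qed

text \<open>At a meeting in i + 1 the first truncation ends on the arc of index i + 1 itself, as
  \<open>hi i\<close> is \<open>len_left i\<close>, and a non-empty second one starts one crossing
  after it. So only the first case of \<open>connection\<close> occurs.\<close>

lemma connection_eq:
  assumes i: "i \<in> indices_at c n" and i': "i' \<in> indices_at c n"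
  shows "connection S c trunc_start trunc_end i i' = (if i' = i + 2 \<and> linked i then Some PtRight else None)"
proof (cases "i' = i + 2 \<and> meeting S c (i + 1)")
  case True
  then have LR': "L i" "R (i + 1)" by (auto simp: meeting_def)
  have h: "hi i = int (len_left i)" using LR LR' by (auto simp: hi_def)
  have "lo i \<le> hi i" using lo_bounds(2)[of i] L_len[OF LR'(1)] h by simp
  moreover have "posI S c (i + 1) = posD S c i + len_left i" by (simp add: posI_def len_left_def)
  ultimately have s: "trunc_end i = posI S c (i + 1)" unfolding trunc_end_def h by simp
  have p: "0 < posI S c (i + 1)" by (simp add: posI_def posD_def cproj_pos_def)
  have lo: "lo i' = 1 - int (len_right (i + 1))" using LR[of "i + 1"] LR'(2) True by (auto simp: lo_def)
  \<comment> \<open>Keeps the subtraction of natural numbers in \<open>posII\<close> exact.\<close>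
  have b: "len_right (i + 1) < posD S c i'"
    using R_facts(3)[OF LR'(2)] posD_eq[OF i'] True by simp
  have II: "posII S c (i + 1) = posD S c i' - len_right (i + 1)" using True by (simp add: posII_def len_right_def)
  have r: "trunc_start i' = (if lo i' \<le> hi i' then posII S c (i + 1) + 1 else 0)"
    unfolding trunc_start_def II using b by (auto simp: lo)
  have "linked i \<longleftrightarrow> lo i' \<le> hi i'" using LR' True by (simp add: linked_def)
  then show ?thesis using True s r p b II by (auto simp: connection_def)
next
  case False
  then show ?thesis using not_one_point by (auto simp: connection_def linked_def meeting_def)
qed

text \<open>Position 0 of the list is the far end of the arm before the origin, which explains the
  shift.\<close>

lemma nth_cproj:
  assumes i: "i \<in> indices_at c n" and k: "k \<le> fan_deg S (cross c i) + fan_deg S (e i)"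
  shows "fst (cprojD S c i) ! k = coord_cross S (e i) (int k - int (fan_deg S (cross c i)))"
    "k < fan_deg S (cross c i) + fan_deg S (e i) \<Longrightarrow>
      snd (cprojD S c i) ! k = (if k < fan_deg S (cross c i) then PtRight else PtLeft)"
proof -
  let ?l = "fan_deg S (cross c i)"
  have o: "opp S (e i) = cross c i" by (rule index_half_edge(3)[OF i])
  show "fst (cprojD S c i) ! k = coord_cross S (e i) (int k - int ?l)"
  proof (cases "k < ?l")
    case True
    then have "nat (int ?l - int k) = Suc (?l - Suc k)" by simp
    then show ?thesis using True o
      by (simp add: cprojD_def cproj_def nth_append rev_nth coord_cross_def nth_after_Suc)
  next
    case False
    then have "nat (int k - int ?l) = k - ?l" by simp
    then show ?thesis using False o
      by (simp add: cprojD_def cproj_def nth_append coord_cross_def nth_after_def)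
  qed
  show "k < ?l + fan_deg S (e i) \<Longrightarrow> snd (cprojD S c i) ! k = (if k < ?l then PtRight else PtLeft)"
    using o by (auto simp: cprojD_def cproj_def nth_append)
qed

lemma part_eq:
  assumes i: "i \<in> indices_at c n"
  shows "part S c trunc_start trunc_end i = (if lo i \<le> hi i then
    (map (coord_cross S (e i)) [lo i..hi i], map (\<lambda>x. if x < 0 then PtRight else PtLeft) [lo i..hi i - 1])
    else ([], []))"
proof -
  let ?l = "fan_deg S (cross c i)" and ?r = "fan_deg S (e i)"
  have o: "opp S (e i) = cross c i" by (rule index_half_edge(3)[OF i])
  have len: "length (fst (cprojD S c i)) = Suc (?l + ?r)" "length (snd (cprojD S c i)) = ?l + ?r"
    using o by (simp_all add: cprojD_def cproj_def)
  have p: "part S c trunc_start trunc_end i = trunc (trunc_start i) (trunc_end i) (cprojD S c i)"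
    using not_one_point by (simp add: part_def)
  show ?thesis
  proof (cases "lo i \<le> hi i")
    case False
    then show ?thesis by (simp add: p trunc_start_def trunc_end_def trunc_def)
  next
    case True
    \<comment> \<open>List positions of \<open>lo i\<close> and \<open>hi i\<close>, counted from 0,
      whereas the arguments of \<open>trunc\<close> count from 1.\<close>
    define A where "A = nat (int ?l + lo i)"
    define B where "B = nat (int ?l + hi i)"
    have AB: "int A = int ?l + lo i" "int B = int ?l + hi i" "A \<le> B" "B \<le> ?l + ?r"
      using lo_bounds(1)[of i] hi_bounds(1)[of i] True by (auto simp: A_def B_def)
    have s: "trunc_start i = Suc A" "trunc_end i = Suc B"
      using True AB by (auto simp: trunc_start_def trunc_end_def posD_eq[OF i])
    have t: "trunc (trunc_start i) (trunc_end i) (cprojD S c i) =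
      (drop A (take (Suc B) (fst (cprojD S c i))), drop A (take B (snd (cprojD S c i))))"
      using AB by (simp add: trunc_def s)
    have "drop A (take (Suc B) (fst (cprojD S c i))) = map (coord_cross S (e i)) [lo i..hi i]"
    proof (rule nth_equalityI)
      fix k assume "k < length (drop A (take (Suc B) (fst (cprojD S c i))))"
      then have k: "k + A \<le> B" using AB len by simp
      then have "[lo i..hi i] ! k = lo i + int k" using AB by (intro nth_upto) linarith
      moreover have "k < length [lo i..hi i]" using k AB by simp
      ultimately show "drop A (take (Suc B) (fst (cprojD S c i))) ! k = map (coord_cross S (e i)) [lo i..hi i] ! k"
        using k AB len nth_cproj(1)[OF i, of "A + k"] by (simp add: algebra_simps)
    qed (use AB len in auto)
    moreover have "drop A (take B (snd (cprojD S c i))) = map (\<lambda>x. if x < 0 then PtRight else PtLeft) [lo i..hi i - 1]"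
    proof (rule nth_equalityI)
      fix k assume "k < length (drop A (take B (snd (cprojD S c i))))"
      then have k: "k + A < B" using AB len by simp
      then have "[lo i..hi i - 1] ! k = lo i + int k" using AB by (intro nth_upto) linarith
      moreover have "k < length [lo i..hi i - 1]" using k AB by simp
      moreover have "A + k < ?l \<longleftrightarrow> lo i + int k < 0" using AB by linarith
      ultimately show "drop A (take B (snd (cprojD S c i))) ! k =
          map (\<lambda>x. if x < 0 then PtRight else PtLeft) [lo i..hi i - 1] ! k"
        using k AB len nth_cproj(2)[OF i, of "A + k"] by simp
    qed (use AB len in auto)
    ultimately show ?thesis using True by (simp add: p t)
  qed
qed

section \<open>Labelling the curves of the supplemental union by cells\<close>

definition labels :: "nat \<Rightarrow> (nat \<times> int) list" where
  "labels i = map (Pair i) [lo i..hi i]"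

text \<open>The crossings of a curve of the supplemental union stand for the basis elements \<open>ls\<close>.\<close>

definition labelling :: "(nat \<times> int) list \<Rightarrow> 'h pcurve \<Rightarrow> bool" where
  "labelling ls p \<longleftrightarrow> ls \<noteq> [] \<and> map crossing ls = fst p \<and> map letter ls = map Some (snd p) @ [None] \<and>
     successively (\<lambda>b b'. b' = next_cell b) ls"

lemma successively_upto: "successively (\<lambda>x y. y = x + 1) [j..k :: int]"
proof (induction "nat (k - j + 1)" arbitrary: j)
  case (Suc m)
  then have "[j..k] = j # [j + 1..k]" by (simp add: upto.simps)
  then show ?case using Suc(1)[of "j + 1"] Suc(2) by (cases "j + 1 \<le> k") (auto simp: upto.simps[of "j + 1"] successively_Cons)
qed simp

lemma labels_props:
  assumes i: "i \<in> indices_at c n" and "lo i \<le> hi i"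
  shows "labels i \<noteq> []" "hd (labels i) = (i, lo i)" "last (labels i) = (i, hi i)"
    "map crossing (labels i) = fst (part S c trunc_start trunc_end i)"
    "map letter (labels i) = map Some (snd (part S c trunc_start trunc_end i)) @ [if linked i then Some PtRight else None]"
    "successively (\<lambda>b b'. b' = next_cell b) (labels i)"
proof -
  have u: "[lo i..hi i] = [lo i..hi i - 1] @ [hi i]" using assms(2) by (rule upto_rec2)
  show "labels i \<noteq> []" "hd (labels i) = (i, lo i)" "last (labels i) = (i, hi i)"
    using assms(2) u by (auto simp: labels_def upto.simps[of "lo i"])
  show "map crossing (labels i) = fst (part S c trunc_start trunc_end i)"
    using assms(2) by (simp add: labels_def part_eq[OF i])
  show "map letter (labels i) = map Some (snd (part S c trunc_start trunc_end i)) @ [if linked i then Some PtRight else None]"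
    using assms(2) by (auto simp: labels_def part_eq[OF i] letter_def u)
  have "successively (\<lambda>x y. x < hi i \<and> y = x + 1) [lo i..hi i]"
    using successively_upto[of "lo i" "hi i"]
    by (rule successively_mono) auto
  then have "successively (\<lambda>x y. (i, y) = next_cell (i, x)) [lo i..hi i]"
    by (rule successively_mono) (auto simp: next_cell_def)
  then show "successively (\<lambda>b b'. b' = next_cell b) (labels i)"
    by (simp add: labels_def successively_map)
qed

text \<open>Joining only prolongs a part, so a non-empty part keeps the head of the list
  non-trivial.\<close>

lemma suppl_union_hd:
  "\<exists>u us. suppl_union S c r s (i # is) = u # us \<and> length (fst (part S c r s i)) \<le> length (fst u)"
proof (cases "is")
  case (Cons j js)
  show ?thesis
  proof (cases "connection S c r s i j")
    case (Some d)
    obtain xs ts where "part S c r s i = (xs, ts)" by (cases "part S c r s i")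
    moreover obtain ys vs where "hd (suppl_union S c r s (j # js)) = (ys, vs)" by (metis surj_pair)
    ultimately show ?thesis using Some Cons by simp
  qed (use Cons in simp)
qed simp

text \<open>The third hypothesis makes the list an end piece of the indices of degree n: the
  induction passes to tails, and the partner i + 2 of a linked i must still be present. The equation
  for \<open>concat\<close> later shows that the strings use up all cells without
  repetition.\<close>

lemma suppl_union_labelling:
  assumes "sorted_wrt (<) is" "set is \<subseteq> indices_at c n"
    and "\<And>i j. i \<in> set is \<Longrightarrow> j \<in> indices_at c n \<Longrightarrow> i < j \<Longrightarrow> j \<in> set is"
  shows "\<exists>Ls. list_all2 labelling Ls (filter (\<lambda>p. ncross p \<noteq> 0) (suppl_union S c trunc_start trunc_end is)) \<and>
    concat Ls = concat (map labels is)"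
  using assms
proof (induction "is" rule: induct_list012)
  case 1
  then show ?case by simp
next
  case (2 i)
  have i: "i \<in> indices_at c n" using 2 by simp
  have nl: "\<not> linked i" using linked_index[OF i] 2(3)[of i "i + 2"] by (auto simp: linked_def)
  show ?case
  proof (cases "lo i \<le> hi i")
    case True
    note lp = labels_props[OF i True]
    have "ncross (part S c trunc_start trunc_end i) \<noteq> 0"
      using lp(1) unfolding ncross_def lp(4)[symmetric] by simp
    moreover have "labelling (labels i) (part S c trunc_start trunc_end i)"
      using lp nl by (simp add: labelling_def)
    ultimately show ?thesis by (intro exI[of _ "[labels i]"]) simp
  next
    case False
    then show ?thesis by (intro exI[of _ "[]"]) (simp add: part_eq[OF i] ncross_def labels_def)
  qed
next
  case (3 i i' js)
  let ?su = "suppl_union S c trunc_start trunc_end"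
  let ?part = "part S c trunc_start trunc_end"
  have i: "i \<in> indices_at c n" "i' \<in> indices_at c n" using 3 by simp_all
  have up: "\<And>k j. k \<in> set (i' # js) \<Longrightarrow> j \<in> indices_at c n \<Longrightarrow> k < j \<Longrightarrow> j \<in> set (i' # js)"
    using 3(3,5) by (metis insert_iff list.simps(15) order_less_trans order_less_irrefl sorted_wrt.simps(2))
  have "\<exists>Ls. list_all2 labelling Ls (filter (\<lambda>p. ncross p \<noteq> 0) (?su (i' # js))) \<and>
    concat Ls = concat (map labels (i' # js))"
  proof (rule 3(2))
    show "sorted_wrt (<) (i' # js)" "set (i' # js) \<subseteq> indices_at c n" using 3(3,4) by simp_all
  qed (rule up)
  then obtain Ls where Ls: "list_all2 labelling Ls (filter (\<lambda>p. ncross p \<noteq> 0) (?su (i' # js)))"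
    "concat Ls = concat (map labels (i' # js))" by blast
  show ?case
  proof (cases "linked i")
    case False
    then have su: "?su (i # i' # js) = ?part i # ?su (i' # js)"
      by (simp add: connection_eq[OF i])
    show ?thesis
    proof (cases "lo i \<le> hi i")
      case True
      note lp = labels_props[OF i(1) True]
      have "ncross (?part i) \<noteq> 0"
        using lp(1) unfolding ncross_def lp(4)[symmetric] by simp
      moreover have "labelling (labels i) (?part i)"
        using lp False by (simp add: labelling_def)
      ultimately show ?thesis using Ls su by (intro exI[of _ "labels i # Ls"]) simp
    next
      case False
      then have "labels i = []" "ncross (?part i) = 0" by (simp_all add: labels_def part_eq[OF i(1)] ncross_def)
      then show ?thesis using Ls unfolding su by (intro exI[of _ Ls]) simp
    qed
  next
    case True
    \<comment> \<open>The partner is the very next entry: i + 2 is in the list and i + 1 is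
      not.\<close>
    have "i + 2 \<in> indices_at c n" "i + 1 \<notin> indices_at c n" using linked_index[OF i(1)] True by (auto simp: linked_def)
    then have "i + 2 \<in> set (i' # js)" "i < i'" "i' \<noteq> i + 1" using 3(3) 3(5)[of i "i + 2"] i(2) by auto
    then have i': "i' = i + 2" using 3(3) by auto
    have lh: "lo i \<le> hi i" "lo i' \<le> hi i'" using True linked_bounds[of i] i' by (auto simp: linked_def)
    note lp = labels_props[OF i(1) lh(1)] and lp' = labels_props[OF i(2) lh(2)]
    obtain u us where u: "?su (i' # js) = u # us" "length (fst (?part i')) \<le> length (fst u)"
      using suppl_union_hd by blast
    \<comment> \<open>The head u survives the filter, so the first of the labellings belongs to
      it.\<close>
    have nu: "ncross u \<noteq> 0" using u(2) lp'(1) unfolding ncross_def lp'(4)[symmetric] by auto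
    then obtain l ls where l: "Ls = l # ls" "labelling l u" "list_all2 labelling ls (filter (\<lambda>p. ncross p \<noteq> 0) us)"
      using Ls(1) u(1) by (auto simp: list_all2_Cons2)
    have lne: "l \<noteq> []" using l(2) by (simp add: labelling_def)
    have "hd l = hd (concat Ls)" using lne l(1) by simp
    also have "\<dots> = (i', lo i')" using lp'(1,2) unfolding Ls(2) by simp
    finally have hl: "hd l = (i', lo i')" .
    have su: "?su (i # i' # js) = join (?part i) PtRight u # us"
      using True i' connection_eq[OF i] unfolding suppl_union.simps(3) u(1) by simp
    obtain xs ts where p: "?part i = (xs, ts)" by (cases "?part i")
    obtain ys vs where uv: "u = (ys, vs)" by (cases u)
    have "labelling (labels i @ l) (join (?part i) PtRight u)"
      using l(2) lp(1,3,4,5,6) True lne hl unfolding p uv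
      by (auto simp: labelling_def successively_append_iff next_cell_def i')
    moreover have "ncross (join (?part i) PtRight u) \<noteq> 0" using nu by (simp add: p uv ncross_def)
    moreover have "concat ((labels i @ l) # ls) = concat (map labels (i # i' # js))"
      using Ls(2) unfolding l(1) by simp
    ultimately show ?thesis unfolding su using l(3) by (intro exI[of _ "(labels i @ l) # ls"]) simp
  qed
qed

text \<open>A connecting segment starts at the glued crossing, which has the coordinate
  \<open>- int (len_right (i + 1))\<close> on the curve of i + 2; seen there it is an ordinary step
  along that curve.\<close>

lemma letter_corner:
  assumes "b \<in> cells n" "letter b = Some t"
  shows "case_prod (corner S) (seg_arrow S t (crossing b) (crossing (next_cell b)))"
proof -
  obtain i x where b: "b = (i, x)" by (cases b)
  have i: "i \<in> indices_at c n" using assms by (auto simp: cells_def b)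
  have ei: "e i \<in> half_edges S" by (rule index_half_edge(2)[OF i])
  have x: "lo i \<le> x" "x \<le> hi i" using assms(1) by (auto simp: cells_def b)
  show ?thesis
  proof (cases "x < hi i")
    case True
    have "(i, x) \<in> cells n" "(i, x + 1) \<in> cells n" using i x True by (auto simp: cells_def)
    then have "x \<in> coord_range S (e i)" "x + 1 \<in> coord_range S (e i)" using cells_range by blast+
    then have "x < 0 \<Longrightarrow> corner S (opp S (coord_cross S (e i) (x + 1))) (opp S (coord_cross S (e i) x))"
      "\<not> x < 0 \<Longrightarrow> corner S (coord_cross S (e i) x) (coord_cross S (e i) (x + 1))"
      using coord_corner(1)[OF S ei, of "x + 1"] coord_corner(2)[OF S ei, of x] by simp_all
    then show ?thesis
      using assms(2) True by (cases "x < 0") (simp_all add: b letter_def next_cell_def split: if_splits)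
  next
    case False
    then have lk: "linked i" "t = PtRight" using assms(2) by (auto simp: b letter_def split: if_splits)
    then have LR': "L i" "R (i + 1)" by (auto simp: linked_def)
    have x: "x = int (len_left i)" using linked_bounds(2)[OF lk(1)] False x by simp
    have i2: "i + 2 \<in> indices_at c n" using linked_index[OF i LR'] by blast
    have "0 < len_right (i + 1)" "len_right (i + 1) \<le> fan_deg S (cross c (i + 2))" using R_facts(2,3)[OF LR'(2)] by simp_all
    then have "- int (len_right (i + 1)) \<in> coord_range S (e (i + 2))" "- int (len_right (i + 1)) < 0"
      using range_iff[OF i2] by auto
    from coord_corner(2)[OF S index_half_edge(2)[OF i2] this] show ?thesis
      using False lk(2) linked_bounds(3)[OF lk(1)] cr_glue[OF LR'] x by (simp add: b next_cell_def add.commute)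
  qed
qed

end

section \<open>String modules in coordinates\<close>

text \<open>A first isomorphism theorem for bare records: M and T come without module axioms, so the
  kernel condition takes the form that the fibres of f are the cosets of N.\<close>

lemma rmod_quot_iso:
  assumes closed: "\<And>x. x \<in> carrier M \<Longrightarrow> f x \<in> carrier T"
    "\<And>x y. x \<in> carrier M \<Longrightarrow> y \<in> carrier M \<Longrightarrow> x \<oplus>\<^bsub>M\<^esub> y \<in> carrier M"
    "\<And>x a. x \<in> carrier M \<Longrightarrow> a \<in> carrier A \<Longrightarrow> ract M x a \<in> carrier M"
    and surj: "\<And>t. t \<in> carrier T \<Longrightarrow> \<exists>x\<in>carrier M. f x = t"
    and add: "\<And>x y. x \<in> carrier M \<Longrightarrow> y \<in> carrier M \<Longrightarrow> f (x \<oplus>\<^bsub>M\<^esub> y) = f x \<oplus>\<^bsub>T\<^esub> f y"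
    and act: "\<And>x a. x \<in> carrier M \<Longrightarrow> a \<in> carrier A \<Longrightarrow> f (ract M x a) = ract T (f x) a"
    and fib: "\<And>x. x \<in> carrier M \<Longrightarrow> N +>\<^bsub>M\<^esub> x = {y \<in> carrier M. f y = f x}"
  shows "rmod_iso A (rmod_quot M N) T"
proof -
  define g where "g X = f (SOME x. x \<in> X)" for X
  have car: "carrier (rmod_quot M N) = {{y \<in> carrier M. f y = f x} | x. x \<in> carrier M}"
    using fib by (auto simp: rmod_quot_def A_RCOSETS_def')
  have g: "g X = t" if "\<And>y. y \<in> X \<Longrightarrow> f y = t" "x \<in> X" for X t x
    using that someI[of "\<lambda>x. x \<in> X" x] by (simp add: g_def)
  have gf: "g {y \<in> carrier M. f y = f x} = f x" if "x \<in> carrier M" for x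
    by (rule g) (use that in auto)
  show ?thesis
    unfolding rmod_iso_def
  proof (intro exI conjI ballI)
    show "bij_betw g (carrier (rmod_quot M N)) (carrier T)"
      unfolding bij_betw_def
    proof
      show "inj_on g (carrier (rmod_quot M N))" by (rule inj_onI) (auto simp: car gf)
      show "g ` carrier (rmod_quot M N) = carrier T"
      proof (intro equalityI subsetI)
        fix t assume "t \<in> carrier T"
        then obtain x where "x \<in> carrier M" "f x = t" using surj by blast
        then show "t \<in> g ` carrier (rmod_quot M N)"
          using gf by (intro image_eqI[of _ _ "{y \<in> carrier M. f y = f x}"]) (auto simp: car)
      qed (auto simp: car gf closed(1))
    qed
  next
    fix X Y assume "X \<in> carrier (rmod_quot M N)" "Y \<in> carrier (rmod_quot M N)"
    then obtain x y where *: "x \<in> carrier M" "X = {z \<in> carrier M. f z = f x}"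
      "y \<in> carrier M" "Y = {z \<in> carrier M. f z = f y}" by (auto simp: car)
    have "g (X \<oplus>\<^bsub>rmod_quot M N\<^esub> Y) = f x \<oplus>\<^bsub>T\<^esub> f y"
    proof (rule g)
      show "x \<oplus>\<^bsub>M\<^esub> y \<in> X \<oplus>\<^bsub>rmod_quot M N\<^esub> Y"
        using * by (auto simp: rmod_quot_def set_add_def')
      show "f z = f x \<oplus>\<^bsub>T\<^esub> f y" if "z \<in> X \<oplus>\<^bsub>rmod_quot M N\<^esub> Y" for z
        using that add by (auto simp: rmod_quot_def set_add_def' *(2,4))
    qed
    then show "g (X \<oplus>\<^bsub>rmod_quot M N\<^esub> Y) = g X \<oplus>\<^bsub>T\<^esub> g Y" using * gf by simp
  next
    fix X a assume a: "a \<in> carrier A" and "X \<in> carrier (rmod_quot M N)"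
    then obtain x where *: "x \<in> carrier M" "X = {z \<in> carrier M. f z = f x}" by (auto simp: car)
    have "g (ract (rmod_quot M N) X a) = ract T (f x) a"
    proof (rule g)
      show "ract M x a \<in> ract (rmod_quot M N) X a"
        using * closed(3)[OF _ a] fib[OF closed(3)[OF *(1) a]] by (auto simp: rmod_quot_def intro!: exI[of _ x])
      show "f z = ract T (f x) a" if z: "z \<in> ract (rmod_quot M N) X a" for z
      proof -
        obtain y where y: "y \<in> carrier M" "f y = f x" "z \<in> N +>\<^bsub>M\<^esub> ract M y a"
          using z by (auto simp: rmod_quot_def *(2))
        then show ?thesis using fib[OF closed(3)[OF y(1) a]] act[OF y(1) a] by simp
      qed
    qed
    then show "g (ract (rmod_quot M N) X a) = ract T (g X) a" using * gf by simp
  qed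
qed

lemma in_set_concat_nth:
  "b \<in> set (concat Ls) \<longleftrightarrow> (\<exists>j<length Ls. \<exists>t<length (Ls ! j). Ls ! j ! t = b)"
  unfolding set_concat by simp (metis in_set_conv_nth)

lemma distinct_concat_nth:
  assumes "distinct (concat Ls)" "j < length Ls" "t < length (Ls ! j)" "j' < length Ls" "t' < length (Ls ! j')"
    "Ls ! j ! t = Ls ! j' ! t'"
  shows "j = j' \<and> t = t'"
  using assms
proof (induction Ls arbitrary: j j')
  case (Cons l Ls)
  have disj: "set l \<inter> set (concat Ls) = {}" using Cons.prems(1) by simp
  have "False" if "k < length Ls" "s < length (Ls ! k)" "s' < length l" "Ls ! k ! s = l ! s'" for k s s'
  proof -
    have "Ls ! k ! s \<in> set (concat Ls)" using that(1,2) unfolding in_set_concat_nth by blast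
    moreover have "l ! s' \<in> set l" using that(3) by simp
    ultimately show False using disj that(4) by auto
  qed
  note F = this
  show ?case
  proof (cases j)
    case 0
    show ?thesis
    proof (cases j')
      case j': 0
      then show ?thesis using Cons.prems 0 nth_eq_iff_index_eq[of l t t'] by simp
    next
      case (Suc k)
      then have False using Cons.prems 0 by (intro F[of k t' t]) simp_all
      then show ?thesis ..
    qed
  next
    case (Suc k)
    show ?thesis
    proof (cases j')
      case 0
      then have False using Cons.prems Suc by (intro F[of k t t']) simp_all
      then show ?thesis ..
    next
      case (Suc k')
      then show ?thesis using Cons.prems Cons.IH[of k k'] \<open>j = Suc k\<close> by simp
    qed
  qed
qed simp

context surface_curve
begin

sublocale Q: finite_bound_quiver "surface_quiver S"
  by (rule finite_bound_quiver_surface[OF S])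

section \<open>Actions of paths and comparison with string modules\<close>

definition path_act :: "('h set, 'h \<times> 'h) path \<Rightarrow> (nat \<Rightarrow> int \<Rightarrow> 'k::field) \<Rightarrow> nat \<Rightarrow> int \<Rightarrow> 'k" where
  "path_act = (\<lambda>(v, as) u. foldl (\<lambda>u \<alpha>. arrow_act \<alpha> u) (vertex_act (arc S) v u) as)"

lemma path_act_Nil: "path_act (v, []) u = vertex_act (arc S) v u"
  and path_act_snoc: "path_act (v, as @ [\<alpha>]) u = arrow_act \<alpha> (path_act (v, as) u)"
  by (simp_all add: path_act_def)

lemma path_act_cycles: "u \<in> cycles n \<Longrightarrow> path_act (v, as) u \<in> cycles n"
  by (induction as rule: rev_induct) (auto simp: path_act_Nil path_act_snoc vertex_act_cycles arrow_act_cycles)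

text \<open>A path acts into x only if it is an end piece of the path at x, and k is the length of
  the complementary prefix. The sum over all k, with at most one non-zero term, is the shape in
  which \<open>coef_mult\<close> delivers products.\<close>

lemma path_act_expand:
  assumes "i \<in> indices_at c n" "x \<in> coord_range S (e i)"
  shows "path_act (v, bs) u i x = (\<Sum>k\<le>nat \<bar>x\<bar>.
    if (v, bs) = (path_end (surface_quiver S) (arc S (e i)) (take k (coord_path S (e i) x)), drop k (coord_path S (e i) x))
    then u i (sgn x * int k) else (0 :: 'k::field))"
  using assms(2)
proof (induction bs arbitrary: x rule: rev_induct)
  case Nil
  have "(\<Sum>k\<le>nat \<bar>x\<bar>. if (v, []) = (path_end (surface_quiver S) (arc S (e i)) (take k (coord_path S (e i) x)), drop k (coord_path S (e i) x))
      then u i (sgn x * int k) else 0) =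
    (\<Sum>k\<le>nat \<bar>x\<bar>. if k = nat \<bar>x\<bar> then if arc S (coord_cross S (e i) x) = v then u i x else 0 else 0)"
    using reduced_coord_path(2)[OF S index_half_edge(2)[OF assms(1)] Nil]
    by (intro sum.cong) (auto simp: sgn_if)
  then show ?case by (simp add: path_act_Nil vertex_act_def)
next
  case (snoc \<alpha> bs)
  let ?cp = "coord_path S (e i)" and ?cr = "coord_cross S (e i)" and ?pe = "path_end (surface_quiver S) (arc S (e i))"
  note ei = index_half_edge(2)[OF assms(1)]
  have rng: "- int (fan_deg S (cross c i)) \<le> x \<and> x \<le> int (fan_deg S (e i))"
    using snoc.prems range_iff[OF assms(1)] by simp
  show ?case
  proof (cases "x = 0")
    case True
    then show ?thesis by (simp add: path_act_snoc arrow_act_def coord_path_def)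
  next
    case False
    \<comment> \<open>The neighbour of x towards the origin; the last arrow of the path at x
      follows.\<close>
    define y where "y = x - sgn x"
    define \<beta> where "\<beta> = (if 0 < x then (?cr (x - 1), ?cr x) else (opp S (?cr (x + 1)), opp S (?cr x)))"
    have cp: "?cp x = ?cp y @ [\<beta>]"
      using False coord_path_step_pos[OF S, of x "e i"] coord_path_step_neg[OF S ei snoc.prems]
      by (auto simp: y_def \<beta>_def sgn_if)
    have y: "y \<in> coord_range S (e i)" using rng False unfolding range_iff[OF assms(1)] y_def by (auto simp: sgn_if)
    have m: "nat \<bar>x\<bar> = Suc (nat \<bar>y\<bar>)" using False by (auto simp: y_def sgn_if)
    have "path_act (v, bs @ [\<alpha>]) u i x = (if \<alpha> = \<beta> then path_act (v, bs) u i y else 0)"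
      using False rng by (auto simp: path_act_snoc arrow_act_def y_def \<beta>_def sgn_if)
    also have "\<dots> = (if \<alpha> = \<beta> then (\<Sum>k\<le>nat \<bar>y\<bar>. if (v, bs) = (?pe (take k (?cp y)), drop k (?cp y)) then u i (sgn y * int k) else 0) else 0)"
      using snoc.IH[OF y] by simp
    also have "\<dots> = (\<Sum>k\<le>nat \<bar>y\<bar>. if (v, bs @ [\<alpha>]) = (?pe (take k (?cp x)), drop k (?cp x)) then u i (sgn x * int k) else 0)"
    proof -
      have "(if \<alpha> = \<beta> then if (v, bs) = (?pe (take k (?cp y)), drop k (?cp y)) then u i (sgn y * int k) else 0 else 0) =
        (if (v, bs @ [\<alpha>]) = (?pe (take k (?cp x)), drop k (?cp x)) then u i (sgn x * int k) else 0)"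
        if "k \<le> nat \<bar>y\<bar>" for k
      proof -
        have "sgn y * int k = sgn x * int k" using that False by (auto simp: y_def sgn_if)
        then show ?thesis unfolding cp using that by auto
      qed
      then show ?thesis by (auto intro!: sum.cong)
    qed
    also have "\<dots> = (\<Sum>k\<le>nat \<bar>x\<bar>. if (v, bs @ [\<alpha>]) = (?pe (take k (?cp x)), drop k (?cp x)) then u i (sgn x * int k) else 0)"
      unfolding m using m by (simp add: sum.atMost_Suc)
    finally show ?thesis .
  qed
qed

definition on_strings :: "(nat \<times> int) list list \<Rightarrow> (nat \<Rightarrow> int \<Rightarrow> 'k::field) \<Rightarrow> nat \<Rightarrow> nat \<Rightarrow> 'k" where
  "on_strings Ls u j t = (if t < length (Ls ! j) then psi u (Ls ! j ! t) else 0)"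

lemma labelling_nth:
  assumes "labelling l (xs, ts)"
  shows "length xs = length l" "t < length l \<Longrightarrow> xs ! t = crossing (l ! t)"
    "Suc t < length l \<Longrightarrow> letter (l ! t) = Some (ts ! t)" "Suc t < length l \<Longrightarrow> l ! Suc t = next_cell (l ! t)"
    "Suc t = length l \<Longrightarrow> letter (l ! t) = None" "length ts = length l - 1"
proof -
  have l: "map crossing l = xs" "map letter l = map Some ts @ [None]" "successively (\<lambda>b b'. b' = next_cell b) l"
    using assms by (auto simp: labelling_def)
  show "length xs = length l" using l(1) by auto
  show "t < length l \<Longrightarrow> xs ! t = crossing (l ! t)" using l(1) by auto
  have len: "length l = Suc (length ts)" using arg_cong[OF l(2), of length] by simp
  then show "length ts = length l - 1" by simp
  have nth: "letter (l ! t) = (map Some ts @ [None]) ! t" if "t < length l" for t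
    using that by (simp add: l(2)[symmetric])
  show "Suc t < length l \<Longrightarrow> letter (l ! t) = Some (ts ! t)" "Suc t = length l \<Longrightarrow> letter (l ! t) = None"
    using nth[of t] len by (auto simp: nth_append)
  show "Suc t < length l \<Longrightarrow> l ! Suc t = next_cell (l ! t)"
    using l(3) by (simp add: successively_conv_nth)
qed

text \<open>A letter PtLeft before a cell comes from x - 1 in the same interval; a letter PtRight
  after it leads to x + 1 or through a glue. These are the summands of
  \<open>psi_arrow_act\<close>.\<close>

lemma string_arrow_act_psi:
  assumes Ls: "list_all2 labelling Ls ps" "distinct (concat Ls)" "set (concat Ls) = cells n"
    and u: "u \<in> cycles n" and j: "j < length ps"
  shows "string_arrow_act S (ps ! j) (on_strings Ls u j) \<alpha> = on_strings Ls (arrow_act \<alpha> u) j"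
proof
  fix t
  obtain xs ts where p: "ps ! j = (xs, ts)" by (cases "ps ! j")
  define l where "l = Ls ! j"
  have lj: "j < length Ls" using Ls(1) j list_all2_lengthD by metis
  have lab: "labelling l (xs, ts)" using Ls(1) j p l_def list_all2_nthD2 by metis
  note ln = labelling_nth[OF lab]
  show "string_arrow_act S (ps ! j) (on_strings Ls u j) \<alpha> t = on_strings Ls (arrow_act \<alpha> u) j t"
  proof (cases "t < length l")
    case False
    then show ?thesis using ln(1) by (simp add: string_arrow_act_def p on_strings_def l_def)
  next
    case t: True
    obtain i x where b: "l ! t = (i, x)" by (cases "l ! t")
    have mem: "l ! s \<in> cells n" if "s < length l" for s
      using that lj unfolding Ls(3)[symmetric] l_def in_set_concat_nth by blast
    have bc: "(i, x) \<in> cells n" using mem[OF t] b by simp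
    then have ix: "i \<in> indices_at c n" "lo i \<le> x" "x \<le> hi i" by (auto simp: cells_def)
    have pred: "0 < t \<and> ts ! (t - 1) = PtLeft \<longleftrightarrow> 0 < x \<and> lo i < x"
      and pred_eq: "0 < t \<and> ts ! (t - 1) = PtLeft \<Longrightarrow> l ! (t - 1) = (i, x - 1)"
    proof -
      have 1: "0 < x \<and> lo i < x \<and> l ! (t - 1) = (i, x - 1)" if h: "0 < t \<and> ts ! (t - 1) = PtLeft"
      proof -
        obtain i' x' where b': "l ! (t - 1) = (i', x')" by (cases "l ! (t - 1)")
        have "letter (i', x') = Some PtLeft" using ln(3)[of "t - 1"] h t b' by simp
        then have x': "x' < hi i'" "0 \<le> x'" by (auto simp: letter_def split: if_splits)
        then have "(i, x) = (i', x' + 1)" using ln(4)[of "t - 1"] h t b b' by (simp add: next_cell_def)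
        moreover have "(i', x') \<in> cells n" using mem[of "t - 1"] t b' by simp
        ultimately show ?thesis using x' b' by (auto simp: cells_def)
      qed
      then show "0 < t \<and> ts ! (t - 1) = PtLeft \<Longrightarrow> l ! (t - 1) = (i, x - 1)" by blast
      \<comment> \<open>The cell (i, x - 1) occurs in some string, not in last place because it has
        a letter, and its successor there is (i, x). Distinctness identifies this successor with
        place t of string j.\<close>
      have "0 < t \<and> ts ! (t - 1) = PtLeft" if h: "0 < x \<and> lo i < x"
      proof -
        have "(i, x - 1) \<in> set (concat Ls)" using ix h unfolding Ls(3) by (auto simp: cells_def)
        then obtain j' t' where jt: "j' < length Ls" "t' < length (Ls ! j')" "Ls ! j' ! t' = (i, x - 1)"
          unfolding in_set_concat_nth by blast
        have lt: "letter (i, x - 1) = Some PtLeft" using h ix by (simp add: letter_def)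
        obtain xs' ts' where p': "ps ! j' = (xs', ts')" by (cases "ps ! j'")
        have lab': "labelling (Ls ! j') (xs', ts')" using Ls(1) jt(1) p' list_all2_nthD by metis
        note ln' = labelling_nth[OF lab']
        have s: "Suc t' < length (Ls ! j')"
          using ln'(5)[of t'] jt(2,3) lt by (cases "Suc t' = length (Ls ! j')") auto
        then have "Ls ! j' ! Suc t' = Ls ! j ! t"
          using ln'(4)[OF s] jt(3) b h ix by (simp add: next_cell_def l_def)
        then have "j' = j" "t = Suc t'"
          using distinct_concat_nth[OF Ls(2) jt(1) s lj] t by (auto simp: l_def)
        then show ?thesis using ln'(3)[OF s] lt jt(3) p p' by simp
      qed
      with 1 show "0 < t \<and> ts ! (t - 1) = PtLeft \<longleftrightarrow> 0 < x \<and> lo i < x" by blast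
    qed
    have succ: "Suc t < length l \<and> ts ! t = PtRight \<longleftrightarrow> letter (i, x) = Some PtRight"
      using ln(3)[of t] ln(5)[of t] b t by (cases "Suc t = length l") auto
    have "string_arrow_act S (ps ! j) (on_strings Ls u j) \<alpha> t =
      (if (0 < t \<and> ts ! (t - 1) = PtLeft) \<and> \<alpha> = (xs ! (t - 1), xs ! t) then psi u (l ! (t - 1)) else 0) +
      (if (Suc t < length l \<and> ts ! t = PtRight) \<and> \<alpha> = (opp S (xs ! Suc t), opp S (xs ! t)) then psi u (l ! Suc t) else 0)"
    proof -
      have o: "on_strings Ls u j s = psi u (l ! s)" if "s < length l" for s
        using that by (simp add: on_strings_def l_def)
      have "t - 1 < length l" using t by simp
      note os = o[OF this] o[of "Suc t"]
      show ?thesis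
        unfolding string_arrow_act_def p prod.case ln(1) using t os
        by (cases "0 < t"; cases "Suc t < length l") (simp_all only: if_True if_False simp_thms seg_arrow.simps)
    qed
    also have "\<dots> = (if 0 < x \<and> lo i < x \<and> \<alpha> = (coord_cross S (e i) (x - 1), coord_cross S (e i) x) then psi u (i, x - 1) else 0) +
      (if letter (i, x) = Some PtRight \<and> \<alpha> = (opp S (crossing (next_cell (i, x))), opp S (coord_cross S (e i) x)) then psi u (next_cell (i, x)) else 0)"
    proof (rule arg_cong2[of _ _ _ _ "(+)"])
      show "(if (0 < t \<and> ts ! (t - 1) = PtLeft) \<and> \<alpha> = (xs ! (t - 1), xs ! t) then psi u (l ! (t - 1)) else 0) =
        (if 0 < x \<and> lo i < x \<and> \<alpha> = (coord_cross S (e i) (x - 1), coord_cross S (e i) x) then psi u (i, x - 1) else 0)"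
      proof (cases "0 < t \<and> ts ! (t - 1) = PtLeft")
        case True
        then have "l ! (t - 1) = (i, x - 1)" "xs ! (t - 1) = crossing (l ! (t - 1))" "0 < x \<and> lo i < x"
          using pred pred_eq[OF True] ln(2)[of "t - 1"] t by simp_all
        then show ?thesis using ln(2)[OF t] b True by simp
      next
        case False
        then have n: "\<not> ((0 < t \<and> ts ! (t - 1) = PtLeft) \<and> P)" "\<not> (0 < x \<and> lo i < x \<and> P)" for P
          using pred by blast+
        show ?thesis by (rule trans[OF if_not_P[OF n(1)] if_not_P[OF n(2), symmetric]])
      qed
      show "(if (Suc t < length l \<and> ts ! t = PtRight) \<and> \<alpha> = (opp S (xs ! Suc t), opp S (xs ! t)) then psi u (l ! Suc t) else 0) =
        (if letter (i, x) = Some PtRight \<and> \<alpha> = (opp S (crossing (next_cell (i, x))), opp S (coord_cross S (e i) x)) then psi u (next_cell (i, x)) else 0)"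
      proof (cases "Suc t < length l \<and> ts ! t = PtRight")
        case True
        then have "l ! Suc t = next_cell (i, x)" "xs ! Suc t = crossing (l ! Suc t)" "letter (i, x) = Some PtRight"
          using succ ln(4)[of t] ln(2)[of "Suc t"] b by simp_all
        then show ?thesis using ln(2)[OF t] b True by simp
      next
        case False
        then have n: "\<not> ((Suc t < length l \<and> ts ! t = PtRight) \<and> P)" "\<not> (letter (i, x) = Some PtRight \<and> P)" for P
          using succ by blast+
        show ?thesis by (rule trans[OF if_not_P[OF n(1)] if_not_P[OF n(2), symmetric]])
      qed
    qed
    also have "\<dots> = psi (arrow_act \<alpha> u) (i, x)"
      unfolding psi_arrow_act[OF u bc] using ix by (auto simp: letter_def next_cell_def linked_def)
    finally show ?thesis using t b by (simp add: on_strings_def l_def)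
  qed
qed

lemma string_path_act_psi:
  assumes Ls: "list_all2 labelling Ls ps" "distinct (concat Ls)" "set (concat Ls) = cells n"
    and u: "u \<in> cycles n" and j: "j < length ps"
  shows "string_path_act S (ps ! j) (on_strings Ls u j) (v, as) = on_strings Ls (path_act (v, as) u) j"
proof (induction as rule: rev_induct)
  case Nil
  obtain xs ts where p: "ps ! j = (xs, ts)" by (cases "ps ! j")
  have lab: "labelling (Ls ! j) (xs, ts)" using Ls(1) j p list_all2_nthD2 by metis
  have "psi (vertex_act (arc S) v u) (Ls ! j ! t) = (if arc S (xs ! t) = v then psi u (Ls ! j ! t) else 0)"
    if "t < length (Ls ! j)" for t
    using labelling_nth(2)[OF lab that] psi_vertex_act[of "arc S" v u "fst (Ls ! j ! t)" "snd (Ls ! j ! t)"] by simp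
  then show ?case
    by (auto simp: string_path_act_def p on_strings_def path_act_Nil ncross_def labelling_nth(1)[OF lab])
next
  case (snoc \<alpha> as)
  then show ?case
    using string_arrow_act_psi[OF Ls path_act_cycles[OF u] j]
    by (simp add: string_path_act_def path_act_snoc)
qed

end

section \<open>Cohomology\<close>

context surface_curve
begin

abbreviation term_module :: "int \<Rightarrow> ((('h set, 'h \<times> 'h) path \<Rightarrow> 'k::field) set, nat \<Rightarrow> (('h set, 'h \<times> 'h) path \<Rightarrow> 'k) set) right_module" where
  "term_module n \<equiv> trm (curve_complex S (surface_algebra S) c) n"

abbreviation boundary_map :: "int \<Rightarrow> (nat \<Rightarrow> (('h set, 'h \<times> 'h) path \<Rightarrow> 'k::field) set) \<Rightarrow> nat \<Rightarrow> (('h set, 'h \<times> 'h) path \<Rightarrow> 'k) set" where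
  "boundary_map n \<equiv> diff (curve_complex S (surface_algebra S) c) n"

section \<open>Passing from the modules to coordinates\<close>

definition coords :: "int \<Rightarrow> (nat \<Rightarrow> (('h set, 'h \<times> 'h) path \<Rightarrow> 'k::field) set) \<Rightarrow> nat \<Rightarrow> int \<Rightarrow> 'k" where
  "coords n f i x = (if i \<in> indices_at c n \<and> x \<in> coord_range S (e i)
     then Q.coef (f i) (arc S (e i), coord_path S (e i) x) else 0)"

text \<open>Only finitely many indices have degree n, so the direct sum is the full product.\<close>

lemma term_module_carrier:
  "f \<in> carrier (term_module n :: (_, _ \<Rightarrow> (_ \<Rightarrow> 'k::field) set) right_module) \<longleftrightarrow> f \<in> extensional (indices_at c n) \<and>
    (\<forall>i\<in>indices_at c n. f i \<in> carrier (bound_algebra (surface_quiver S)) \<and>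
       (\<forall>w as. Q.coef (f i) (w, as) \<noteq> 0 \<longrightarrow> w = arc S (e i)))"
proof -
  have v: "arc S (cross c i) \<in> verts (surface_quiver S)" if "i \<in> indices_at c n" for i
    using index_half_edge(1)[OF that] by (simp add: surface_quiver_simps)
  have "finite {i \<in> indices_at c n. P i}" for P
    using finite_indices_at[OF adm, of n] by simp
  then have "f \<in> carrier (term_module n :: (_, _ \<Rightarrow> (_ \<Rightarrow> 'k) set) right_module) \<longleftrightarrow>
    f \<in> (\<Pi>\<^sub>E i\<in>indices_at c n. carrier (principal_module (bound_algebra (surface_quiver S)) (path_class (surface_quiver S) (arc S (cross c i), []))))"
    by (simp add: curve_complex_def Let_def rmod_dsum_def surface_algebra_def)
  also have "\<dots> \<longleftrightarrow> f \<in> extensional (indices_at c n) \<and> (\<forall>i\<in>indices_at c n. f i \<in> carrier (bound_algebra (surface_quiver S)) \<and>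
       (\<forall>w as. Q.coef (f i) (w, as) \<noteq> 0 \<longrightarrow> w = arc S (e i)))"
  proof -
    have pc: "carrier (principal_module (bound_algebra (surface_quiver S)) (path_class (surface_quiver S) (arc S (cross c i), []) :: (_ \<Rightarrow> 'k) set)) =
      {X \<in> carrier (bound_algebra (surface_quiver S)). \<forall>w as. Q.coef X (w, as) \<noteq> 0 \<longrightarrow> w = arc S (e i)}"
      if "i \<in> indices_at c n" for i
      unfolding index_half_edge(4)[OF that] by (rule Q.principal_carrier[OF v[OF that]])
    have "(\<forall>i\<in>indices_at c n. f i \<in> carrier (principal_module (bound_algebra (surface_quiver S)) (path_class (surface_quiver S) (arc S (cross c i), [])))) \<longleftrightarrow>
      (\<forall>i\<in>indices_at c n. f i \<in> carrier (bound_algebra (surface_quiver S)) \<and>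
         (\<forall>w as. Q.coef (f i) (w, as) \<noteq> 0 \<longrightarrow> w = arc S (e i)))"
      by (rule ball_cong[OF refl]) (simp only: pc mem_Collect_eq)
    then show ?thesis unfolding PiE_iff by (simp only: conj_commute)
  qed
  finally show ?thesis .
qed

lemma term_module_ops:
  "f \<oplus>\<^bsub>term_module n\<^esub> g = (\<lambda>i\<in>indices_at c n. f i \<oplus>\<^bsub>bound_algebra (surface_quiver S)\<^esub> g i)"
  "\<zero>\<^bsub>term_module n\<^esub> = (\<lambda>i\<in>indices_at c n. \<zero>\<^bsub>bound_algebra (surface_quiver S)\<^esub>)"
  "ract (term_module n) f X = (\<lambda>i\<in>indices_at c n. f i \<otimes>\<^bsub>bound_algebra (surface_quiver S)\<^esub> X)"
  by (simp_all add: curve_complex_def Let_def rmod_dsum_def surface_algebra_def principal_module_def cong: restrict_cong)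

lemma coords_terms: "coords n f \<in> terms n"
  using range_iff[of _ n] by (auto simp: terms_def coords_def)

lemma coords_eqI:
  fixes f g :: "nat \<Rightarrow> (('h set, 'h \<times> 'h) path \<Rightarrow> 'k::field) set"
  assumes f: "f \<in> carrier (term_module n)" and g: "g \<in> carrier (term_module n)" and eq: "coords n f = coords n g"
  shows "f = g"
proof (rule extensionalityI)
  show "f \<in> extensional (indices_at c n)" "g \<in> extensional (indices_at c n)"
    using f g by (auto simp: term_module_carrier)
  fix i assume i: "i \<in> indices_at c n"
  note ei = index_half_edge(2)[OF i]
  show "f i = g i"
  proof (rule Q.coef_eqI)
    show "f i \<in> carrier (bound_algebra (surface_quiver S))" "g i \<in> carrier (bound_algebra (surface_quiver S))"
      using f g i by (auto simp: term_module_carrier)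
    fix p assume p: "reduced (surface_quiver S) p"
    obtain w as where wa: "p = (w, as)" by (cases p)
    show "Q.coef (f i) p = Q.coef (g i) p"
    proof (cases "w = arc S (e i)")
      case True
      then obtain x where "x \<in> coord_range S (e i)" "as = coord_path S (e i) x"
        using reduced_coord_cases[OF S ei] p wa by metis
      then show ?thesis using fun_cong[OF fun_cong[OF eq, of i], of x] i by (simp add: coords_def wa True)
    next
      case False
      then have "Q.coef (f i) (w, as) = 0" "Q.coef (g i) (w, as) = 0"
        using f g i unfolding term_module_carrier by blast+
      then show ?thesis by (simp add: wa)
    qed
  qed
qed

lemma coords_surj:
  fixes u :: "nat \<Rightarrow> int \<Rightarrow> 'k::field"
  assumes "u \<in> terms n"
  shows "\<exists>f\<in>carrier (term_module n). coords n f = u"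
proof -
  have "\<exists>X. X \<in> carrier (bound_algebra (surface_quiver S)) \<and> (\<forall>w as. Q.coef X (w, as) \<noteq> 0 \<longrightarrow> w = arc S (e i)) \<and>
    (\<forall>x\<in>coord_range S (e i). Q.coef X (arc S (e i), coord_path S (e i) x) = u i x)" if i: "i \<in> indices_at c n" for i
  proof -
    note ei = index_half_edge(2)[OF i]
    let ?p = "\<lambda>x. (arc S (e i), coord_path S (e i) x)"
    have inj: "inj_on ?p (coord_range S (e i))"
      using coord_path_inj[OF S ei] by (auto intro!: inj_onI)
    \<comment> \<open>The inverse reads the coordinate off a path, which is unambiguous by
      \<open>coord_path_inj\<close>.\<close>
    define g where "g p = (if p \<in> ?p ` coord_range S (e i) then u i (the_inv_into (coord_range S (e i)) ?p p) else 0)" for p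
    have "finite (?p ` coord_range S (e i))" by (simp add: coord_range_def)
    moreover have "{p. g p \<noteq> 0} \<subseteq> ?p ` coord_range S (e i)" by (auto simp: g_def)
    ultimately have "finite {p. g p \<noteq> 0}" by (rule finite_subset[rotated])
    moreover have "reduced (surface_quiver S) p" if "g p \<noteq> 0" for p
      using that reduced_coord_path(1)[OF S ei] by (auto simp: g_def split: if_splits)
    ultimately obtain X where X: "X \<in> carrier (bound_algebra (surface_quiver S))" "\<forall>p. Q.coef X p = g p"
      using Q.coef_surj[of g] by blast
    have "g (?p x) = u i x" if "x \<in> coord_range S (e i)" for x
      using that the_inv_into_f_f[OF inj that] by (simp add: g_def)
    moreover have "w = arc S (e i)" if "g (w, as) \<noteq> 0" for w as
      using that by (auto simp: g_def split: if_splits)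
    ultimately show ?thesis using X by (intro exI[of _ X]) auto
  qed
  then obtain X where X: "\<And>i. i \<in> indices_at c n \<Longrightarrow> X i \<in> carrier (bound_algebra (surface_quiver S)) \<and>
    (\<forall>w as. Q.coef (X i) (w, as) \<noteq> 0 \<longrightarrow> w = arc S (e i)) \<and>
    (\<forall>x\<in>coord_range S (e i). Q.coef (X i) (arc S (e i), coord_path S (e i) x) = u i x)" by metis
  let ?f = "\<lambda>i\<in>indices_at c n. X i"
  have "?f \<in> carrier (term_module n)" using X unfolding term_module_carrier by auto
  moreover have "coords n ?f i x = u i x" for i x
    using X[of i] assms range_iff[of i n x] by (auto simp: coords_def terms_def)
  then have "coords n ?f = u" by blast
  ultimately show ?thesis by blast
qed

lemma coords_add:
  fixes f g :: "nat \<Rightarrow> (('h set, 'h \<times> 'h) path \<Rightarrow> 'k::field) set"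
  assumes "f \<in> carrier (term_module n)" "g \<in> carrier (term_module n)"
  shows "f \<oplus>\<^bsub>term_module n\<^esub> g \<in> carrier (term_module n)"
    "coords n (f \<oplus>\<^bsub>term_module n\<^esub> g) = (\<lambda>i x. coords n f i x + coords n g i x)"
proof -
  interpret A: ring "bound_algebra (surface_quiver S) :: (('h set, 'h \<times> 'h) path \<Rightarrow> 'k) set ring"
    by (rule Q.ring_A)
  have fg: "f i \<in> carrier (bound_algebra (surface_quiver S))" "g i \<in> carrier (bound_algebra (surface_quiver S))"
    "\<And>w as. Q.coef (f i) (w, as) \<noteq> 0 \<Longrightarrow> w = arc S (e i)" "\<And>w as. Q.coef (g i) (w, as) \<noteq> 0 \<Longrightarrow> w = arc S (e i)"
    if "i \<in> indices_at c n" for i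
    using that assms unfolding term_module_carrier by blast+
  show "f \<oplus>\<^bsub>term_module n\<^esub> g \<in> carrier (term_module n)"
    unfolding term_module_carrier term_module_ops
  proof (intro conjI ballI allI impI)
    fix i w as assume i: "i \<in> indices_at c n" and nz: "Q.coef ((\<lambda>i\<in>indices_at c n. f i \<oplus>\<^bsub>bound_algebra (surface_quiver S)\<^esub> g i) i) (w, as) \<noteq> 0"
    then have "Q.coef (f i) (w, as) + Q.coef (g i) (w, as) \<noteq> 0" using Q.coef_add[OF fg(1,2)[OF i]] by simp
    then have "Q.coef (f i) (w, as) \<noteq> 0 \<or> Q.coef (g i) (w, as) \<noteq> 0" by auto
    then show "w = arc S (e i)" using fg(3,4)[OF i] by blast
  qed (use fg in auto)
  show "coords n (f \<oplus>\<^bsub>term_module n\<^esub> g) = (\<lambda>i x. coords n f i x + coords n g i x)"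
    unfolding term_module_ops using Q.coef_add[OF fg(1,2)] by (auto simp: coords_def fun_eq_iff)
qed

lemma coords_zero:
  "(\<zero>\<^bsub>term_module n\<^esub> :: nat \<Rightarrow> (_ \<Rightarrow> 'k::field) set) \<in> carrier (term_module n)"
  "coords n (\<zero>\<^bsub>term_module n\<^esub>) = (\<lambda>i x. 0 :: 'k)"
proof -
  interpret A: ring "bound_algebra (surface_quiver S) :: (('h set, 'h \<times> 'h) path \<Rightarrow> 'k) set ring"
    by (rule Q.ring_A)
  show "(\<zero>\<^bsub>term_module n\<^esub> :: nat \<Rightarrow> (_ \<Rightarrow> 'k::field) set) \<in> carrier (term_module n)"
    "coords n (\<zero>\<^bsub>term_module n\<^esub>) = (\<lambda>i x. 0 :: 'k)"
    unfolding term_module_carrier term_module_ops by (auto simp: Q.coef_zero coords_def fun_eq_iff)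
qed

lemma coef_segment_mult:
  fixes X :: "(('h set, 'h \<times> 'h) path \<Rightarrow> 'k::field) set"
  assumes h: "h \<in> half_edges S" and a: "0 < a" "a \<le> fan_deg S h"
    and X: "X \<in> carrier (bound_algebra (surface_quiver S))" "\<And>w as. Q.coef X (w, as) \<noteq> 0 \<Longrightarrow> w = arc S (nth_after S h a)"
  shows "path_class (surface_quiver S) (arc S h, chain S h a) \<otimes>\<^bsub>bound_algebra (surface_quiver S)\<^esub> X \<in> carrier (bound_algebra (surface_quiver S))"
    "Q.coef (path_class (surface_quiver S) (arc S h, chain S h a) \<otimes>\<^bsub>bound_algebra (surface_quiver S)\<^esub> X) (w, as) \<noteq> 0 \<Longrightarrow> w = arc S h"
proof -
  interpret A: ring "bound_algebra (surface_quiver S) :: (('h set, 'h \<times> 'h) path \<Rightarrow> 'k) set ring"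
    by (rule Q.ring_A)
  have p: "is_path (surface_quiver S) (arc S h) (chain S h a)"
    using reduced_chain[OF S h a(2)] by (simp add: reduced_def)
  show mem: "path_class (surface_quiver S) (arc S h, chain S h a) \<otimes>\<^bsub>bound_algebra (surface_quiver S)\<^esub> X \<in> carrier (bound_algebra (surface_quiver S))"
    by (rule A.m_closed[OF Q.coef_path_class(1)[OF p] X(1)])
  have X': "\<And>u cs. Q.coef X (u, cs) \<noteq> 0 \<Longrightarrow> u = path_end (surface_quiver S) (arc S h) (chain S h a)"
    unfolding path_end_chain[OF S h] by (rule X(2))
  assume nz: "Q.coef (path_class (surface_quiver S) (arc S h, chain S h a) \<otimes>\<^bsub>bound_algebra (surface_quiver S)\<^esub> X) (w, as) \<noteq> 0"
  have "Q.coef (path_class (surface_quiver S) (arc S h, chain S h a) \<otimes>\<^bsub>bound_algebra (surface_quiver S)\<^esub> X) (w, as) =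
    (if w = arc S h \<and> take (length (chain S h a)) as = chain S h a
     then Q.coef X (path_end (surface_quiver S) (arc S h) (chain S h a), drop (length (chain S h a)) as) else 0)"
    by (rule Q.coef_path_mult[OF p X(1) Q.coef_nonzero[OF mem nz] X'])
  then show "w = arc S h" using nz by presburger
qed

text \<open>\<open>coef_chain_mult\<close> computes on the arm after a half-edge. For
  \<open>L\<close> its result lives on the curve of \<open>cross c (i + 1)\<close>, the reverse of
  the neighbour's curve; for \<open>R\<close> the curve of i itself has to be reversed. These
  reversals turn the shifts into reflections.\<close>

lemma coords_boundary:
  fixes f :: "nat \<Rightarrow> (('h set, 'h \<times> 'h) path \<Rightarrow> 'k::field) set"
  assumes f: "f \<in> carrier (term_module n)"
  shows "boundary_map n f \<in> carrier (term_module (n + 1))" "coords (n + 1) (boundary_map n f) = boundary n (coords n f)"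
proof -
  let ?A = "bound_algebra (surface_quiver S) :: (('h set, 'h \<times> 'h) path \<Rightarrow> 'k) set ring"
  interpret A: ring ?A by (rule Q.ring_A)
  define X where "X i = (if L i then path_class (surface_quiver S) (arc S (cross c i), around S (e i) (cross c (i + 1))) \<otimes>\<^bsub>?A\<^esub> f (i + 1) else \<zero>\<^bsub>?A\<^esub>)" for i
  define Y where "Y i = (if R (i - 1) then path_class (surface_quiver S) (arc S (cross c i), around S (cross c i) (e (i - 1))) \<otimes>\<^bsub>?A\<^esub> f (i - 1) else \<zero>\<^bsub>?A\<^esub>)" for i
  have bm: "boundary_map n f = (\<lambda>i\<in>indices_at c (n + 1). X i \<oplus>\<^bsub>?A\<^esub> Y i)"
    by (simp add: curve_complex_def Let_def surface_algebra_def X_def Y_def)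
  have ff: "f j \<in> carrier ?A" "\<And>w as. Q.coef (f j) (w, as) \<noteq> 0 \<Longrightarrow> w = arc S (cross c j)" "\<And>w as. Q.coef (f j) (w, as) \<noteq> 0 \<Longrightarrow> w = arc S (e j)"
    if "j \<in> indices_at c n" for j
    using that f index_half_edge(4)[OF that] unfolding term_module_carrier by metis+
  have X: "X i \<in> carrier ?A \<and> (\<forall>w as. Q.coef (X i) (w, as) \<noteq> 0 \<longrightarrow> w = arc S (e i)) \<and>
    (\<forall>x\<in>coord_range S (e i). Q.coef (X i) (arc S (e i), coord_path S (e i) x) =
       (if L i \<and> int (len_left i) \<le> x then coords n f (i + 1) (int (len_left i) - x) else 0))"
    if i: "i \<in> indices_at c (n + 1)" for i
  proof (cases "L i")
    case False
    then show ?thesis using A.zero_closed by (simp add: X_def Q.coef_zero)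
  next
    case True
    note Lf = L_facts[OF True]
    have i1: "i + 1 \<in> indices_at c n" using L_I[OF True] i by simp
    have Xi: "X i = path_class (surface_quiver S) (arc S (e i), chain S (e i) (len_left i)) \<otimes>\<^bsub>?A\<^esub> f (i + 1)"
      using True by (simp only: X_def if_True Lf(5) index_half_edge(4)[OF i])
    note ff' = ff(1,2)[OF i1, folded Lf(4)]
    have "Q.coef (f (i + 1)) (arc S (cross c (i + 1)), coord_path S (cross c (i + 1)) (x - int (len_left i))) = coords n f (i + 1) (int (len_left i) - x)"
      if x: "x \<in> coord_range S (e i)" "int (len_left i) \<le> x" for x
    proof -
      have r: "int (len_left i) - x \<in> coord_range S (e (i + 1))"
        using x L_len[OF True] unfolding range_iff[OF i1] by (auto simp: coord_range_def)
      have "coord_path S (cross c (i + 1)) (x - int (len_left i)) = coord_path S (e (i + 1)) (int (len_left i) - x)"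
        using coord_opp(1)[OF S index_half_edge(2)[OF i1] r] index_half_edge(3)[OF i1] by simp
      then show ?thesis using r i1 index_half_edge(4)[OF i1] by (simp add: coords_def)
    qed
    then show ?thesis
      unfolding Xi using coef_segment_mult[OF Lf(1-3) ff'] coef_chain_mult[OF S Lf(1-3) _ ff'] True Lf(4) by simp
  qed
  have Y: "Y i \<in> carrier ?A \<and> (\<forall>w as. Q.coef (Y i) (w, as) \<noteq> 0 \<longrightarrow> w = arc S (e i)) \<and>
    (\<forall>x\<in>coord_range S (e i). Q.coef (Y i) (arc S (e i), coord_path S (e i) x) =
       (if R (i - 1) \<and> x \<le> - int (len_right (i - 1)) then coords n f (i - 1) (- int (len_right (i - 1)) - x) else 0))"
    if i: "i \<in> indices_at c (n + 1)" for i
  proof (cases "R (i - 1)")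
    case False
    then show ?thesis using A.zero_closed by (simp add: Y_def Q.coef_zero)
  next
    case True
    then have i': "i - 1 + 1 = i" using R_pred[of i] by simp
    note Rf = R_facts[OF True, unfolded i']
    note ei = index_half_edge[OF i]
    have i1: "i - 1 \<in> indices_at c n" using R_I[OF True, of n] i i' by simp
    have Yi: "Y i = path_class (surface_quiver S) (arc S (cross c i), chain S (cross c i) (len_right (i - 1))) \<otimes>\<^bsub>?A\<^esub> f (i - 1)"
      using True by (simp only: Y_def if_True Rf(5))
    note ff' = ff(1,3)[OF i1, folded Rf(4)]
    have 1: "Q.coef (Y i) (arc S (e i), coord_path S (e i) x) =
       (if x \<le> - int (len_right (i - 1)) then coords n f (i - 1) (- int (len_right (i - 1)) - x) else 0)"
      if x: "x \<in> coord_range S (e i)" for x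
    proof -
      have o: "coord_path S (e i) x = coord_path S (cross c i) (- x)" "- x \<in> coord_range S (cross c i)"
        using coord_opp[OF S ei(2) x] unfolding ei(3) by simp_all
      have r: "- int (len_right (i - 1)) - x \<in> coord_range S (e (i - 1))" if "x \<le> - int (len_right (i - 1))"
        using that x R_pred[OF True] unfolding range_iff[OF i1] range_iff[OF i] by auto
      have "Q.coef (Y i) (arc S (e i), coord_path S (e i) x) =
        (if int (len_right (i - 1)) \<le> - x then Q.coef (f (i - 1)) (arc S (e (i - 1)), coord_path S (e (i - 1)) (- x - int (len_right (i - 1)))) else 0)"
        unfolding Yi o(1) ei(4) using coef_chain_mult[OF S Rf(1-3) o(2) ff'] Rf(4) by simp
      also have "\<dots> = (if x \<le> - int (len_right (i - 1)) then coords n f (i - 1) (- int (len_right (i - 1)) - x) else 0)"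
      proof -
        have c: "int (len_right (i - 1)) \<le> - x \<longleftrightarrow> x \<le> - int (len_right (i - 1))" "- x - int (len_right (i - 1)) = - int (len_right (i - 1)) - x"
          by linarith+
        show ?thesis unfolding c using r i1 by (simp add: coords_def)
      qed
      finally show ?thesis .
    qed
    then show ?thesis
      using coef_segment_mult[OF Rf(1-3) ff'] True ei(4) unfolding Yi by simp
  qed
  have add: "Q.coef (X i \<oplus>\<^bsub>?A\<^esub> Y i) p = Q.coef (X i) p + Q.coef (Y i) p" if "i \<in> indices_at c (n + 1)" for i p
    using X[OF that] Y[OF that] by (intro Q.coef_add) auto
  show "boundary_map n f \<in> carrier (term_module (n + 1))"
    unfolding term_module_carrier bm
  proof (intro conjI ballI allI impI)
    fix i w as assume i: "i \<in> indices_at c (n + 1)" and nz: "Q.coef ((\<lambda>i\<in>indices_at c (n + 1). X i \<oplus>\<^bsub>?A\<^esub> Y i) i) (w, as) \<noteq> 0"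
    then have "Q.coef (X i) (w, as) + Q.coef (Y i) (w, as) \<noteq> 0" using add by simp
    then have "Q.coef (X i) (w, as) \<noteq> 0 \<or> Q.coef (Y i) (w, as) \<noteq> 0" by auto
    then show "w = arc S (e i)" using X[OF i] Y[OF i] by blast
  qed (use X Y in auto)
  show "coords (n + 1) (boundary_map n f) = boundary n (coords n f)"
  proof (intro ext)
    fix i x
    show "coords (n + 1) (boundary_map n f) i x = boundary n (coords n f) i x"
    proof (cases "i \<in> indices_at c (n + 1) \<and> x \<in> coord_range S (e i)")
      case True
      then show ?thesis using range_iff[of i "n + 1" x] X[of i] Y[of i] add[of i]
        unfolding bm by (simp add: coords_def boundary_def)
    next
      case False
      then show ?thesis using range_iff[of i "n + 1" x] by (auto simp: coords_def boundary_def)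
    qed
  qed
qed

text \<open>Non-reduced paths in the representative a drop out on both sides, because end pieces of
  a coordinate path are reduced.\<close>

lemma coords_ract:
  fixes f :: "nat \<Rightarrow> (('h set, 'h \<times> 'h) path \<Rightarrow> 'k::field) set"
  assumes f: "f \<in> carrier (term_module n)" and X: "X \<in> carrier (bound_algebra (surface_quiver S))"
  defines "a \<equiv> SOME x. x \<in> X"
  shows "ract (term_module n) f X \<in> carrier (term_module n)"
    "coords n (ract (term_module n) f X) = (\<lambda>i x. \<Sum>q | a q \<noteq> 0. a q * path_act q (coords n f) i x)"
proof -
  let ?Q = "surface_quiver S"
  let ?A = "bound_algebra ?Q :: (('h set, 'h \<times> 'h) path \<Rightarrow> 'k) set ring"
  interpret A: ring ?A by (rule Q.ring_A)
  have aX: "a \<in> X" unfolding a_def by (rule Q.rep_exists[OF X])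
  have fin: "finite {q. a q \<noteq> 0}" using Q.rep(1)[OF X aX] by (simp add: Q.carrier_support)
  have ff: "f j \<in> carrier ?A" "\<And>w as. Q.coef (f j) (w, as) \<noteq> 0 \<Longrightarrow> w = arc S (e j)"
    if "j \<in> indices_at c n" for j
    using that f unfolding term_module_carrier by metis+
  show "ract (term_module n) f X \<in> carrier (term_module n)"
    unfolding term_module_carrier term_module_ops
  proof (intro conjI ballI allI impI)
    fix i w as assume i: "i \<in> indices_at c n" and nz: "Q.coef ((\<lambda>i\<in>indices_at c n. f i \<otimes>\<^bsub>?A\<^esub> X) i) (w, as) \<noteq> 0"
    then have nz': "Q.coef (f i \<otimes>\<^bsub>?A\<^esub> X) (w, as) \<noteq> 0" by simp
    have mem: "f i \<otimes>\<^bsub>?A\<^esub> X \<in> carrier ?A" using ff(1)[OF i] X by simp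
    have "(\<Sum>k\<le>length as. Q.coef (f i) (w, take k as) * a (path_end ?Q w (take k as), drop k as)) \<noteq> 0"
      using nz' Q.coef_mult[OF ff(1)[OF i] X aX Q.coef_nonzero[OF mem nz']] by simp
    then obtain k where "Q.coef (f i) (w, take k as) \<noteq> 0"
      by (metis (no_types, lifting) mult_zero_left sum.not_neutral_contains_not_neutral)
    then show "w = arc S (e i)" by (rule ff(2)[OF i])
  qed (use ff X in auto)
  show "coords n (ract (term_module n) f X) = (\<lambda>i x. \<Sum>q | a q \<noteq> 0. a q * path_act q (coords n f) i x)"
  proof (intro ext)
    fix i x
    show "coords n (ract (term_module n) f X) i x = (\<Sum>q | a q \<noteq> 0. a q * path_act q (coords n f) i x)"
    proof (cases "i \<in> indices_at c n \<and> x \<in> coord_range S (e i)")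
      case False
      \<comment> \<open>The action preserves the support condition of \<open>terms\<close>.\<close>
      have "path_act q (coords n f) i x = 0" for q
      proof -
        have "path_act q (coords n f) i x = 0 \<or> path_act q (coords n f) \<notin> terms n"
          using False range_iff[of i n x] unfolding terms_def by blast
        moreover have "path_act (v, as) (coords n f) \<in> terms n" for v as
          by (induction as rule: rev_induct)
            (use coords_terms[of n f] in \<open>auto simp: path_act_Nil path_act_snoc terms_def vertex_act_def arrow_act_def split: if_splits\<close>)
        ultimately show ?thesis by (cases q) auto
      qed
      then show ?thesis using False by (auto simp: coords_def)
    next
      case True
      then have i: "i \<in> indices_at c n" and x: "x \<in> coord_range S (e i)" by auto
      note ei = index_half_edge(2)[OF i]
      let ?cp = "coord_path S (e i) x"
      let ?q = "\<lambda>k. (path_end ?Q (arc S (e i)) (take k ?cp), drop k ?cp)"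
      have t: "Q.coef (f i) (arc S (e i), take k ?cp) = coords n f i (sgn x * int k)" if "k \<le> nat \<bar>x\<bar>" for k
      proof -
        have "sgn x * int k \<in> coord_range S (e i)"
          using that x by (auto simp: coord_range_def sgn_if)
        then show ?thesis using i take_coord_path[OF S that, of "e i"] by (simp add: coords_def)
      qed
      have "coords n (ract (term_module n) f X) i x = Q.coef (f i \<otimes>\<^bsub>?A\<^esub> X) (arc S (e i), ?cp)"
        using i x by (simp add: coords_def term_module_ops)
      also have "\<dots> = (\<Sum>k\<le>nat \<bar>x\<bar>. Q.coef (f i) (arc S (e i), take k ?cp) * a (?q k))"
        using Q.coef_mult[OF ff(1)[OF i] X aX reduced_coord_path(1)[OF S ei x]] by simp
      \<comment> \<open>Each value of a is spread over its finite support so that the two sums can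
        be exchanged.\<close>
      also have "\<dots> = (\<Sum>k\<le>nat \<bar>x\<bar>. \<Sum>q | a q \<noteq> 0. if q = ?q k then a q * coords n f i (sgn x * int k) else 0)"
        using fin t by (intro sum.cong) (auto simp: sum.delta)
      also have "\<dots> = (\<Sum>q | a q \<noteq> 0. \<Sum>k\<le>nat \<bar>x\<bar>. if q = ?q k then a q * coords n f i (sgn x * int k) else 0)"
        by (rule sum.swap)
      also have "\<dots> = (\<Sum>q | a q \<noteq> 0. a q * path_act q (coords n f) i x)"
      proof (rule sum.cong)
        fix q :: "('h set, 'h \<times> 'h) path"
        obtain v as where q: "q = (v, as)" by (cases q)
        show "(\<Sum>k\<le>nat \<bar>x\<bar>. if q = ?q k then a q * coords n f i (sgn x * int k) else 0) = a q * path_act q (coords n f) i x"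
          unfolding q path_act_expand[OF i x] sum_distrib_left by (intro sum.cong) auto
      qed simp
      finally show ?thesis .
    qed
  qed
qed

section \<open>The isomorphism with a direct sum of string modules\<close>

lemma labelling_permissible: "labelling l p \<Longrightarrow> set l \<subseteq> cells n \<Longrightarrow> permissible S p"
proof -
  assume lab: "labelling l p" and sub: "set l \<subseteq> cells n"
  obtain xs ts where p: "p = (xs, ts)" by (cases p)
  note ln = labelling_nth[OF lab[unfolded p]]
  have "crossing b \<in> half_edges S" if "b \<in> set l" for b
  proof -
    obtain i x where b: "b = (i, x)" by (cases b)
    then have "(i, x) \<in> cells n" using that sub by auto
    then have "i \<in> indices_at c n" "x \<in> coord_range S (e i)" using cells_range by (auto simp: cells_def)
    then show ?thesis using reduced_coord_path(3)[OF S index_half_edge(2)] by (simp add: b)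
  qed
  moreover have "xs = map crossing l" using lab by (simp add: labelling_def p)
  ultimately have "set xs \<subseteq> half_edges S" by auto
  moreover have "case_prod (corner S) (seg_arrow S (ts ! j) (xs ! j) (xs ! Suc j))" if "Suc j < length xs" for j
  proof -
    have j: "Suc j < length l" using that ln(1) by simp
    then have "l ! j \<in> cells n" by (intro subsetD[OF sub nth_mem]) simp
    from letter_corner[OF this ln(3)[OF j]] show ?thesis
      using ln(2)[of j] ln(2)[OF j] ln(4)[OF j] j by simp
  qed
  ultimately show ?thesis using ln(1,6) by (simp add: permissible_def p)
qed

text \<open>The isomorphism reads \<open>psi\<close> of the coordinates along the strings. Its
  fibres are the cosets of the boundaries by \<open>psi_eq_iff\<close>, it is onto by
  \<open>psi_surj\<close>, and it respects the action by \<open>coords_ract\<close> and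
  \<open>string_path_act_psi\<close>.\<close>

lemma cohomology_curves:
  "is_curves_of S (surface_algebra S :: ('h, 'k::field) surface_alg) (cohomology (curve_complex S (surface_algebra S) c) n)
    (nontrivial_curves (suppl_union S c trunc_start trunc_end (sorted_list_of_set (indices_at c n))))"
proof -
  let ?A = "bound_algebra (surface_quiver S) :: (('h set, 'h \<times> 'h) path \<Rightarrow> 'k) set ring"
  define ps where "ps = filter (\<lambda>p. ncross p \<noteq> 0) (suppl_union S c trunc_start trunc_end (sorted_list_of_set (indices_at c n)))"
  have fin: "finite (indices_at c n)" by (rule finite_indices_at[OF adm])
  obtain Ls where Ls: "list_all2 labelling Ls ps" "concat Ls = concat (map labels (sorted_list_of_set (indices_at c n)))"
    using suppl_union_labelling[of "sorted_list_of_set (indices_at c n)" n] fin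
    unfolding ps_def by auto
  \<comment> \<open>Together with \<open>dist\<close>, this says that the strings partition the
    cells of degree n.\<close>
  have set: "set (concat Ls) = cells n"
    unfolding Ls(2) using fin by (auto simp: labels_def cells_def)
  have "distinct is \<Longrightarrow> distinct (concat (map labels is))" for "is"
    by (induction "is") (auto simp: labels_def distinct_map inj_on_def)
  then have dist: "distinct (concat Ls)" unfolding Ls(2) by simp
  have len: "length Ls = length ps" using Ls(1) by (rule list_all2_lengthD)
  have nth: "labelling (Ls ! j) (ps ! j)" "ncross (ps ! j) = length (Ls ! j)" if "j < length ps" for j
  proof -
    show "labelling (Ls ! j) (ps ! j)" using Ls(1) that list_all2_nthD2 by metis
    then show "ncross (ps ! j) = length (Ls ! j)"
      using labelling_nth(1)[of "Ls ! j" "fst (ps ! j)" "snd (ps ! j)"] by (simp add: ncross_def)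
  qed
  let ?T = "rmod_dsum {..<length ps} (\<lambda>j. string_module S (ps ! j) :: (_, nat \<Rightarrow> 'k) right_module)"
  have T: "carrier ?T = (\<Pi>\<^sub>E j\<in>{..<length ps}. {F. \<forall>t\<ge>length (Ls ! j). F t = 0})"
    using nth(2) by (auto simp: rmod_dsum_def string_module_def intro!: PiE_cong)
  define \<Phi> where "\<Phi> f = (\<lambda>j\<in>{..<length ps}. on_strings Ls (coords n f) j)" for f :: "nat \<Rightarrow> (('h set, 'h \<times> 'h) path \<Rightarrow> 'k) set"
  define K where "K = a_kernel (term_module n) (term_module (n + 1)) (boundary_map n :: (nat \<Rightarrow> (('h set, 'h \<times> 'h) path \<Rightarrow> 'k) set) \<Rightarrow> _)"
  define M where "M = (term_module n)\<lparr>carrier := K\<rparr>"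
  define N where "N = (boundary_map (n - 1) :: (nat \<Rightarrow> (('h set, 'h \<times> 'h) path \<Rightarrow> 'k) set) \<Rightarrow> _) ` carrier (term_module (n - 1))"
  have M_ops: "f \<oplus>\<^bsub>M\<^esub> g = f \<oplus>\<^bsub>term_module n\<^esub> g" "ract M f X = ract (term_module n) f X" for f g X
    unfolding M_def by simp_all
  have M_car: "f \<in> carrier M \<longleftrightarrow> f \<in> carrier (term_module n) \<and> coords n f \<in> cycles n" for f
  proof -
    have "boundary_map n f = \<zero>\<^bsub>term_module (n + 1)\<^esub> \<longleftrightarrow> coords n f \<in> cycles n" if f: "f \<in> carrier (term_module n)"
    proof -
      have "boundary_map n f = \<zero>\<^bsub>term_module (n + 1)\<^esub> \<longleftrightarrow> coords (n + 1) (boundary_map n f) = (\<lambda>i x. 0)"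
      proof
        assume "boundary_map n f = \<zero>\<^bsub>term_module (n + 1)\<^esub>"
        then show "coords (n + 1) (boundary_map n f) = (\<lambda>i x. 0)" by (simp only: coords_zero(2))
      next
        assume "coords (n + 1) (boundary_map n f) = (\<lambda>i x. 0)"
        then show "boundary_map n f = \<zero>\<^bsub>term_module (n + 1)\<^esub>"
          by (intro coords_eqI[OF coords_boundary(1)[OF f] coords_zero(1)]) (simp only: coords_zero(2))
      qed
      also have "\<dots> \<longleftrightarrow> coords n f \<in> cycles n"
        unfolding coords_boundary(2)[OF f] cycles_def fun_eq_iff using coords_terms[of n f] by blast
      finally show ?thesis .
    qed
    then show ?thesis unfolding M_def K_def a_kernel_def' by auto
  qed
  have psi_eq: "\<Phi> f = \<Phi> g \<longleftrightarrow> (\<forall>b\<in>cells n. psi (coords n f) b = psi (coords n g) b)" for f g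
  proof
    assume eq: "\<Phi> f = \<Phi> g"
    show "\<forall>b\<in>cells n. psi (coords n f) b = psi (coords n g) b"
    proof
      fix b assume "b \<in> cells n"
      then obtain j t where jt: "j < length Ls" "t < length (Ls ! j)" "Ls ! j ! t = b"
        unfolding set[symmetric] in_set_concat_nth by blast
      then show "psi (coords n f) b = psi (coords n g) b"
        using fun_cong[OF fun_cong[OF eq, of j], of t] len by (simp add: \<Phi>_def on_strings_def)
    qed
  next
    assume eq: "\<forall>b\<in>cells n. psi (coords n f) b = psi (coords n g) b"
    have "Ls ! j ! t \<in> cells n" if "j < length ps" "t < length (Ls ! j)" for j t
      unfolding set[symmetric] in_set_concat_nth using that len by auto
    then show "\<Phi> f = \<Phi> g" using eq by (auto simp: \<Phi>_def on_strings_def fun_eq_iff restrict_def)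
  qed
  have "rmod_iso ?A (rmod_quot M N) ?T"
  proof (rule rmod_quot_iso[where f = \<Phi>])
    fix f assume f: "f \<in> carrier M"
    then have fc: "f \<in> carrier (term_module n)" and fz: "coords n f \<in> cycles n" by (simp_all add: M_car)
    show "\<Phi> f \<in> carrier ?T" unfolding T by (auto simp: \<Phi>_def on_strings_def)
    show "N +>\<^bsub>M\<^esub> f = {g \<in> carrier M. \<Phi> g = \<Phi> f}"
    proof (intro equalityI subsetI)
      fix g assume "g \<in> N +>\<^bsub>M\<^esub> f"
      then obtain h where h: "h \<in> carrier (term_module (n - 1))" "g = boundary_map (n - 1) h \<oplus>\<^bsub>term_module n\<^esub> f"
        by (auto simp: a_r_coset_def' N_def M_ops)
      have bh: "boundary_map (n - 1) h \<in> carrier (term_module n)" "coords n (boundary_map (n - 1) h) = boundary (n - 1) (coords (n - 1) h)"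
        using coords_boundary[OF h(1)] by simp_all
      have g: "g \<in> carrier (term_module n)" "coords n g = (\<lambda>i x. boundary (n - 1) (coords (n - 1) h) i x + coords n f i x)"
        using coords_add[OF bh(1) fc] bh(2) by (simp_all add: h(2))
      have gz: "coords n g \<in> cycles n" unfolding g(2) by (rule cycles_closed[OF boundary_cycle fz])
      moreover have "\<Phi> g = \<Phi> f"
        unfolding psi_eq using psi_eq_iff[OF fz gz] g(2) coords_terms by blast
      ultimately show "g \<in> {g \<in> carrier M. \<Phi> g = \<Phi> f}" using g(1) by (simp add: M_car)
    next
      fix g assume "g \<in> {g \<in> carrier M. \<Phi> g = \<Phi> f}"
      then have g: "g \<in> carrier (term_module n)" "coords n g \<in> cycles n" "\<Phi> g = \<Phi> f" by (simp_all add: M_car)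
      obtain w where w: "w \<in> terms (n - 1)" "coords n g = (\<lambda>i x. boundary (n - 1) w i x + coords n f i x)"
        using g(3) psi_eq_iff[OF fz g(2)] unfolding psi_eq by blast
      obtain h where h: "h \<in> carrier (term_module (n - 1))" "coords (n - 1) h = w"
        using coords_surj[OF w(1)] by blast
      have bh: "boundary_map (n - 1) h \<in> carrier (term_module n)" "coords n (boundary_map (n - 1) h) = boundary (n - 1) w"
        using coords_boundary[OF h(1)] h(2) by simp_all
      have "g = boundary_map (n - 1) h \<oplus>\<^bsub>term_module n\<^esub> f"
        by (rule coords_eqI[OF g(1) coords_add(1)[OF bh(1) fc]])
          (simp add: coords_add(2)[OF bh(1) fc] bh(2) w(2))
      then show "g \<in> N +>\<^bsub>M\<^esub> f" using h(1) by (auto simp: a_r_coset_def' N_def M_ops)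
    qed
    fix g assume g: "g \<in> carrier M"
    then have gc: "g \<in> carrier (term_module n)" and gz: "coords n g \<in> cycles n" by (simp_all add: M_car)
    show "f \<oplus>\<^bsub>M\<^esub> g \<in> carrier M"
      unfolding M_car M_ops using coords_add[OF fc gc] cycles_closed(1)[OF fz gz] by simp
    show "\<Phi> (f \<oplus>\<^bsub>M\<^esub> g) = \<Phi> f \<oplus>\<^bsub>?T\<^esub> \<Phi> g"
      unfolding M_ops \<Phi>_def coords_add(2)[OF fc gc]
      by (auto simp: rmod_dsum_def string_module_def on_strings_def psi_add fun_eq_iff restrict_def)
  next
    fix f X assume f: "f \<in> carrier M" and X: "X \<in> carrier ?A"
    define a where "a = (SOME x. x \<in> X)"
    have fc: "f \<in> carrier (term_module n)" and fz: "coords n f \<in> cycles n" using f by (simp_all add: M_car)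
    note r = coords_ract[OF fc X, folded a_def]
    \<comment> \<open>An algebra element acts by a finite linear combination of paths, so closure of
      the cycles is shown by induction on the set of paths.\<close>
    have "(\<lambda>i x. \<Sum>q\<in>Q. a q * path_act q (coords n f) i x) \<in> cycles n" if "finite Q" for Q
      using that
    proof (induction Q rule: finite_induct)
      case empty
      then show ?case by (simp add: cycles_iff terms_iff)
    next
      case (insert q Q)
      obtain v as where q: "q = (v, as)" by (cases q)
      have "(\<lambda>i x. a q * path_act q (coords n f) i x) \<in> cycles n"
        using path_act_cycles[OF fz, of v as] unfolding q cycles_iff terms_iff by simp
      from cycles_closed(1)[OF this insert.IH] show ?case using insert.hyps by simp
    qed
    moreover have "finite {q. a q \<noteq> 0}"
      using Q.rep(1)[OF X Q.rep_exists[OF X]] by (simp add: a_def Q.carrier_support)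
    ultimately show "ract M f X \<in> carrier M" unfolding M_car M_ops using r by simp
    show "\<Phi> (ract M f X) = ract ?T (\<Phi> f) X"
    proof
      fix j
      show "\<Phi> (ract M f X) j = ract ?T (\<Phi> f) X j"
      proof (cases "j < length ps")
        case j: True
        have "ract ?T (\<Phi> f) X j = ract (string_module S (ps ! j)) (on_strings Ls (coords n f) j) X"
          using j by (simp add: rmod_dsum_def \<Phi>_def)
        also have "\<dots> = (\<lambda>t. \<Sum>q | a q \<noteq> 0. a q * string_path_act S (ps ! j) (on_strings Ls (coords n f) j) q t)"
          by (simp add: string_module_def Let_def a_def)
        also have "\<dots> = (\<lambda>t. \<Sum>q | a q \<noteq> 0. a q * on_strings Ls (path_act q (coords n f)) j t)"
        proof (intro ext sum.cong refl)
          fix t and q :: "('h set, 'h \<times> 'h) path"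
          obtain v as where q: "q = (v, as)" by (cases q)
          show "a q * string_path_act S (ps ! j) (on_strings Ls (coords n f) j) q t = a q * on_strings Ls (path_act q (coords n f)) j t"
            unfolding q string_path_act_psi[OF Ls(1) dist set fz j] ..
        qed
        also have "\<dots> = on_strings Ls (coords n (ract (term_module n) f X)) j"
          unfolding r(2) by (auto simp: on_strings_def fun_eq_iff psi_sum psi_scale)
        finally show ?thesis using j by (simp add: \<Phi>_def M_ops)
      qed (simp add: \<Phi>_def rmod_dsum_def)
    qed
  next
    fix t assume t: "t \<in> carrier ?T"
    \<comment> \<open>Reads t as a function on the cells; distinctness makes the described value
      unique.\<close>
    define F where "F b = (THE y. \<exists>j k. j < length Ls \<and> k < length (Ls ! j) \<and> Ls ! j ! k = b \<and> t j k = y)" for b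
    have F: "F (Ls ! j ! k) = t j k" if "j < length Ls" "k < length (Ls ! j)" for j k
      unfolding F_def using that distinct_concat_nth[OF dist] by (intro the_equality) blast+
    obtain u where u: "u \<in> cycles n" "\<forall>b\<in>cells n. psi u b = F b" using psi_surj[of n F] by blast
    then have "u \<in> terms n" by (simp add: cycles_def)
    then obtain f where f: "f \<in> carrier (term_module n)" "coords n f = u" using coords_surj by blast
    have tx: "t \<in> extensional {..<length ps}" and t0: "\<And>j k. j < length ps \<Longrightarrow> length (Ls ! j) \<le> k \<Longrightarrow> t j k = 0"
      using t unfolding T by (auto simp: PiE_iff)
    have "\<Phi> f = t"
    proof (rule extensionalityI[OF _ tx])
      fix j assume j: "j \<in> {..<length ps}"
      have "on_strings Ls u j k = t j k" for k
      proof (cases "k < length (Ls ! j)")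
        case True
        then have "Ls ! j ! k \<in> cells n" unfolding set[symmetric] in_set_concat_nth using j len by auto
        then show ?thesis using True F[of j k] j len u(2) by (simp add: on_strings_def)
      qed (use t0 j in \<open>simp add: on_strings_def\<close>)
      then show "\<Phi> f j = t j" using j f(2) by (auto simp: \<Phi>_def)
    qed (simp add: \<Phi>_def)
    then show "\<exists>x\<in>carrier M. \<Phi> x = t" using f u(1) by (intro bexI[of _ f]) (auto simp: M_car)
  qed
  then have iso: "rmod_iso (surface_algebra S) (cohomology (curve_complex S (surface_algebra S) c) n) ?T"
    unfolding cohomology_def K_def[symmetric] N_def[symmetric] M_def[symmetric] by (simp only: surface_algebra_def)
  have perm: "permissible S p \<and> ncross p \<noteq> 0" if p: "p \<in> set ps" for p
  proof -
    obtain j where j: "j < length ps" "p = ps ! j" using p by (auto simp: in_set_conv_nth)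
    have "Ls ! j \<in> set Ls" using j(1) len by simp
    then have "set (Ls ! j) \<subseteq> set (concat Ls)" by auto
    then show ?thesis using labelling_permissible[OF nth(1)[OF j(1)]] j p unfolding set by (auto simp: ps_def)
  qed
  have "mset ps = nontrivial_curves (suppl_union S c trunc_start trunc_end (sorted_list_of_set (indices_at c n)))"
    by (simp add: ps_def nontrivial_curves_def)
  with iso perm show ?thesis unfolding is_curves_of_def by blast
qed

end

theorem theorem1p2:
  fixes S :: "('p, 'h) ribbon_surface" and c :: "'h graded_curve"
    and A :: "('h, 'k::alg_closed_field) surface_alg"
  assumes "marked_ribbon_surface S" and "A = surface_algebra S" and "admissible S c"
  shows "\<forall>n::int. \<exists>r s :: nat \<Rightarrow> nat.
    (\<forall>i. 1 \<le> i \<and> enat i \<le> len c \<longrightarrow> r i \<le> s i \<and> s i \<le> ncross (cprojD S c i) + 1) \<and>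
    is_curves_of S A (cohomology (curve_complex S A c) n)
      (nontrivial_curves (suppl_union S c r s (sorted_list_of_set (indices_at c n))))"
proof
  fix n :: int
  interpret surface_curve S c using assms by unfold_locales
  \<comment> \<open>The bounds are available for indices of a given degree; i lies in degree
    \<open>- idx c i\<close>, whatever n is.\<close>
  have "trunc_start i \<le> trunc_end i \<and> trunc_end i \<le> ncross (cprojD S c i) + 1"
    if "1 \<le> i \<and> enat i \<le> len c" for i
    using trunc_bounds[of i "- idx c i"] that by (simp add: indices_at_def)
  then show "\<exists>r s :: nat \<Rightarrow> nat.
    (\<forall>i. 1 \<le> i \<and> enat i \<le> len c \<longrightarrow> r i \<le> s i \<and> s i \<le> ncross (cprojD S c i) + 1) \<and>
    is_curves_of S A (cohomology (curve_complex S A c) n)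
      (nontrivial_curves (suppl_union S c r s (sorted_list_of_set (indices_at c n))))"
    using cohomology_curves[of n] unfolding assms(2) by blast
qed

end
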